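(* Let $n$ and $k$ be positive integers and let $c=(1\,2\cdots 2n)$. Consider $NC(B_n)$ as the sublattice of $NC(A_{2n-1})$ fixed under conjugation by $c^n$, so that $NC^{(k)}(B_n)$ is the subposet of $NC^{(k)}(A_{2n-1})$ of multichains all of whose entries commute with $c^n$. Then the map $$(\pi_1,\ldots,\pi_k)\mapsto K^{-1}\Big\langle K^{\{\pi_2\}}(\{\pi_1\}),\ \ldots,\ K^{\{\pi_k\}}(\{\pi_{k-1}\}),\ K(\{\pi_k\})\Big\rangle$$ on $NC^{(k)}(A_{2n-1})$, when restricted to $NC^{(k)}(B_n)$, is an isomorphism of posets $NC^{(k)}(B_n)\cong\widetilde{NC}^{(k)}(2n)$.
   Context: Let $A_{2n-1}$ be the symmetric group on $[2n]=\{1,\ldots,2n\}$ (permutations multiplied right to left), $T$ its set of transpositions, $\ell_T$ the word length with respect to $T$, $\pi\leq_T\mu\iff\ell_T(\mu)=\ell_T(\pi)+\ell_T(\pi^{-1}\mu)$, and $NC(A_{2n-1})=\{w:1\leq_Tw\leq_Tc\}$. $NC^{(k)}(A_{2n-1})$ is the set of sequences $\pi_1\leq_T\cdots\leq_T\pi_k$ in $NC(A_{2n-1})$, with $(\pi)_k\leq(\mu)_k$ iff $\mu_i^{-1}\mu_{i+1}\leq_T\pi_i^{-1}\pi_{i+1}$ for $1\leq i\leq k$ ($\pi_{k+1}=\mu_{k+1}=c$). $B_n$ is the signed permutation group, the centralizer of the antipodal map in the permutations of $\{\pm1,\ldots,\pm n\}$; identifying $j\leftrightarrow j$ and $-j\leftrightarrow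 n+j$ ($1\le j\le n$) embeds $B_n$ in $A_{2n-1}$ as the centralizer of $c^n$, and $c$ corresponds to the Coxeter element $(1,2,\ldots,n,-1,-2,\ldots,-n)$ of $B_n$. $NC(B_n)$ (the interval from $1$ to this Coxeter element in the absolute order of $B_n$) is identified with $\{\pi\in NC(A_{2n-1}):c^n\pi c^{-n}=\pi\}$ with the induced order. $\{\pi\}$ denotes the partition of $[2n]$ into orbits of $\pi$. A partition of $[N]$ is noncrossing if there are no $a<b<c<d$ with $a,c$ in one block and $b,d$ in a different block; $NC(N)$ is the lattice of noncrossing partitions of $[N]$ under refinement. $\widetilde{NC}^{(k)}(2n)$ is the induced subposet of $NC(2kn)$ of partitions whose blocks all have cardinality divisible by $k$ and which are invariant under the antipodal map $j\mapsto j+kn \pmod{2kn}$. Kreweras complement: for $\mathcal P\in NC(N)$, $K(\mathcal P)$ is the coarsest partition $\mathcal Q$ of $[N]$ such that the partition $(2\mathcal P-1)\cup(2\mathcal Q)$ of $[2N]$ is noncrossing; $K$ is an anti-automorphism of $NC(N)$. For a finite set $X$ of integers, $K_X$ is the Kreweras complement on noncrossing partitions of $X$, transported along the order-preserving bijection $X\leftrightarrow[|X|]$. For $\mathcal P\leq\mathcal N=\{N_1,\ldots,N_t\}$ in $NC(N)$, $K^{\mathcal N}(\mathcal P)=\bigcup_{i}K_{N_i}(\mathcal P|_{N_i})$. In the map above the inner $K$ is on $NC(2n)$ and the outer $K^{-1}$ is the inverse of $K$ on $NC(2kn)$. For partitions $\mathcal Q_1,\ldots,\mathcal Q_k$ of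 $[2n]$, $\langle\mathcal Q_1,\ldots,\mathcal Q_k\rangle=\bigcup_{i=1}^k(k\mathcal Q_i-(k-i))$, a partition of $[2kn]$. *)

theory Defs
  imports
    "HOL-Library.Disjoint_Sets"
    "HOL-Combinatorics.Combinatorics"
    "HOL-Combinatorics.Orbits"
begin

definition poset_iso ::
  "'a set \<Rightarrow> ('a \<Rightarrow> 'a \<Rightarrow> bool) \<Rightarrow> 'b set \<Rightarrow> ('b \<Rightarrow> 'b \<Rightarrow> bool) \<Rightarrow> ('a \<Rightarrow> 'b) \<Rightarrow> bool" where
  "poset_iso A le_A B le_B f \<longleftrightarrow>
     partial_order_on A {(x, y). x \<in> A \<and> y \<in> A \<and> le_A x y} \<and>
     partial_order_on B {(x, y). x \<in> B \<and> y \<in> B \<and> le_B x y} \<and>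
     bij_betw f A B \<and>
     (\<forall>x\<in>A. \<forall>y\<in>A. le_A x y \<longleftrightarrow> le_B (f x) (f y))"

text \<open>Elements of the symmetric group on \<open>[N] = {1..N}\<close> are functions \<open>w\<close> with
  \<open>w permutes {1..N}\<close>; they fix all other numbers. The product of the group is \<open>\<circ>\<close>.\<close>

definition transpositions :: "nat \<Rightarrow> (nat \<Rightarrow> nat) set" where
  "transpositions N = {transpose a b | a b. a \<in> {1..N} \<and> b \<in> {1..N} \<and> a \<noteq> b}"

definition word_length :: "('a \<Rightarrow> 'a) set \<Rightarrow> ('a \<Rightarrow> 'a) \<Rightarrow> nat" where
  "word_length S w = (LEAST m. \<exists>ts. length ts = m \<and> set ts \<subseteq> S \<and> w = foldr (\<circ>) ts id)"

definition abs_le :: "nat \<Rightarrow> (nat \<Rightarrow> nat) \<Rightarrow> (nat \<Rightarrow> nat) \<Rightarrow> bool" where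
  "abs_le N \<pi> \<mu> \<longleftrightarrow>
     word_length (transpositions N) \<mu> =
     word_length (transpositions N) \<pi> + word_length (transpositions N) (inv \<pi> \<circ> \<mu>)"

definition long_cycle :: "nat \<Rightarrow> nat \<Rightarrow> nat" where
  "long_cycle N = cycle_of_list [1..<Suc N]"

definition NC_A :: "nat \<Rightarrow> (nat \<Rightarrow> nat) set" where
  "NC_A N = {w. w permutes {1..N} \<and> abs_le N id w \<and> abs_le N w (long_cycle N)}"

text \<open>The multichain \<open>\<pi>\<^sub>1 \<le> \<dots> \<le> \<pi>\<^sub>k\<close> is the list \<open>ps\<close> with \<open>ps ! i = \<pi>\<^sub>i\<^sub>+\<^sub>1\<close>; appending the long
  cycle supplies the convention for the index \<open>k + 1\<close>.\<close>

definition NCk_A :: "nat \<Rightarrow> nat \<Rightarrow> (nat \<Rightarrow> nat) list set" where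
  "NCk_A N k = {ps. length ps = k \<and> set ps \<subseteq> NC_A N \<and> successively (abs_le N) ps}"

definition NCk_le :: "nat \<Rightarrow> (nat \<Rightarrow> nat) list \<Rightarrow> (nat \<Rightarrow> nat) list \<Rightarrow> bool" where
  "NCk_le N ps qs \<longleftrightarrow>
     (\<forall>i < length ps.
        abs_le N (inv (qs ! i) \<circ> (qs @ [long_cycle N]) ! Suc i)
                 (inv (ps ! i) \<circ> (ps @ [long_cycle N]) ! Suc i))"

text \<open>\<open>B\<^sub>n\<close> is the centralizer of \<open>c\<^sup>n\<close> in the symmetric group on \<open>[2n]\<close>.\<close>

definition NCk_B :: "nat \<Rightarrow> nat \<Rightarrow> (nat \<Rightarrow> nat) list set" where
  "NCk_B n k = {ps \<in> NCk_A (2 * n) k.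
     \<forall>\<pi> \<in> set ps. \<pi> \<circ> (long_cycle (2 * n) ^^ n) = (long_cycle (2 * n) ^^ n) \<circ> \<pi>}"

definition noncrossing :: "nat set set \<Rightarrow> bool" where
  "noncrossing P \<longleftrightarrow>
     \<not> (\<exists>A\<in>P. \<exists>B\<in>P. A \<noteq> B \<and>
          (\<exists>a b c d. a < b \<and> b < c \<and> c < d \<and> a \<in> A \<and> c \<in> A \<and> b \<in> B \<and> d \<in> B))"

definition NC :: "nat \<Rightarrow> nat set set set" where
  "NC N = {P. partition_on {1..N} P \<and> noncrossing P}"

definition antipodal :: "nat \<Rightarrow> nat \<Rightarrow> nat" where
  "antipodal m j = (if j \<le> m then j + m else j - m)"

text \<open>The map \<open>antipodal (k * n)\<close> is \<open>j \<mapsto> j + kn (mod 2kn)\<close> with representatives in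
  \<open>{1..2 * k * n}\<close>.\<close>

definition NC_tilde :: "nat \<Rightarrow> nat \<Rightarrow> nat set set set" where
  "NC_tilde k n = {P \<in> NC (2 * k * n).
     (\<forall>B\<in>P. k dvd card B) \<and> (\<lambda>B. antipodal (k * n) ` B) ` P = P}"

definition cycle_partition :: "nat \<Rightarrow> (nat \<Rightarrow> nat) \<Rightarrow> nat set set" where
  "cycle_partition N \<pi> = orbit \<pi> ` {1..N}"

definition kreweras_candidates :: "nat \<Rightarrow> nat set set \<Rightarrow> nat set set set" where
  "kreweras_candidates N P =
     {Q. partition_on {1..N} Q \<and>
         (\<lambda>B. (\<lambda>j. 2 * j - 1) ` B) ` P \<union> (\<lambda>B. (\<lambda>j. 2 * j) ` B) ` Q \<in> NC (2 * N)}"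

definition kreweras :: "nat \<Rightarrow> nat set set \<Rightarrow> nat set set" where
  "kreweras N P = (THE Q. Q \<in> kreweras_candidates N P \<and>
     (\<forall>R \<in> kreweras_candidates N P. refines {1..N} R Q))"

definition kreweras_inv :: "nat \<Rightarrow> nat set set \<Rightarrow> nat set set" where
  "kreweras_inv N = inv_into (NC N) (kreweras N)"

text \<open>For finite \<open>X\<close>, \<open>rank_in X\<close> is the order-preserving bijection from \<open>X\<close> onto
  \<open>{1..card X}\<close>.\<close>

definition rank_in :: "nat set \<Rightarrow> nat \<Rightarrow> nat" where
  "rank_in X x = card {y \<in> X. y \<le> x}"

definition kreweras_on :: "nat set \<Rightarrow> nat set set \<Rightarrow> nat set set" where
  "kreweras_on X P =
     (\<lambda>B. inv_into X (rank_in X) ` B) ` kreweras (card X) ((\<lambda>B. rank_in X ` B) ` P)"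

definition restrict_partition :: "nat set set \<Rightarrow> nat set \<Rightarrow> nat set set" where
  "restrict_partition P X = (\<lambda>B. B \<inter> X) ` P - {{}}"

definition rel_kreweras :: "nat set set \<Rightarrow> nat set set \<Rightarrow> nat set set" where
  "rel_kreweras M P = (\<Union>X\<in>M. kreweras_on X (restrict_partition P X))"

text \<open>Since the list is indexed from 0, the shift \<open>k - i\<close> becomes \<open>k - Suc i\<close>.\<close>

definition shuffle_partition :: "nat set set list \<Rightarrow> nat set set" where
  "shuffle_partition Qs =
     (\<Union>i<length Qs. (\<lambda>B. (\<lambda>j. length Qs * j - (length Qs - Suc i)) ` B) ` (Qs ! i))"

definition kreweras_sequence :: "nat \<Rightarrow> (nat \<Rightarrow> nat) list \<Rightarrow> nat set set list" where
  "kreweras_sequence N ps =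
     map (\<lambda>i. rel_kreweras (cycle_partition N (ps ! Suc i)) (cycle_partition N (ps ! i)))
       [0..<length ps - 1]
     @ [kreweras N (cycle_partition N (last ps))]"

definition nabla :: "nat \<Rightarrow> (nat \<Rightarrow> nat) list \<Rightarrow> nat set set" where
  "nabla N ps = kreweras_inv (length ps * N) (shuffle_partition (kreweras_sequence N ps))"

end

theory Submission
  imports Defs
begin

text \<open>
  Write \<open>c\<close> for the long cycle of \<open>{1..N}\<close>, \<open>N = 2 n\<close>, and \<open>C\<close> for that of \<open>{1..k N}\<close>. The proof replaces
  noncrossing partitions and their Kreweras complements by permutations, where the map becomes the
  formula \<open>C s\<^sup>-\<^sup>1\<close> with \<open>s\<close> the shuffle of the quotients \<open>\<rho>\<^sub>i = \<pi>\<^sub>i\<^sup>-\<^sup>1 \<pi>\<^sub>i\<^sub>+\<^sub>1\<close>.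

  The dictionary rests on a local description of the elements \<open>w\<close> below \<open>c\<close> in the absolute order
  (\<open>nc_perm\<close>): the points strictly between \<open>x\<close> and \<open>w x\<close> on the circle form a union of orbits. It holds for
  \<open>c\<close> and survives cutting an orbit in two (\<open>nc_perm_cut\<close>), and every element below \<open>c\<close> arises from it by
  such cuts (\<open>abs_le_descend\<close>). Conversely, if \<open>\<pi>\<close> and \<open>\<mu>\<close> have this property and the orbits of \<open>\<pi>\<close> refine
  those of \<open>\<mu>\<close>, then inside a \<open>\<mu>\<close>-orbit two points \<open>y < z\<close> share an orbit of \<open>\<pi>\<^sup>-\<^sup>1 \<mu>\<close> iff the points in
  \<open>(y, z]\<close> form a union of \<open>\<pi>\<close>-orbits (\<open>quotient_orbit_iff\<close>). This has two consequences. Counting classes gives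
  \<open>\<pi> \<le> \<mu>\<close> (\<open>nc_perm_abs_le\<close>), so the absolute order is refinement of orbit partitions; and the condition on
  \<open>(y, z]\<close> is exactly that \<open>y\<close> and \<open>z\<close> may share a block interleaved with the \<open>\<pi>\<close>-orbits, so the orbits of
  \<open>\<pi>\<^sup>-\<^sup>1 \<mu>\<close> are the relative Kreweras complement (\<open>rel_kreweras_cycles\<close>).

  The shuffle \<open>s\<close> acts on the \<open>i\<close>-th residue class modulo \<open>k\<close> like \<open>\<rho>\<^sub>i\<close>, while \<open>C\<close> moves each class to the
  next and applies \<open>c\<close> once per round. Hence \<open>C s\<^sup>-\<^sup>1\<close> also moves each class to the next, so that its orbits have
  cardinality divisible by \<open>k\<close>, and its first return to the first class is \<open>c \<rho>\<^sub>k\<^sup>-\<^sup>1 \<dots> \<rho>\<^sub>1\<^sup>-\<^sup>1 = \<pi>\<^sub>1\<close>. It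
  therefore has as many orbits as \<open>\<pi>\<^sub>1\<close>, and \<open>s\<close> lies below \<open>C\<close> precisely if \<open>\<pi>\<^sub>1 \<rho>\<^sub>1 \<dots> \<rho>\<^sub>k\<close> is a factorization
  of \<open>c\<close> of minimal length (\<open>nc_perm_shuffle_perm_iff\<close>), which means that the \<open>\<pi>\<^sub>i\<close> form a multichain. In the
  other direction, a noncrossing \<open>w\<close> with orbits of cardinality divisible by \<open>k\<close> moves each class to the next,
  because its gaps are unions of orbits (\<open>shifts_of_card_orbit_dvd\<close>); so \<open>w\<^sup>-\<^sup>1 C\<close> preserves the classes and is a
  shuffle. The order is respected since \<open>s \<mapsto> C s\<^sup>-\<^sup>1\<close> reverses the absolute order and lengths of shuffles are
  additive. Finally \<open>C\<close> raised to \<open>k n\<close> is the antipodal map and acts on each class like \<open>c\<^sup>n\<close>, so commutation with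
  \<open>c\<^sup>n\<close> corresponds to antipodal invariance (\<open>chain_commute_iff\<close>).
\<close>

section \<open>Orbits and stable sets\<close>

text \<open>The bijections considered satisfy \<open>w ` S = S\<close> on such sets. Stating this as an equivalence
  makes closure under all Boolean operations immediate; the stable sets are the unions of orbits.\<close>

definition stable :: "('a \<Rightarrow> 'a) \<Rightarrow> 'a set \<Rightarrow> bool" where
  "stable w S \<longleftrightarrow> (\<forall>x. w x \<in> S \<longleftrightarrow> x \<in> S)"

lemma stable_Int: "stable w S \<Longrightarrow> stable w T \<Longrightarrow> stable w (S \<inter> T)"
  and stable_Diff: "stable w S \<Longrightarrow> stable w T \<Longrightarrow> stable w (S - T)"
  and stable_Un: "stable w S \<Longrightarrow> stable w T \<Longrightarrow> stable w (S \<union> T)"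
  by (auto simp: stable_def)

lemma stable_orbit_iff:
  assumes "stable w S" "y \<in> orbit w x"
  shows "y \<in> S \<longleftrightarrow> x \<in> S"
  using assms(2,1) by induction (auto simp: stable_def)

lemma stableI_finite:
  assumes "inj w" "finite S" "w ` S \<subseteq> S"
  shows "stable w S"
proof -
  have "w ` S = S"
    using assms by (intro endo_inj_surj) (auto intro: inj_on_subset)
  then show ?thesis
    using assms(1) by (metis inj_image_mem_iff stable_def)
qed

lemma permutation_of_permutes: "w permutes {1..N::nat} \<Longrightarrow> permutation w"
  by (auto simp: permutation_permutes)

lemma self_in_orbit: "w permutes {1..N::nat} \<Longrightarrow> x \<in> orbit w x"
  by (simp add: permutation_of_permutes permutation_self_in_orbit)

lemma orbit_sym:
  assumes "w permutes {1..N::nat}" "y \<in> orbit w x" shows "x \<in> orbit w y"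
  using assms self_in_orbit orbit_swap by metis

lemma orbit_eqI_mem:
  assumes "w permutes {1..N::nat}" "y \<in> orbit w x" shows "orbit w y = orbit w x"
  using assms by (meson orbit_sym orbit_trans subsetI subset_antisym)

lemma orbit_eq_iff:
  assumes "w permutes {1..N::nat}" shows "orbit w y = orbit w x \<longleftrightarrow> y \<in> orbit w x"
  using orbit_eqI_mem[OF assms, of y x] self_in_orbit[OF assms, of y] by auto

lemma stable_orbit:
  assumes "w permutes {1..N::nat}" shows "stable w (orbit w x)"
  unfolding stable_def
proof (intro allI iffI)
  fix y
  have y: "w y \<in> orbit w y" by (rule orbit.base)
  show "y \<in> orbit w x" if "w y \<in> orbit w x"
    using orbit_trans[OF orbit_sym[OF assms y] that] .
  show "w y \<in> orbit w x" if "y \<in> orbit w x" using that by (rule orbit.step)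
qed

lemma stable_iff_orbit_subset:
  assumes "w permutes {1..N::nat}"
  shows "stable w S \<longleftrightarrow> (\<forall>x\<in>S. orbit w x \<subseteq> S)"
proof
  show "stable w S \<Longrightarrow> \<forall>x\<in>S. orbit w x \<subseteq> S" by (auto simp: stable_orbit_iff)
  assume R: "\<forall>x\<in>S. orbit w x \<subseteq> S"
  show "stable w S" unfolding stable_def
  proof (intro allI iffI)
    fix x
    have "x \<in> orbit w (w x)" using orbit_sym[OF assms orbit.base] .
    then show "w x \<in> S \<Longrightarrow> x \<in> S" using R by (metis subsetD)
    show "x \<in> S \<Longrightarrow> w x \<in> S" using R orbit.base[of w x] by (metis subsetD)
  qed
qed

lemma orbit_subset_range: "w permutes {1..N::nat} \<Longrightarrow> x \<in> {1..N} \<Longrightarrow> orbit w x \<subseteq> {1..N}"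
  by (rule permutes_orbit_subset)

lemma partition_on_orbits:
  assumes "w permutes {1..N::nat}" "stable w X" shows "partition_on X (orbit w ` X)"
proof (rule partition_onI)
  have "orbit w x \<subseteq> X" if "x \<in> X" for x using stable_iff_orbit_subset[OF assms(1)] assms(2) that by simp
  then show "\<Union> (orbit w ` X) = X"
    using self_in_orbit[OF assms(1)] by auto
  show "\<And>A B. A \<in> orbit w ` X \<Longrightarrow> B \<in> orbit w ` X \<Longrightarrow> A \<noteq> B \<Longrightarrow> disjnt A B"
    unfolding disjnt_def using orbit_eqI_mem[OF assms(1)] by (metis (no_types, lifting) disjoint_iff imageE)
  show "{} \<notin> orbit w ` X"
  proof
    assume "{} \<in> orbit w ` X"
    then obtain x where "{} = orbit w x" by (rule imageE)
    then show False using orbit_nonempty[of w x] by simp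
  qed
qed

lemma stable_range: "w permutes A \<Longrightarrow> stable w A"
  by (simp add: stable_def permutes_in_image)

lemma partition_on_cycles: "w permutes {1..N} \<Longrightarrow> partition_on {1..N} (cycle_partition N w)"
  unfolding cycle_partition_def by (intro partition_on_orbits stable_range)

lemma finite_cycle_partition [simp]: "finite (cycle_partition N w)"
  by (simp add: cycle_partition_def)

lemma cyc_le: "card (cycle_partition N w) \<le> N"
  unfolding cycle_partition_def using card_image_le[of "{1..N}" "orbit w"] by simp

lemma refines_cycles_iff:
  assumes "u permutes {1..N}" "v permutes {1..N}"
  shows "refines {1..N} (cycle_partition N u) (cycle_partition N v) \<longleftrightarrow> (\<forall>x. orbit u x \<subseteq> orbit v x)"
proof
  assume L: "refines {1..N} (cycle_partition N u) (cycle_partition N v)"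
  show "\<forall>x. orbit u x \<subseteq> orbit v x"
  proof
    fix x
    show "orbit u x \<subseteq> orbit v x"
    proof (cases "x \<in> {1..N}")
      case True
      then obtain y where y: "orbit u x \<subseteq> orbit v y"
        using L unfolding refines_def cycle_partition_def by (metis image_iff)
      then have "x \<in> orbit v y" using self_in_orbit[OF assms(1), of x] by auto
      then show ?thesis using y orbit_eqI_mem[OF assms(2)] by simp
    next
      case False
      then show ?thesis
        using assms orbit_eq_singleton_iff[of u x] orbit_eq_singleton_iff[of v x]
        by (simp add: permutes_not_in)
    qed
  qed
next
  assume "\<forall>x. orbit u x \<subseteq> orbit v x"
  then show "refines {1..N} (cycle_partition N u) (cycle_partition N v)"
    unfolding refines_def using partition_on_cycles[OF assms(1)] partition_on_cycles[OF assms(2)]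
    by (auto simp: cycle_partition_def)
qed

section \<open>Word length and number of orbits\<close>

abbreviation cyc :: "nat \<Rightarrow> (nat \<Rightarrow> nat) \<Rightarrow> nat" where
  "cyc N w \<equiv> card (cycle_partition N w)"

abbreviation tlen :: "nat \<Rightarrow> (nat \<Rightarrow> nat) \<Rightarrow> nat" where
  "tlen N w \<equiv> word_length (transpositions N) w"

text \<open>Only the orbits of \<open>a\<close> and \<open>b\<close> are affected when \<open>w\<close> is multiplied by the transposition
  of \<open>a\<close> and \<open>b\<close>, so the two orbit counts differ as the counts on the union of these orbits do.\<close>

lemma cyc_mult_transpose:
  assumes w: "w permutes {1..N}" and ab: "a \<in> {1..N}" "b \<in> {1..N}"
    and A: "A = orbit w a \<union> orbit w b" and w': "w' = w \<circ> transpose a b"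
  shows "cyc N w' + card (orbit w ` A) = cyc N w + card (orbit w' ` A)"
    and "orbit w' ` A \<subseteq> {orbit w' a, orbit w' b}"
    and "orbit w ` A = {orbit w a, orbit w b}"
    and "\<And>x. orbit w' x \<subseteq> (if x \<in> A then A else orbit w x)"
proof -
  have p: "w' permutes {1..N}"
    unfolding w' by (intro permutes_compose permutes_swap_id w ab)
  have memA: "a \<in> A" "b \<in> A" using self_in_orbit[OF w] by (auto simp: A)
  have st: "stable w A" unfolding A by (intro stable_Un stable_orbit[OF w])
  have st': "stable w' A"
    using st memA unfolding stable_def w' by (auto simp: transpose_def)
  have sub: "A \<subseteq> {1..N}" using orbit_subset_range[OF w] ab by (auto simp: A)
  have out: "orbit w x = orbit w' x" if "x \<notin> A" for x
  proof (rule orbit_cong0[of _ "- A"])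
    show "x \<in> - A" using that by simp
    show "w \<in> - A \<rightarrow> - A" using st by (auto simp: stable_def)
    show "\<And>y. y \<in> - A \<Longrightarrow> w y = w' y" using memA by (auto simp: w' transpose_def)
  qed
  have inn: "orbit u x \<subseteq> A" if "x \<in> A" "stable u A" for u x
    using that by (auto simp: stable_orbit_iff)
  have split: "cyc N u = card (orbit u ` A) + card (orbit u ` ({1..N} - A))"
    if u: "u permutes {1..N}" "stable u A" for u
  proof -
    have "cycle_partition N u = orbit u ` A \<union> orbit u ` ({1..N} - A)"
      unfolding cycle_partition_def image_Un[symmetric] using sub by (simp add: Un_absorb1)
    moreover have "orbit u ` A \<inter> orbit u ` ({1..N} - A) = {}"
    proof -
      have "orbit u x \<noteq> orbit u y" if "x \<in> A" "y \<notin> A" for x y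
        using inn[OF that(1) u(2)] self_in_orbit[OF u(1), of y] that(2) by auto
      then show ?thesis by fastforce
    qed
    moreover have "finite A" using sub by (rule finite_subset) simp
    ultimately show ?thesis by (simp add: card_Un_disjoint)
  qed
  have "orbit w ` ({1..N} - A) = orbit w' ` ({1..N} - A)"
    using out by (auto intro!: image_cong)
  then show "cyc N w' + card (orbit w ` A) = cyc N w + card (orbit w' ` A)"
    using split[OF w st] split[OF p st'] by simp
  show "orbit w ` A = {orbit w a, orbit w b}"
  proof
    show "orbit w ` A \<subseteq> {orbit w a, orbit w b}" using orbit_eqI_mem[OF w] by (auto simp: A)
    show "{orbit w a, orbit w b} \<subseteq> orbit w ` A" using memA by auto
  qed
  show "orbit w' ` A \<subseteq> {orbit w' a, orbit w' b}"
  proof -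
    have "a \<in> orbit w' x \<or> b \<in> orbit w' x" if "x \<in> A" for x
    proof (rule ccontr)
      assume n: "\<not> (a \<in> orbit w' x \<or> b \<in> orbit w' x)"
      have "orbit w x = orbit w' x"
      proof (rule orbit_cong)
        show "x \<in> orbit w' x" using self_in_orbit[OF p] .
        show "\<And>s. s \<in> orbit w' x \<Longrightarrow> w s = w' s" using n by (auto simp: w' transpose_def)
      qed
      moreover have "a \<in> orbit w x \<or> b \<in> orbit w x"
        using that orbit_sym[OF w] unfolding A by (metis UnE)
      ultimately show False using n by simp
    qed
    then show ?thesis using orbit_eqI_mem[OF p] by (metis image_subsetI insert_iff)
  qed
  show "\<And>x. orbit w' x \<subseteq> (if x \<in> A then A else orbit w x)"
    using inn[OF _ st'] out by auto
qed

lemma cyc_mult_transpose_ge: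
  assumes "w permutes {1..N}" "a \<in> {1..N}" "b \<in> {1..N}"
  shows "cyc N w \<le> Suc (cyc N (w \<circ> transpose a b))"
proof -
  let ?A = "orbit w a \<union> orbit w b" and ?w = "w \<circ> transpose a b"
  note C = cyc_mult_transpose[OF assms refl refl]
  have "finite ?A" using assms by (meson finite_UnI finite_orbit self_in_orbit)
  moreover have "?A \<noteq> {}" using orbit_nonempty[of w a] by auto
  ultimately have "0 < card (orbit ?w ` ?A)" by (simp add: card_gt_0_iff)
  moreover have "card (orbit w ` ?A) \<le> 2"
    unfolding C(3) by (simp add: card_insert_if)
  ultimately show ?thesis using C(1) by linarith
qed

text \<open>If \<open>a\<close> and \<open>b\<close> were in different orbits of \<open>w\<close>, these two orbits would be replaced by at most
  two orbits of the product, because each of the new ones contains \<open>a\<close> or \<open>b\<close>.\<close>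

lemma cyc_increase_same_orbit:
  assumes "w permutes {1..N}" "a \<in> {1..N}" "b \<in> {1..N}" "cyc N w < cyc N (w \<circ> transpose a b)"
  shows "b \<in> orbit w a"
proof (rule ccontr)
  let ?A = "orbit w a \<union> orbit w b" and ?w = "w \<circ> transpose a b"
  note C = cyc_mult_transpose[OF assms(1-3) refl refl]
  assume "b \<notin> orbit w a"
  then have "orbit w a \<noteq> orbit w b" using orbit_eq_iff[OF assms(1)] by metis
  then have "card (orbit w ` ?A) = 2" unfolding C(3) by simp
  moreover have "card (orbit ?w ` ?A) \<le> card {orbit ?w a, orbit ?w b}"
    using C(2) by (intro card_mono) auto
  moreover have "card {orbit ?w a, orbit ?w b} \<le> 2" by (simp add: card_insert_if)
  ultimately show False using C(1) assms(4) by linarith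
qed

lemma orbit_mult_transpose_subset:
  assumes "w permutes {1..N::nat}" "a \<in> {1..N}" "b \<in> {1..N}" "b \<in> orbit w a"
  shows "orbit (w \<circ> transpose a b) x \<subseteq> orbit w x"
proof -
  have "orbit w b = orbit w a" by (rule orbit_eqI_mem[OF assms(1,4)])
  then show ?thesis
    using cyc_mult_transpose(4)[OF assms(1-3) refl refl, of x] orbit_eqI_mem[OF assms(1), of x a]
    by (auto split: if_splits)
qed

text \<open>The product fixes \<open>w b\<close>, and \<open>b\<close> remains in the rest of the former orbit, which is therefore
  cut into at least two.\<close>

lemma cyc_split_off:
  assumes w: "w permutes {1..N}" and b: "b \<in> {1..N}" "w b \<noteq> b"
  shows "cyc N w < cyc N (w \<circ> transpose (w b) b)"
proof -
  define a where "a = w b"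
  let ?A = "orbit w a \<union> orbit w b" and ?w = "w \<circ> transpose a b"
  have a: "a \<in> {1..N}" unfolding a_def using b w permutes_in_image by metis
  note C = cyc_mult_transpose[OF w a b(1) refl refl]
  have "orbit w a = orbit w b" unfolding a_def using orbit.base[of w b] orbit_eqI_mem[OF w] by simp
  then have 1: "card (orbit w ` ?A) = 1" unfolding C(3) by simp
  have p: "?w permutes {1..N}"
    by (intro permutes_compose permutes_swap_id w a b)
  have "?w a = a" by (simp add: a_def)
  then have "orbit ?w a = {a}" by (simp add: orbit_eq_singleton_iff)
  then have "orbit ?w a \<noteq> orbit ?w b" using self_in_orbit[OF p, of b] b(2) unfolding a_def by (metis singletonD)
  then have "card {orbit ?w a, orbit ?w b} = 2" by simp
  moreover have "{orbit ?w a, orbit ?w b} \<subseteq> orbit ?w ` ?A" using self_in_orbit[OF w] by simp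
  moreover have "finite ?A" using w by (meson finite_UnI finite_orbit self_in_orbit)
  ultimately have "2 \<le> card (orbit ?w ` ?A)" by (metis card_mono finite_imageI)
  then show ?thesis using C(1) 1 unfolding a_def by linarith
qed

lemma cyc_id: "cyc N id = N"
proof -
  have "orbit (id :: nat \<Rightarrow> nat) x = {x}" for x by (simp add: orbit_eq_singleton_iff)
  then have "cycle_partition N id = (\<lambda>x. {x}) ` {1..N}" by (auto simp: cycle_partition_def)
  then show ?thesis by (simp add: card_image)
qed

lemma foldr_comp_Nil: "foldr (\<circ>) [] id = id"
  by simp

lemma foldr_comp_append: "foldr (\<circ>) (ts @ us) id = foldr (\<circ>) ts id \<circ> foldr (\<circ>) us id"
  by (induction ts) auto

lemma word_permutes:
  "set ts \<subseteq> transpositions N \<Longrightarrow> foldr (\<circ>) ts id permutes {1..N}"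
proof (induction ts)
  case Nil
  then show ?case by (simp only: foldr_comp_Nil permutes_id)
next
  case (Cons t ts)
  then have "t permutes {1..N}" by (auto simp: transpositions_def intro!: permutes_swap_id)
  moreover have "foldr (\<circ>) ts id permutes {1..N}" by (rule Cons.IH) (use Cons.prems in simp)
  moreover have "foldr (\<circ>) (t # ts) id = t \<circ> foldr (\<circ>) ts id" by simp
  ultimately show ?case by (simp only: permutes_compose)
qed

lemma cyc_word_ge:
  "set ts \<subseteq> transpositions N \<Longrightarrow> N \<le> cyc N (foldr (\<circ>) ts id) + length ts"
proof (induction ts rule: rev_induct)
  case Nil
  then show ?case by (simp only: foldr_comp_Nil cyc_id list.size)
next
  case (snoc t ts)
  then obtain a b where t: "t = transpose a b" "a \<in> {1..N}" "b \<in> {1..N}"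
    by (auto simp: transpositions_def)
  have e: "foldr (\<circ>) (ts @ [t]) id = foldr (\<circ>) ts id \<circ> transpose a b"
    using t by (simp only: foldr_comp_append foldr_Cons foldr_Nil id_apply comp_apply comp_id)
  have p: "foldr (\<circ>) ts id permutes {1..N}" using snoc.prems by (intro word_permutes) simp
  have "N \<le> cyc N (foldr (\<circ>) ts id) + length ts" by (rule snoc.IH) (use snoc.prems in simp)
  moreover have "cyc N (foldr (\<circ>) ts id) \<le> Suc (cyc N (foldr (\<circ>) (ts @ [t]) id))"
    unfolding e by (rule cyc_mult_transpose_ge[OF p t(2,3)])
  ultimately show ?case unfolding length_append_singleton by linarith
qed

lemma word_exists:
  assumes "w permutes {1..N}"
  shows "\<exists>ts. length ts + cyc N w = N \<and> set ts \<subseteq> transpositions N \<and> w = foldr (\<circ>) ts id"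
  using assms
proof (induction "N - cyc N w" arbitrary: w rule: less_induct)
  case less
  show ?case
  proof (cases "w = id")
    case True
    then show ?thesis by (intro exI[of _ "[]"]) (simp add: cyc_id)
  next
    case False
    then obtain b where b: "w b \<noteq> b" by (auto simp: fun_eq_iff)
    then have bN: "b \<in> {1..N}" using less.prems by (meson permutes_not_in)
    then have aN: "w b \<in> {1..N}" using less.prems bN permutes_in_image by metis
    define t where "t = transpose (w b) b"
    have p: "w \<circ> t permutes {1..N}"
      unfolding t_def by (intro permutes_compose permutes_swap_id less.prems aN bN)
    have c: "cyc N w < cyc N (w \<circ> t)" unfolding t_def by (rule cyc_split_off[OF less.prems bN b])
    obtain ts where ts: "length ts + cyc N (w \<circ> t) = N" "set ts \<subseteq> transpositions N"
        "w \<circ> t = foldr (\<circ>) ts id"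
      using less.hyps[OF _ p] c cyc_le[of N "w \<circ> t"] by (metis diff_less_mono2 less_le_trans)
    have "w = (w \<circ> t) \<circ> t" by (simp add: t_def comp_assoc)
    also have "\<dots> = foldr (\<circ>) (ts @ [t]) id"
      by (simp only: foldr_comp_append ts(3) foldr_Cons foldr_Nil id_apply comp_apply comp_id)
    finally have e: "w = foldr (\<circ>) (ts @ [t]) id" .
    have st: "set (ts @ [t]) \<subseteq> transpositions N"
      using ts(2) aN bN b unfolding t_def transpositions_def by auto
    have "N \<le> cyc N w + length (ts @ [t])" using cyc_word_ge[OF st] e by simp
    then have "length (ts @ [t]) + cyc N w = N" using ts(1) c by simp
    then show ?thesis using e st by blast
  qed
qed

text \<open>A transposition changes the number of orbits by at most one, and unless \<open>w\<close> is the identity, a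
  suitable one increases it.\<close>

lemma tlen_cyc:
  assumes "w permutes {1..N}" shows "tlen N w + cyc N w = N"
proof -
  obtain ts where ts: "length ts + cyc N w = N" "set ts \<subseteq> transpositions N" "w = foldr (\<circ>) ts id"
    using word_exists[OF assms] by blast
  have "tlen N w = length ts" unfolding word_length_def
  proof (rule Least_equality)
    show "\<exists>us. length us = length ts \<and> set us \<subseteq> transpositions N \<and> w = foldr (\<circ>) us id"
      using ts by blast
    fix m
    assume "\<exists>us. length us = m \<and> set us \<subseteq> transpositions N \<and> w = foldr (\<circ>) us id"
    then show "length ts \<le> m" using cyc_word_ge ts(1) by fastforce
  qed
  then show ?thesis using ts by simp
qed

lemma tlen_mult_le:
  assumes "u permutes {1..N}" "v permutes {1..N}"
  shows "tlen N (u \<circ> v) \<le> tlen N u + tlen N v"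
proof -
  obtain us where us: "length us + cyc N u = N" "set us \<subseteq> transpositions N" "u = foldr (\<circ>) us id"
    using word_exists[OF assms(1)] by blast
  obtain vs where vs: "length vs + cyc N v = N" "set vs \<subseteq> transpositions N" "v = foldr (\<circ>) vs id"
    using word_exists[OF assms(2)] by blast
  have "N \<le> cyc N (u \<circ> v) + length (us @ vs)"
    using cyc_word_ge[of "us @ vs" N] us vs by (simp add: foldr_comp_append del: foldr_append)
  moreover have "u \<circ> v permutes {1..N}" using assms by (intro permutes_compose)
  ultimately show ?thesis
    using tlen_cyc[of "u \<circ> v" N] tlen_cyc[OF assms(1)] tlen_cyc[OF assms(2)] us(1) vs(1) by simp
qed

lemma tlen_id: "tlen N id = 0"
  using tlen_cyc[OF permutes_id, of N] cyc_id[of N] by linarith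

lemma tlen_eq_0:
  assumes "w permutes {1..N}" "tlen N w = 0" shows "w = id"
proof (rule ccontr)
  obtain ts where ts: "length ts + cyc N w = N" "w = foldr (\<circ>) ts id"
    using word_exists[OF assms(1)] by blast
  assume "w \<noteq> id"
  then show False using ts tlen_cyc[OF assms(1)] assms(2) by (cases ts) auto
qed

lemma orbit_conj:
  assumes "w permutes {1..N::nat}" "g permutes {1..N::nat}"
  shows "orbit (g \<circ> w \<circ> inv g) (g x) = g ` orbit w x"
  using orbit_inverse[OF self_in_orbit[OF assms(1)], of x "g \<circ> w \<circ> inv g" g]
    permutes_inverses(2)[OF assms(2)] by simp

lemma cycle_partition_conj:
  assumes "w permutes {1..N::nat}" "g permutes {1..N::nat}"
  shows "cycle_partition N (g \<circ> w \<circ> inv g) = (`) g ` cycle_partition N w"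
proof -
  have "cycle_partition N (g \<circ> w \<circ> inv g) = (\<lambda>x. orbit (g \<circ> w \<circ> inv g) (g x)) ` {1..N}"
    using permutes_image[OF assms(2)] unfolding cycle_partition_def by (metis image_image)
  then show ?thesis unfolding orbit_conj[OF assms] cycle_partition_def by (simp add: image_image)
qed

lemma tlen_conj:
  assumes "w permutes {1..N}" "g permutes {1..N}"
  shows "tlen N (g \<circ> w \<circ> inv g) = tlen N w"
proof -
  have "inj ((`) g)" using permutes_inj[OF assms(2)] by (simp add: inj_image_eq_iff inj_def)
  then have "cyc N (g \<circ> w \<circ> inv g) = cyc N w"
    unfolding cycle_partition_conj[OF assms] by (intro card_image) (auto intro: inj_on_subset)
  moreover have "g \<circ> w \<circ> inv g permutes {1..N}"
    using assms by (intro permutes_compose permutes_inv)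
  ultimately show ?thesis using tlen_cyc assms(1) by (metis add_right_cancel)
qed

lemma tlen_comm:
  assumes "u permutes {1..N}" "v permutes {1..N}"
  shows "tlen N (u \<circ> v) = tlen N (v \<circ> u)"
proof -
  have "v \<circ> (u \<circ> v) \<circ> inv v = v \<circ> u"
    using permutes_inv_o(1)[OF assms(2)] by (simp add: comp_assoc)
  then show ?thesis
    using tlen_conj[of "u \<circ> v" N v] assms permutes_compose by metis
qed

lemma tlen_inv:
  assumes "w permutes {1..N}" shows "tlen N (inv w) = tlen N w"
proof -
  have "cycle_partition N (inv w) = cycle_partition N w"
    unfolding cycle_partition_def by (simp add: orbit_inv_eq[OF permutation_of_permutes[OF assms]])
  then show ?thesis using tlen_cyc assms permutes_inv by (metis add_right_cancel)
qed

section \<open>The absolute order\<close>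

lemma abs_le_refl: "w permutes {1..N} \<Longrightarrow> abs_le N w w"
  by (simp add: abs_le_def permutes_inv_o tlen_id)

lemma abs_leI:
  assumes "u permutes {1..N}" "v permutes {1..N}"
    and "tlen N u + tlen N (inv u \<circ> v) \<le> tlen N v"
  shows "abs_le N u v"
proof -
  have "u \<circ> (inv u \<circ> v) = v" by (simp add: permutes_inv_o[OF assms(1)] flip: comp_assoc)
  then show ?thesis
    using tlen_mult_le[of u N "inv u \<circ> v"] assms permutes_compose[OF assms(2) permutes_inv[OF assms(1)]]
    unfolding abs_le_def by simp
qed

lemma abs_le_trans:
  assumes "u permutes {1..N}" "v permutes {1..N}" "w permutes {1..N}"
    and "abs_le N u v" "abs_le N v w"
  shows "abs_le N u w"
proof (rule abs_leI)
  have "(inv u \<circ> v) \<circ> (inv v \<circ> w) = inv u \<circ> (v \<circ> inv v) \<circ> w" by (simp add: comp_assoc)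
  then have "(inv u \<circ> v) \<circ> (inv v \<circ> w) = inv u \<circ> w" by (simp add: permutes_inv_o[OF assms(2)])
  moreover have "inv u \<circ> v permutes {1..N}" "inv v \<circ> w permutes {1..N}"
    using assms by (auto intro: permutes_compose permutes_inv)
  ultimately have "tlen N (inv u \<circ> w) \<le> tlen N (inv u \<circ> v) + tlen N (inv v \<circ> w)"
    using tlen_mult_le by metis
  then show "tlen N u + tlen N (inv u \<circ> w) \<le> tlen N w"
    using assms(4,5) unfolding abs_le_def by linarith
qed (use assms in auto)

text \<open>An element below \<open>\<mu>\<close> arises from \<open>\<mu>\<close> by cutting orbits in two: if \<open>\<pi> \<noteq> \<mu>\<close>, remove one
  transposition from a shortest word of \<open>\<pi>\<^sup>-\<^sup>1 \<mu>\<close> and multiply \<open>\<pi>\<close> by it. The length of \<open>\<pi>\<close> has to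
  grow, so this transposition joins two orbits of \<open>\<pi>\<close>.\<close>

lemma abs_le_descend [consumes 3, case_names base step]:
  assumes "\<pi> permutes {1..N}" "\<mu> permutes {1..N}" "abs_le N \<pi> \<mu>"
    and base: "P \<mu>"
    and step: "\<And>\<nu> a b. \<nu> permutes {1..N} \<Longrightarrow> a \<in> {1..N} \<Longrightarrow> b \<in> {1..N} \<Longrightarrow> a \<noteq> b \<Longrightarrow>
      b \<in> orbit \<nu> a \<Longrightarrow> P \<nu> \<Longrightarrow> P (\<nu> \<circ> transpose a b)"
  shows "P \<pi>"
  using assms(1,3)
proof (induction "tlen N (inv \<pi> \<circ> \<mu>)" arbitrary: \<pi> rule: less_induct)
  case less
  note \<pi> = less.prems(1)
  define \<tau> where "\<tau> = inv \<pi> \<circ> \<mu>"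
  have \<tau>: "\<tau> permutes {1..N}"
    unfolding \<tau>_def using assms(2) \<pi> by (intro permutes_compose permutes_inv)
  show ?case
  proof (cases "\<tau> = id")
    case True
    then have "\<pi> \<circ> (inv \<pi> \<circ> \<mu>) = \<pi>" by (simp add: \<tau>_def)
    then have "\<pi> = \<mu>" by (simp add: permutes_inv_o[OF \<pi>] flip: comp_assoc)
    then show ?thesis using base by simp
  next
    case False
    define w where "w = inv \<tau>"
    have w: "w permutes {1..N}" unfolding w_def by (rule permutes_inv[OF \<tau>])
    have "w \<noteq> id" using False \<tau> unfolding w_def by (metis inv_id permutes_inv_inv)
    then obtain b where b: "w b \<noteq> b" by (auto simp: fun_eq_iff)
    then have bN: "b \<in> {1..N}" using w by (meson permutes_not_in)
    define a where "a = w b"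
    have aN: "a \<in> {1..N}" unfolding a_def using w bN permutes_in_image by metis
    define t where "t = transpose a b"
    have t: "t permutes {1..N}" unfolding t_def by (intro permutes_swap_id aN bN)
    have tt: "t \<circ> t = id" by (simp add: t_def)
    define \<pi>' where "\<pi>' = \<pi> \<circ> t"
    have \<pi>': "\<pi>' permutes {1..N}" unfolding \<pi>'_def by (intro permutes_compose t \<pi>)
    have wt: "w \<circ> t permutes {1..N}" by (intro permutes_compose t w)
    have \<pi>_eq: "\<pi> = \<pi>' \<circ> t" unfolding \<pi>'_def by (simp add: comp_assoc tt)
    have t\<tau>: "inv \<pi>' \<circ> \<mu> = t \<circ> \<tau>"
      unfolding \<pi>'_def \<tau>_def using o_inv_distrib[OF permutes_bij[OF \<pi>] permutes_bij[OF t]] tt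
      by (simp add: inv_unique_comp comp_assoc)
    have "inv (t \<circ> \<tau>) = w \<circ> t"
      unfolding w_def using o_inv_distrib[OF permutes_bij[OF t] permutes_bij[OF \<tau>]] tt
      by (simp add: inv_unique_comp)
    then have "tlen N (t \<circ> \<tau>) = tlen N (w \<circ> t)"
      using tlen_inv permutes_compose[OF \<tau> t] by metis
    moreover have "cyc N w < cyc N (w \<circ> t)"
      using cyc_split_off[OF w bN b] unfolding t_def a_def .
    moreover have "tlen N w = tlen N \<tau>" unfolding w_def by (rule tlen_inv[OF \<tau>])
    ultimately have dec: "tlen N (t \<circ> \<tau>) < tlen N \<tau>"
      using tlen_cyc[OF w] tlen_cyc[OF wt] by linarith
    have inc: "tlen N \<pi>' \<le> Suc (tlen N \<pi>)"
      using cyc_mult_transpose_ge[OF \<pi> aN bN] tlen_cyc[OF \<pi>] tlen_cyc[OF \<pi>']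
      unfolding \<pi>'_def t_def by linarith
    have total: "tlen N \<mu> = tlen N \<pi> + tlen N \<tau>"
      using less.prems(2) unfolding abs_le_def \<tau>_def .
    have le: "abs_le N \<pi>' \<mu>"
      by (rule abs_leI[OF \<pi>' assms(2)]) (use dec inc total in \<open>simp add: t\<tau>\<close>)
    then have "tlen N \<mu> = tlen N \<pi>' + tlen N (t \<circ> \<tau>)" unfolding abs_le_def t\<tau> .
    then have "tlen N \<pi> < tlen N \<pi>'" using dec total by linarith
    then have "cyc N \<pi>' < cyc N \<pi>"
      using tlen_cyc[OF \<pi>] tlen_cyc[OF \<pi>'] by linarith
    then have "b \<in> orbit \<pi>' a"
      using cyc_increase_same_orbit[OF \<pi>' aN bN] \<pi>_eq unfolding t_def by simp
    moreover have "P \<pi>'"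
      by (rule less.hyps[OF _ \<pi>' le]) (use dec in \<open>simp add: t\<tau> \<tau>_def\<close>)
    moreover have "a \<noteq> b" using b by (simp add: a_def)
    ultimately show ?thesis using step[OF \<pi>' aN bN] \<pi>_eq unfolding t_def by simp
  qed
qed

text \<open>Cutting orbits in two refines the orbit partition.\<close>

lemma abs_le_orbit_subset:
  assumes "\<pi> permutes {1..N}" "\<mu> permutes {1..N}" "abs_le N \<pi> \<mu>"
  shows "orbit \<pi> x \<subseteq> orbit \<mu> x"
  using assms
proof (induction rule: abs_le_descend)
  case (step \<nu> a b)
  then show ?case using orbit_mult_transpose_subset[of \<nu> N a b x] by (meson order_trans)
qed simp

section \<open>The long cycle\<close>

lemma cycle_of_upt:
  assumes "a < b"
  shows "cycle_of_list [a..<b] x = (if a \<le> x \<and> Suc x < b then Suc x else if Suc x = b then a else x)"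
  using assms
proof (induction "b - a" arbitrary: a)
  case 0
  then show ?case by simp
next
  case (Suc d)
  show ?case
  proof (cases "Suc a = b")
    case True
    then have "[a..<b] = [a]" by auto
    then show ?thesis using True by auto
  next
    case False
    then have ab: "Suc a < b" using Suc by simp
    then have "[a..<b] = a # Suc a # [Suc (Suc a)..<b]" "[Suc a..<b] = Suc a # [Suc (Suc a)..<b]"
      by (simp_all add: upt_conv_Cons)
    then have "cycle_of_list [a..<b] = transpose a (Suc a) \<circ> cycle_of_list [Suc a..<b]" by simp
    then show ?thesis using Suc(1)[of "Suc a"] Suc(2) ab by (auto simp: transpose_def)
  qed
qed

lemma long_cycle_apply:
  "1 \<le> x \<Longrightarrow> x < N \<Longrightarrow> long_cycle N x = Suc x"
  "1 \<le> N \<Longrightarrow> long_cycle N N = 1"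
  unfolding long_cycle_def using cycle_of_upt[of 1 "Suc N"] by simp_all

lemma long_cycle_permutes: "long_cycle N permutes {1..N}"
proof -
  have "set [1..<Suc N] = {1..N}" by auto
  then show ?thesis unfolding long_cycle_def using cycle_permutes[of "[1..<Suc N]"] by simp
qed

lemma orbit_long_cycle:
  assumes "x \<in> {1..N}" shows "orbit (long_cycle N) x = {1..N}"
proof -
  have "y \<in> orbit (long_cycle N) 1" if "1 \<le> y" "y \<le> N" for y
    using that
  proof (induction y rule: nat_induct_at_least)
    case base
    show ?case by (rule self_in_orbit[OF long_cycle_permutes])
  next
    case (Suc y)
    then show ?case using orbit.step[of y "long_cycle N" 1] long_cycle_apply(1)[of y N] by simp
  qed
  then have "{1..N} \<subseteq> orbit (long_cycle N) 1" by auto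
  then have "orbit (long_cycle N) 1 = {1..N}"
    using orbit_subset_range[OF long_cycle_permutes, of 1 N] assms by auto
  then show ?thesis using orbit_eqI_mem[OF long_cycle_permutes] assms by metis
qed

lemma orbit_subset_long_cycle:
  assumes "\<pi> permutes {1..N}" shows "orbit \<pi> x \<subseteq> orbit (long_cycle N) x"
proof (cases "x \<in> {1..N}")
  case True
  then show ?thesis using orbit_long_cycle[OF True] orbit_subset_range[OF assms True] by simp
next
  case False
  then show ?thesis
    using orbit_eq_singleton_iff[of \<pi> x] self_in_orbit[OF long_cycle_permutes] permutes_not_in[OF assms] by simp
qed

lemma cycle_partition_long_cycle: "1 \<le> N \<Longrightarrow> cycle_partition N (long_cycle N) = {{1..N}}"
  unfolding cycle_partition_def using orbit_long_cycle by auto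

lemma tlen_long_cycle: "1 \<le> N \<Longrightarrow> Suc (tlen N (long_cycle N)) = N"
  using tlen_cyc[OF long_cycle_permutes, of N] cycle_partition_long_cycle[of N] by simp

lemma NC_A_iff: "w \<in> NC_A N \<longleftrightarrow> w permutes {1..N} \<and> abs_le N w (long_cycle N)"
  unfolding NC_A_def by (auto simp: abs_le_def tlen_id)

section \<open>Noncrossing permutations\<close>

text \<open>The points strictly between \<open>x\<close> and \<open>w x\<close>, going upwards around the circle; all points other
  than \<open>x\<close> if \<open>w x = x\<close>.\<close>

definition gap :: "nat \<Rightarrow> (nat \<Rightarrow> nat) \<Rightarrow> nat \<Rightarrow> nat set" where
  "gap N w x = {y \<in> {1..N}. if x < w x then x < y \<and> y < w x else x < y \<or> y < w x}"

text \<open>The orbits are noncrossing and traversed in cyclic order iff every orbit that meets a gap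
  stays in it. This form is invariant under rotation of the circle and speaks of single steps of
  \<open>w\<close> only.\<close>

definition nc_perm :: "nat \<Rightarrow> (nat \<Rightarrow> nat) \<Rightarrow> bool" where
  "nc_perm N w \<longleftrightarrow> w permutes {1..N} \<and> (\<forall>x\<in>{1..N}. stable w (gap N w x))"

text \<open>The points of \<open>X\<close> in \<open>(y, z]\<close> or \<open>(z, y]\<close>, whichever is nonempty. As these sets compose by
  symmetric difference, their stability is an equivalence relation between \<open>y\<close> and \<open>z\<close>.\<close>

definition between :: "nat set \<Rightarrow> nat \<Rightarrow> nat \<Rightarrow> nat set" where
  "between X y z = {x \<in> X. (x \<le> y) \<noteq> (x \<le> z)}"

lemma between_sym: "between X y z = between X z y"
  by (auto simp: between_def)

lemma stable_between_trans:
  assumes "stable w X" "stable w (between X y z)" "stable w (between X z u)"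
  shows "stable w (between X y u)"
proof -
  have "between X y u = (between X y z - between X z u) \<union> (between X z u - between X y z)"
    by (auto simp: between_def)
  then show ?thesis using assms by (simp add: stable_Un stable_Diff)
qed

lemma nc_perm_permutes: "nc_perm N w \<Longrightarrow> w permutes {1..N}"
  by (simp add: nc_perm_def)

lemma nc_perm_gap: "nc_perm N w \<Longrightarrow> x \<in> {1..N} \<Longrightarrow> y \<in> orbit w z \<Longrightarrow> y \<in> gap N w x \<longleftrightarrow> z \<in> gap N w x"
  unfolding nc_perm_def using stable_orbit_iff by metis

lemma nc_perm_long_cycle: "nc_perm N (long_cycle N)"
  unfolding nc_perm_def
proof (intro conjI ballI)
  fix x assume x: "x \<in> {1..N}"
  have "gap N (long_cycle N) x = {}"
  proof (cases "x = N")
    case True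
    then show ?thesis using long_cycle_apply(2)[of N] x by (auto simp: gap_def)
  next
    case False
    then show ?thesis using long_cycle_apply(1)[of x N] x by (auto simp: gap_def)
  qed
  then show "stable (long_cycle N) (gap N (long_cycle N) x)" by (simp add: stable_def)
qed (rule long_cycle_permutes)

lemma stable_orbit_coarser:
  assumes "\<pi> permutes {1..N::nat}" "\<mu> permutes {1..N::nat}" "\<And>x. orbit \<pi> x \<subseteq> orbit \<mu> x"
  shows "stable \<pi> (orbit \<mu> y)"
  unfolding stable_iff_orbit_subset[OF assms(1)] using assms(3) orbit_eqI_mem[OF assms(2)] by metis

text \<open>With \<open>u = \<pi>\<^sup>-\<^sup>1 (\<mu> y)\<close>, the successor \<open>\<pi> u = \<mu> y\<close> of \<open>u\<close> in its \<open>\<pi>\<close>-orbit directly follows \<open>y\<close>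
  in the \<open>\<mu>\<close>-orbit \<open>X\<close> of \<open>y\<close>. Hence the points of \<open>X\<close> between \<open>y\<close> and \<open>u\<close> are those inside or those
  outside the gap of \<open>\<pi>\<close> at \<open>u\<close>.\<close>

lemma stable_between_step:
  assumes \<pi>: "nc_perm N \<pi>" and \<mu>: "nc_perm N \<mu>" and sub: "\<And>x. orbit \<pi> x \<subseteq> orbit \<mu> x"
    and y: "y \<in> {1..N}"
  shows "stable \<pi> (between (orbit \<mu> y) y (inv \<pi> (\<mu> y)))"
proof -
  note p\<pi> = nc_perm_permutes[OF \<pi>] and p\<mu> = nc_perm_permutes[OF \<mu>]
  define X where "X = orbit \<mu> y"
  define v where "v = \<mu> y"
  define u where "u = inv \<pi> v"
  have \<pi>u: "\<pi> u = v" unfolding u_def using permutes_inverses(1)[OF p\<pi>] .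
  have XN: "X \<subseteq> {1..N}" unfolding X_def using orbit_subset_range[OF p\<mu> y] .
  have stX: "stable \<pi> X" unfolding X_def by (rule stable_orbit_coarser[OF p\<pi> p\<mu> sub])
  have vX: "v \<in> X" unfolding X_def v_def by (rule orbit.base)
  then have uX: "u \<in> X" using stX \<pi>u unfolding stable_def by metis
  have noX: "x \<notin> gap N \<mu> y" if "x \<in> X" for x
    using nc_perm_gap[OF \<mu> y that[unfolded X_def]] by (auto simp: gap_def)
  have no: "\<not> (if y < v then y < x \<and> x < v else y < x \<or> x < v)" if "x \<in> X" for x
    using noX[OF that] XN that unfolding gap_def v_def by auto
  have st: "stable \<pi> (gap N \<pi> u)" using \<pi> uX XN unfolding nc_perm_def by auto
  have "between X y u = (if u < v \<or> v \<le> y then X \<inter> gap N \<pi> u else X - gap N \<pi> u)"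
  proof -
    have "x \<in> between X y u \<longleftrightarrow> x \<in> (if u < v \<or> v \<le> y then X \<inter> gap N \<pi> u else X - gap N \<pi> u)" for x
    proof (cases "x \<in> X")
      case True
      then show ?thesis
        using no[OF True] no[OF uX] no[OF vX] XN unfolding between_def gap_def \<pi>u
        by (auto split: if_splits)
    next
      case False
      then show ?thesis by (auto simp: between_def)
    qed
    then show ?thesis by blast
  qed
  then have "stable \<pi> (between X y u)" using stX st by (auto intro: stable_Int stable_Diff)
  then show ?thesis by (simp add: X_def u_def v_def)
qed

text \<open>Conversely, the preceding property for the long cycle as \<open>\<mu>\<close> suffices, because the gap at \<open>u\<close> is,
  up to complement, the set between \<open>u\<close> and the predecessor of \<open>\<pi> u\<close> on the circle.\<close>

lemma nc_permI:
  assumes p: "\<pi> permutes {1..N}"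
    and st: "\<And>y. y \<in> {1..N} \<Longrightarrow> stable \<pi> (between {1..N} y (inv \<pi> (long_cycle N y)))"
  shows "nc_perm N \<pi>"
  unfolding nc_perm_def
proof (intro conjI ballI p)
  fix u assume u: "u \<in> {1..N}"
  define v where "v = \<pi> u"
  have v: "v \<in> {1..N}" unfolding v_def using p u permutes_in_image by metis
  define y where "y = (if v = 1 then N else v - 1)"
  have y: "y \<in> {1..N}" using v by (auto simp: y_def)
  have cy: "long_cycle N y = v"
    using long_cycle_apply(1)[of y N] long_cycle_apply(2)[of N] v by (auto simp: y_def)
  have "inv \<pi> v = u" unfolding v_def using permutes_inverses(2)[OF p] .
  then have S: "stable \<pi> (between {1..N} y u)" using st[OF y] cy by simp
  have N: "stable \<pi> {1..N}" using permutes_in_image[OF p] by (simp add: stable_def)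
  have "gap N \<pi> u = (if u < v \<or> v = 1 then between {1..N} y u else {1..N} - between {1..N} y u)"
    using u v unfolding gap_def between_def v_def[symmetric] y_def by auto
  then show "stable \<pi> (gap N \<pi> u)" using S N by (auto intro: stable_Diff)
qed

text \<open>Cutting an orbit of a noncrossing permutation at \<open>a < b\<close>: the points in \<open>(a, b]\<close> form a
  stable set, since a step leaving it would have exactly one of \<open>a\<close>, \<open>b\<close> in its gap.\<close>

lemma stable_cut:
  assumes \<nu>: "nc_perm N \<nu>" and ab: "a \<in> {1..N}" "b \<in> {1..N}" "a < b" "b \<in> orbit \<nu> a"
  shows "stable (\<nu> \<circ> transpose a b) (between {1..N} a b)"
proof (rule stableI_finite)
  let ?\<pi> = "\<nu> \<circ> transpose a b"
  note p = nc_perm_permutes[OF \<nu>]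
  have "?\<pi> permutes {1..N}" using p ab by (intro permutes_compose permutes_swap_id) auto
  then show "inj ?\<pi>" by (rule permutes_inj)
  show "finite (between {1..N} a b)" by (simp add: between_def)
  have eq: "between {1..N} a b = {a<..b}" using ab by (auto simp: between_def)
  show "?\<pi> ` between {1..N} a b \<subseteq> between {1..N} a b"
    unfolding eq
  proof (rule image_subsetI)
    fix x assume x: "x \<in> {a<..b}"
    show "?\<pi> x \<in> {a<..b}"
    proof (cases "x = b")
      case True
      have "a \<notin> gap N \<nu> a" by (auto simp: gap_def)
      then have "b \<notin> gap N \<nu> a" using nc_perm_gap[OF \<nu> ab(1,4)] by simp
      then have "a < \<nu> a \<and> \<nu> a \<le> b" using ab(2,3) by (auto simp: gap_def split: if_splits)
      then show ?thesis using True by simp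
    next
      case False
      have xN: "x \<in> {1..N}" using x ab by auto
      have "b \<in> gap N \<nu> x \<longleftrightarrow> a \<in> gap N \<nu> x" using nc_perm_gap[OF \<nu> xN ab(4)] .
      then have "a < \<nu> x \<and> \<nu> x \<le> b" using ab(1-3) x False by (auto simp: gap_def split: if_splits)
      moreover have "transpose a b x = x" using x False by (auto simp: transpose_def)
      ultimately show ?thesis by simp
    qed
  qed
qed

text \<open>Write \<open>t\<close> for the transposition. Sets stable under \<open>\<nu>\<close> do not separate \<open>a\<close> from \<open>b\<close> and remain
  stable under \<open>\<nu> t\<close>. The steps of \<open>(\<nu> t)\<^sup>-\<^sup>1 c = t (\<nu>\<^sup>-\<^sup>1 c)\<close> are those of \<open>\<nu>\<^sup>-\<^sup>1 c\<close>, possibly prolonged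
  by a step between \<open>a\<close> and \<open>b\<close>, which is the cut just treated.\<close>

lemma nc_perm_cut:
  assumes \<nu>: "nc_perm N \<nu>" and ab: "a \<in> {1..N}" "b \<in> {1..N}" "a \<noteq> b" "b \<in> orbit \<nu> a"
  shows "nc_perm N (\<nu> \<circ> transpose a b)"
proof (rule nc_permI)
  let ?\<pi> = "\<nu> \<circ> transpose a b"
  note p = nc_perm_permutes[OF \<nu>]
  have t: "transpose a b permutes {1..N}" using ab by (intro permutes_swap_id)
  show p': "?\<pi> permutes {1..N}" by (intro permutes_compose t p)
  have cut: "stable ?\<pi> (between {1..N} a b)"
  proof (cases "a < b")
    case True
    then show ?thesis using stable_cut[OF \<nu> ab(1,2) _ ab(4)] by simp
  next
    case False
    then show ?thesis
      using stable_cut[OF \<nu> ab(2,1) _ orbit_sym[OF p ab(4)]] ab(3)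
      by (simp add: between_sym transpose_commute)
  qed
  have st: "stable ?\<pi> S" if "stable \<nu> S" for S
    using that stable_orbit_iff[OF that ab(4)] unfolding stable_def by (auto simp: transpose_def)
  have N: "stable ?\<pi> {1..N}" using permutes_in_image[OF p'] by (simp add: stable_def)
  fix y assume y: "y \<in> {1..N}"
  define z where "z = inv \<nu> (long_cycle N y)"
  have "inv ?\<pi> = transpose a b \<circ> inv \<nu>"
    using o_inv_distrib[OF permutes_bij[OF p] permutes_bij[OF t]] by simp
  then have z: "inv ?\<pi> (long_cycle N y) = transpose a b z" by (simp add: z_def)
  have yz: "stable ?\<pi> (between {1..N} y z)"
    using st[OF stable_between_step[OF \<nu> nc_perm_long_cycle orbit_subset_long_cycle[OF p] y]] orbit_long_cycle[OF y]
    by (simp add: z_def)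
  have "stable ?\<pi> (between {1..N} y (transpose a b z))"
  proof (cases "z = a \<or> z = b")
    case True
    then show ?thesis
      using yz stable_between_trans[OF N yz] cut between_sym[of "{1..N}" a b] by auto
  next
    case False
    then show ?thesis using yz by (simp add: transpose_def)
  qed
  then show "stable ?\<pi> (between {1..N} y (inv ?\<pi> (long_cycle N y)))" using z by simp
qed

text \<open>The long cycle is noncrossing, and every element below it arises from it by cuts.\<close>

lemma NC_A_imp_nc_perm:
  assumes "w \<in> NC_A N" shows "nc_perm N w"
proof -
  have "w permutes {1..N}" "long_cycle N permutes {1..N}" "abs_le N w (long_cycle N)"
    using assms long_cycle_permutes by (auto simp: NC_A_iff)
  then show ?thesis
  proof (induction rule: abs_le_descend)
    case (step \<nu> a b)
    then show ?case by (intro nc_perm_cut)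
  qed (auto simp: nc_perm_long_cycle)
qed

section \<open>Kreweras complements as quotients of permutations\<close>

lemma quotient_stable_orbit:
  assumes "\<pi> permutes {1..N::nat}" "\<mu> permutes {1..N::nat}" "\<And>x. orbit \<pi> x \<subseteq> orbit \<mu> x"
  shows "stable (inv \<pi> \<circ> \<mu>) (orbit \<mu> y)"
proof -
  have "inv \<pi> (\<mu> x) \<in> orbit \<mu> y \<longleftrightarrow> \<pi> (inv \<pi> (\<mu> x)) \<in> orbit \<mu> y" for x
    using stable_orbit_coarser[OF assms, of y] by (simp add: stable_def)
  then show ?thesis
    using stable_orbit[OF assms(2), of y] by (simp add: stable_def permutes_inverses(1)[OF assms(1)])
qed

text \<open>Let \<open>X\<close> be the \<open>\<mu>\<close>-orbit of \<open>y\<close>. Forwards, the points of the orbit of \<open>y\<close> under the quotient \<open>\<pi>\<^sup>-\<^sup>1 \<mu>\<close> are reached by the steps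
  considered above. Backwards, say \<open>y < z\<close> and suppose that the points of \<open>X\<close> in \<open>(y, z]\<close> form a
  stable set \<open>I\<close>. As \<open>\<mu>\<close> moves a point of \<open>X\<close> in \<open>[y, z)\<close> to the next one, \<open>\<pi>\<^sup>-\<^sup>1 \<mu>\<close> maps it into \<open>I\<close>;
  an orbit starting in \<open>y\<close> and avoiding \<open>z\<close> would remain in \<open>I\<close> and never return to \<open>y\<close>.\<close>

lemma quotient_orbit_iff:
  assumes \<pi>: "nc_perm N \<pi>" and \<mu>: "nc_perm N \<mu>" and sub: "\<And>x. orbit \<pi> x \<subseteq> orbit \<mu> x"
    and y: "y \<in> {1..N}" and z: "z \<in> orbit \<mu> y"
  shows "z \<in> orbit (inv \<pi> \<circ> \<mu>) y \<longleftrightarrow> stable \<pi> (between (orbit \<mu> y) y z)"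
proof -
  note p\<pi> = nc_perm_permutes[OF \<pi>] and p\<mu> = nc_perm_permutes[OF \<mu>]
  define \<tau> where "\<tau> = inv \<pi> \<circ> \<mu>"
  have p\<tau>: "\<tau> permutes {1..N}" unfolding \<tau>_def by (intro permutes_compose permutes_inv p\<pi> p\<mu>)
  define X where "X = orbit \<mu> y"
  have XN: "X \<subseteq> {1..N}" unfolding X_def using orbit_subset_range[OF p\<mu> y] .
  have stX: "stable \<pi> X" unfolding X_def by (rule stable_orbit_coarser[OF p\<pi> p\<mu> sub])
  have yX: "y \<in> X" unfolding X_def by (rule self_in_orbit[OF p\<mu>])
  have X_eq: "orbit \<mu> x = X" if "x \<in> X" for x
    using orbit_eqI_mem[OF p\<mu>] that unfolding X_def by simp
  have \<tau>X: "stable \<tau> X" unfolding \<tau>_def X_def by (rule quotient_stable_orbit[OF p\<pi> p\<mu> sub])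
  have forward: "z' \<in> X \<and> stable \<pi> (between X y z')" if "z' \<in> orbit \<tau> y" for z'
    using that
  proof induction
    case base
    then show ?case
      using stable_between_step[OF \<pi> \<mu> sub y] \<tau>X yX unfolding \<tau>_def X_def stable_def by auto
  next
    case (step u)
    then have "stable \<pi> (between X u (\<tau> u))"
      using stable_between_step[OF \<pi> \<mu> sub, of u] X_eq[of u] XN unfolding \<tau>_def by auto
    then show ?case using step \<tau>X stable_between_trans[OF stX] unfolding stable_def by metis
  qed
  have backward: "v \<in> orbit \<tau> u"
    if u: "u \<in> X" and v: "v \<in> X" and uv: "u < v" and st: "stable \<pi> (between X u v)" for u v
  proof (rule ccontr)
    assume n: "v \<notin> orbit \<tau> u"
    have I: "between X u v = {x \<in> X. u < x \<and> x \<le> v}" using uv by (auto simp: between_def)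
    have step: "\<tau> x \<in> between X u v" if x: "x \<in> X" "u \<le> x" "x < v" for x
    proof -
      have xN: "x \<in> {1..N}" using XN x by auto
      have vx: "v \<in> orbit \<mu> x" using X_eq[OF x(1)] v by simp
      have "v \<notin> gap N \<mu> x" using nc_perm_gap[OF \<mu> xN vx] by (auto simp: gap_def)
      then have "x < \<mu> x \<and> \<mu> x \<le> v" using XN v x(3) by (auto simp: gap_def split: if_splits)
      moreover have "\<mu> x \<in> X" using X_eq[OF x(1)] orbit.base[of \<mu> x] by simp
      ultimately have "\<mu> x \<in> between X u v" unfolding I using x by auto
      then have "\<pi> (\<tau> x) \<in> between X u v"
        unfolding \<tau>_def by (simp add: permutes_inverses(1)[OF p\<pi>])
      then show ?thesis using st unfolding stable_def by simp
    qed
    have "x \<in> between X u v" if "x \<in> orbit \<tau> u" for x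
      using that
    proof induction
      case base
      show ?case using step[OF u] uv by simp
    next
      case (step x)
      then have "x \<noteq> v" using n by auto
      then show ?case using step.IH \<open>\<And>x. x \<in> X \<Longrightarrow> u \<le> x \<Longrightarrow> x < v \<Longrightarrow> \<tau> x \<in> between X u v\<close>[of x]
        unfolding I by auto
    qed
    then show False using self_in_orbit[OF p\<tau>, of u] unfolding I by blast
  qed
  have zX: "z \<in> X" using z by (simp add: X_def)
  have "z \<in> orbit \<tau> y \<longleftrightarrow> stable \<pi> (between X y z)"
  proof
    assume st: "stable \<pi> (between X y z)"
    consider "y < z" | "z < y" | "y = z" by linarith
    then show "z \<in> orbit \<tau> y"
    proof cases
      case 1
      then show ?thesis using backward[OF yX zX] st by simp
    next
      case 2
      then show ?thesis
        using backward[OF zX yX] st orbit_sym[OF p\<tau>] by (simp add: between_sym)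
    next
      case 3
      then show ?thesis using self_in_orbit[OF p\<tau>] by simp
    qed
  qed (simp add: forward)
  then show ?thesis by (simp add: \<tau>_def X_def)
qed

lemma card_orbit_maxima:
  assumes w: "w permutes {1..N}"
  shows "card {x \<in> {1..N}. \<forall>x'\<in>orbit w x. x' \<le> x} = cyc N w"
proof (rule bij_betw_same_card[of "orbit w"])
  let ?M = "{x \<in> {1..N}. \<forall>x'\<in>orbit w x. x' \<le> x}"
  have "inj_on (orbit w) ?M"
  proof (rule inj_onI)
    fix x y assume xy: "x \<in> ?M" "y \<in> ?M" "orbit w x = orbit w y"
    then have "x \<in> orbit w y" "y \<in> orbit w x" using self_in_orbit[OF w] by metis+
    then show "x = y" using xy(1,2) by (auto intro: antisym)
  qed
  moreover have "orbit w ` ?M = cycle_partition N w"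
  proof
    show "cycle_partition N w \<subseteq> orbit w ` ?M"
    proof
      fix B assume "B \<in> cycle_partition N w"
      then obtain y where y: "y \<in> {1..N}" "B = orbit w y" by (auto simp: cycle_partition_def)
      have fin: "finite B" unfolding y(2) by (rule finite_orbit[OF self_in_orbit[OF w]])
      have ne: "B \<noteq> {}" using y(2) orbit_nonempty[of w y] by simp
      have m: "Max B \<in> B" using fin ne by simp
      then have "orbit w (Max B) = B" using orbit_eqI_mem[OF w] unfolding y(2) by simp
      moreover have "Max B \<in> {1..N}" using m orbit_subset_range[OF w y(1)] unfolding y(2) by blast
      ultimately have "Max B \<in> ?M" using fin by simp
      then show "B \<in> orbit w ` ?M"
        by (intro image_eqI[of B "orbit w" "Max B"] sym[OF \<open>orbit w (Max B) = B\<close>])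
    qed
  qed (auto simp: cycle_partition_def)
  ultimately show "bij_betw (orbit w) ?M (cycle_partition N w)" by (simp add: bij_betw_def)
qed

text \<open>The elements that are not maximal in their \<open>\<pi>\<close>-orbit, together with the maxima of the
  \<open>\<mu>\<close>-orbits, lie in pairwise different orbits of \<open>\<pi>\<^sup>-\<^sup>1 \<mu>\<close>: if \<open>y < z\<close> were in the same one, then
  \<open>(y, z]\<close> would not separate \<open>\<pi>\<close>-orbits within the common \<open>\<mu>\<close>-orbit, but a larger element of the
  \<open>\<pi>\<close>-orbit of \<open>z\<close> (or of \<open>y\<close>, if \<open>z\<close> is the maximum of the \<open>\<mu>\<close>-orbit) violates this. So
  \<open>\<pi>\<^sup>-\<^sup>1 \<mu>\<close> has enough orbits for its length to be at most the difference of the lengths.\<close>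

lemma nc_perm_abs_le:
  assumes \<pi>: "nc_perm N \<pi>" and \<mu>: "nc_perm N \<mu>" and sub: "\<And>x. orbit \<pi> x \<subseteq> orbit \<mu> x"
  shows "abs_le N \<pi> \<mu>"
proof -
  note p\<pi> = nc_perm_permutes[OF \<pi>] and p\<mu> = nc_perm_permutes[OF \<mu>]
  define \<tau> where "\<tau> = inv \<pi> \<circ> \<mu>"
  have p\<tau>: "\<tau> permutes {1..N}" unfolding \<tau>_def by (intro permutes_compose permutes_inv p\<pi> p\<mu>)
  let ?M\<pi> = "{x \<in> {1..N}. \<forall>x'\<in>orbit \<pi> x. x' \<le> x}"
  let ?M\<mu> = "{x \<in> {1..N}. \<forall>x'\<in>orbit \<mu> x. x' \<le> x}"
  define R where "R = ({1..N} - ?M\<pi>) \<union> ?M\<mu>"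
  have le: "?M\<mu> \<subseteq> ?M\<pi>" using sub by blast
  have "card R = card ({1..N} - ?M\<pi>) + card ?M\<mu>"
    unfolding R_def using le by (intro card_Un_disjoint) auto
  also have "card ({1..N} - ?M\<pi>) = N - card ?M\<pi>" by (subst card_Diff_subset) auto
  finally have cR: "card R = N - cyc N \<pi> + cyc N \<mu>"
    by (simp only: card_orbit_maxima[OF p\<pi>] card_orbit_maxima[OF p\<mu>])
  have RN: "R \<subseteq> {1..N}" by (auto simp: R_def)
  have ne: "orbit \<tau> y \<noteq> orbit \<tau> z" if y: "y \<in> R" and z: "z \<in> R" and yz: "y < z" for y z
  proof
    assume "orbit \<tau> y = orbit \<tau> z"
    then have zy: "z \<in> orbit \<tau> y" using self_in_orbit[OF p\<tau>] by simp
    have yN: "y \<in> {1..N}" using y RN by auto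
    have "stable \<tau> (orbit \<mu> y)" unfolding \<tau>_def by (rule quotient_stable_orbit[OF p\<pi> p\<mu> sub])
    then have z\<mu>: "z \<in> orbit \<mu> y" using stable_orbit_iff[OF _ zy] self_in_orbit[OF p\<mu>] by blast
    define I where "I = between (orbit \<mu> y) y z"
    have st: "stable \<pi> I"
      unfolding I_def using quotient_orbit_iff[OF \<pi> \<mu> sub yN z\<mu>] zy by (simp add: \<tau>_def)
    have zI: "z \<in> I" and yI: "y \<notin> I" using z\<mu> yz by (auto simp: I_def between_def)
    show False
    proof (cases "z \<in> ?M\<pi>")
      case False
      then obtain x where "x \<in> orbit \<pi> z" "z < x" using z RN by (auto simp: not_le)
      moreover from this have "x \<in> I" using stable_orbit_iff[OF st] zI by blast
      ultimately show False using yz by (auto simp: I_def between_def)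
    next
      case True
      then have "z \<in> ?M\<mu>" using z by (auto simp: R_def)
      then have zmax: "x \<le> z" if "x \<in> orbit \<mu> y" for x
        using orbit_eqI_mem[OF p\<mu> z\<mu>] that by auto
      have "y \<notin> ?M\<mu>" using z\<mu> yz by (auto simp: not_le)
      then obtain x where x: "x \<in> orbit \<pi> y" "y < x" using y RN by (auto simp: R_def not_le)
      then have "x \<in> orbit \<mu> y" using sub by blast
      then have "x \<in> I" using x zmax[of x] by (auto simp: I_def between_def)
      then show False using stable_orbit_iff[OF st x(1)] yI by blast
    qed
  qed
  have "inj_on (orbit \<tau>) R"
    by (rule inj_onI) (use ne in \<open>metis linorder_neqE_nat\<close>)
  then have "card R = card (orbit \<tau> ` R)" by (simp add: card_image)
  also have "\<dots> \<le> cyc N \<tau>" unfolding cycle_partition_def using RN by (intro card_mono) auto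
  finally have "N - cyc N \<pi> + cyc N \<mu> \<le> cyc N \<tau>" unfolding cR .
  then show ?thesis
    using tlen_cyc[OF p\<pi>] tlen_cyc[OF p\<mu>] tlen_cyc[OF p\<tau>] unfolding \<tau>_def
    by (intro abs_leI[OF p\<pi> p\<mu>]) linarith
qed

lemma NC_A_eq_nc_perm: "NC_A N = {w. nc_perm N w}"
proof -
  have "w \<in> NC_A N" if w: "nc_perm N w" for w
    unfolding NC_A_iff
    using nc_perm_abs_le[OF w nc_perm_long_cycle orbit_subset_long_cycle] nc_perm_permutes[OF w] by simp
  then show ?thesis using NC_A_imp_nc_perm by auto
qed

lemma abs_le_iff_refines:
  assumes "nc_perm N \<pi>" "nc_perm N \<mu>"
  shows "abs_le N \<pi> \<mu> \<longleftrightarrow> refines {1..N} (cycle_partition N \<pi>) (cycle_partition N \<mu>)"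
  unfolding refines_cycles_iff[OF nc_perm_permutes[OF assms(1)] nc_perm_permutes[OF assms(2)]]
  using abs_le_orbit_subset[OF nc_perm_permutes[OF assms(1)] nc_perm_permutes[OF assms(2)]]
    nc_perm_abs_le[OF assms] by (metis (no_types))

text \<open>Equal orbit partitions give \<open>\<pi> \<le> \<mu>\<close> with \<open>\<pi>\<^sup>-\<^sup>1 \<mu>\<close> of length \<open>0\<close>.\<close>

lemma nc_perm_eqI:
  assumes "nc_perm N \<pi>" "nc_perm N \<mu>" "cycle_partition N \<pi> = cycle_partition N \<mu>"
  shows "\<pi> = \<mu>"
proof -
  note p\<pi> = nc_perm_permutes[OF assms(1)] and p\<mu> = nc_perm_permutes[OF assms(2)]
  have "abs_le N \<pi> \<mu>"
    unfolding abs_le_iff_refines[OF assms(1,2)] assms(3)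
    by (rule refines_refl[OF partition_on_cycles[OF p\<mu>]])
  then have "tlen N (inv \<pi> \<circ> \<mu>) = 0"
    using tlen_cyc[OF p\<pi>] tlen_cyc[OF p\<mu>] unfolding abs_le_def assms(3) by linarith
  then have "inv \<pi> \<circ> \<mu> = id"
    by (rule tlen_eq_0[OF permutes_compose[OF p\<mu> permutes_inv[OF p\<pi>]]])
  then have "\<pi> \<circ> (inv \<pi> \<circ> \<mu>) = \<pi>" by simp
  then show ?thesis by (simp add: permutes_inv_o[OF p\<pi>] flip: comp_assoc)
qed

section \<open>Noncrossing partitions are the orbit partitions of noncrossing permutations\<close>

lemma noncrossingI:
  assumes "\<And>A B a b c d. A \<in> P \<Longrightarrow> B \<in> P \<Longrightarrow> A \<noteq> B \<Longrightarrow> a \<in> A \<Longrightarrow> c \<in> A \<Longrightarrow> b \<in> B \<Longrightarrow> d \<in> B \<Longrightarrow>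
    a < b \<Longrightarrow> b < c \<Longrightarrow> c < d \<Longrightarrow> False"
  shows "noncrossing P"
proof (unfold noncrossing_def, clarify)
  fix A B and a b c d :: nat
  assume "A \<in> P" "B \<in> P" "A \<noteq> B" "a < b" "b < c" "c < d" "a \<in> A" "c \<in> A" "b \<in> B" "d \<in> B"
  then show False using assms[of A B a c b d] by simp
qed

lemma noncrossingD:
  assumes "noncrossing P" "A \<in> P" "B \<in> P" "A \<noteq> B" "a \<in> A" "c \<in> A" "b \<in> B" "d \<in> B"
  shows "\<not> (a < b \<and> b < c \<and> c < d)"
proof
  assume "a < b \<and> b < c \<and> c < d"
  then have E: "\<exists>a b c d. a < b \<and> b < c \<and> c < d \<and> a \<in> A \<and> c \<in> A \<and> b \<in> B \<and> d \<in> B"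
    using assms by auto
  show False
    by (rule notE[OF assms(1)[unfolded noncrossing_def]], rule bexI[of _ A], rule bexI[of _ B],
        rule conjI, rule assms(4), rule E, rule assms(3), rule assms(2))
qed

lemma nc_perm_noncrossing:
  assumes w: "nc_perm N w" shows "noncrossing (cycle_partition N w)"
proof (rule noncrossingI)
  note p = nc_perm_permutes[OF w]
  fix A B a b c d
  assume AB: "A \<in> cycle_partition N w" "B \<in> cycle_partition N w" "A \<noteq> B"
    and mem: "a \<in> A" "c \<in> A" "b \<in> B" "d \<in> B" and lt: "a < b" "b < c" "c < d"
  have part: "partition_on {1..N} (cycle_partition N w)" by (rule partition_on_cycles[OF p])
  have disj: "A \<inter> B = {}" using part AB by (auto simp: partition_on_def disjoint_def)
  have sub: "A \<subseteq> {1..N}" "B \<subseteq> {1..N}" using part AB by (auto simp: partition_on_def)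
  have orb: "orbit w u = C" if "u \<in> C" "C \<in> cycle_partition N w" for u C
    using that orbit_eqI_mem[OF p] unfolding cycle_partition_def by auto
  \<comment> \<open>the last element of \<open>A\<close> before \<open>b\<close>; its gap contains \<open>b\<close>\<close>
  define x where "x = Max {x \<in> A. x < b}"
  have fin: "finite {x \<in> A. x < b}" by (rule finite_subset[of _ "{..b}"]) auto
  have "x \<in> {x \<in> A. x < b}" unfolding x_def by (rule Max_in[OF fin]) (use mem lt in auto)
  then have x: "x \<in> A" "x < b" by auto
  have xmax: "x' \<le> x" if "x' \<in> A" "x' < b" for x'
    unfolding x_def by (rule Max_ge[OF fin]) (use that in auto)
  have xN: "x \<in> {1..N}" using x sub by auto
  have Ax: "orbit w x = A" using orb x AB by simp
  have wx: "w x \<in> A" using Ax orbit.base[of w x] by simp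
  have "b \<in> orbit w d" using orb mem AB by simp
  then have bd: "b \<in> gap N w x \<longleftrightarrow> d \<in> gap N w x" by (rule nc_perm_gap[OF w xN])
  have "c \<in> orbit w x" using Ax mem by simp
  then have c: "c \<notin> gap N w x" using nc_perm_gap[OF w xN] by (auto simp: gap_def)
  have cN: "c \<in> {1..N}" "b \<in> {1..N}" using mem sub by auto
  show False
  proof (cases "x < w x")
    case True
    then have "b \<le> w x" using xmax[OF wx] by linarith
    moreover have "b \<noteq> w x" using wx mem disj by auto
    ultimately have "b \<in> gap N w x" using True x cN by (simp add: gap_def)
    moreover have "w x \<le> c" using c True cN x lt by (auto simp: gap_def)
    ultimately show False using bd True lt by (auto simp: gap_def)
  next
    case False
    then show False using c cN x lt by (auto simp: gap_def)
  qed
qed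

lemma cycle_partition_in_NC: "nc_perm N w \<Longrightarrow> cycle_partition N w \<in> NC N"
  unfolding NC_def using nc_perm_noncrossing partition_on_cycles[OF nc_perm_permutes] by simp

definition next_in :: "nat set \<Rightarrow> nat \<Rightarrow> nat" where
  "next_in B x = (if \<exists>y\<in>B. x < y then Min {y \<in> B. x < y} else Min B)"

lemma next_in_mem:
  assumes "finite B" "x \<in> B" shows "next_in B x \<in> B"
proof (cases "\<exists>y\<in>B. x < y")
  case True
  have "Min {y \<in> B. x < y} \<in> {y \<in> B. x < y}" by (rule Min_in) (use assms True in auto)
  then show ?thesis using True by (simp add: next_in_def)
next
  case False
  have "Min B \<in> B" by (rule Min_in) (use assms in auto)
  then show ?thesis using False by (auto simp: next_in_def)
qed

lemma next_in_gap:
  assumes "finite B" "x \<in> B" "y \<in> B"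
  shows "\<not> (if x < next_in B x then x < y \<and> y < next_in B x else x < y \<or> y < next_in B x)"
proof (cases "\<exists>y\<in>B. x < y")
  case True
  have "Min {y \<in> B. x < y} \<in> {y \<in> B. x < y}" by (rule Min_in) (use assms True in auto)
  then have "x < Min {y \<in> B. x < y}" by blast
  moreover have "Min {y \<in> B. x < y} \<le> y" if "x < y" by (rule Min_le) (use assms that in auto)
  ultimately show ?thesis using True by (auto simp: next_in_def)
next
  case False
  moreover have "Min B \<le> y" "Min B \<le> x" using assms by auto
  ultimately show ?thesis using assms(3) by (auto simp: next_in_def)
qed

text \<open>Passing to the next element cyclically runs through all of \<open>B\<close>: going up from \<open>x\<close> one wraps
  around to \<open>Min B\<close>, and the least element missed would follow an element that is not missed.\<close>

lemma next_in_induct: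
  assumes "finite B" "x \<in> B" "S \<subseteq> B" "x \<in> S" and closed: "\<And>y. y \<in> S \<Longrightarrow> next_in B y \<in> S"
  shows "S = B"
proof (rule ccontr)
  assume "S \<noteq> B"
  then have D: "finite (B - S)" "B - S \<noteq> {}" using assms by auto
  have finS: "finite S" using assms finite_subset by blast
  define y where "y = Min (B - S)"
  have y: "y \<in> B" "y \<notin> S" using Min_in[OF D] unfolding y_def by auto
  have ymin: "z \<in> S" if "z \<in> B" "z < y" for z
    using Min_le[OF D(1), of z] that unfolding y_def by force
  have S0: "S \<noteq> {}" using assms by auto
  define m where "m = Max S"
  have m: "m \<in> S" "\<And>z. z \<in> S \<Longrightarrow> z \<le> m" unfolding m_def using finS S0 by auto
  have nm: "next_in B m \<in> S" using closed m by blast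
  have "Min B \<in> S"
  proof (cases "\<exists>z\<in>B. m < z")
    case True
    have "Min {z \<in> B. m < z} \<in> {z \<in> B. m < z}" by (rule Min_in) (use assms True in auto)
    then have "m < next_in B m" using True by (simp add: next_in_def)
    then show ?thesis using m(2)[OF nm] by simp
  next
    case False
    then show ?thesis using nm by (auto simp: next_in_def)
  qed
  then have "Min B \<noteq> y" using y by auto
  moreover have "Min B \<le> y" using assms(1) y by simp
  ultimately have lt: "Min B < y" by simp
  \<comment> \<open>the predecessor in \<open>B\<close> of the least element \<open>y\<close> outside \<open>S\<close>\<close>
  define p where "p = Max {z \<in> B. z < y}"
  have finp: "finite {z \<in> B. z < y}" using assms(1) by simp
  have "p \<in> {z \<in> B. z < y}" unfolding p_def
    by (rule Max_in[OF finp]) (use lt assms in \<open>auto intro!: exI[of _ "Min B"] Min_in\<close>)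
  then have p: "p \<in> B" "p < y" by auto
  have pmax: "z \<le> p" if "z \<in> B" "z < y" for z
    unfolding p_def by (rule Max_ge[OF finp]) (use that in auto)
  have "Min {z \<in> B. p < z} = y"
    by (rule Min_eqI) (use assms(1) y p pmax in \<open>auto simp: not_less[symmetric]\<close>)
  then have "next_in B p = y" using p y by (auto simp: next_in_def)
  then show False using closed[OF ymin[OF p]] y by simp
qed

text \<open>Let \<open>w\<close> map each point to the next one in its block. A block meeting the gap at \<open>x\<close> and leaving
  it would cross the block of \<open>x\<close>, which contains both ends of the gap.\<close>

lemma nc_perm_of_partition:
  assumes P: "P \<in> NC N" shows "\<exists>w. nc_perm N w \<and> cycle_partition N w = P"
proof -
  have part: "partition_on {1..N} P" and nc: "noncrossing P" using P by (auto simp: NC_def)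
  have ex1: "\<exists>!B. B \<in> P \<and> x \<in> B" if "x \<in> {1..N}" for x
    using part that unfolding partition_on_def disjoint_def by auto
  define blk where "blk x = (THE B. B \<in> P \<and> x \<in> B)" for x
  have blk: "blk x \<in> P" "x \<in> blk x" if "x \<in> {1..N}" for x
    using theI'[OF ex1[OF that]] unfolding blk_def by auto
  have blk_eq: "blk x = B" if "B \<in> P" "x \<in> B" for x B
  proof -
    have "x \<in> {1..N}" using that part by (auto simp: partition_on_def)
    then show ?thesis using ex1 blk that by metis
  qed
  have subB: "B \<subseteq> {1..N}" if "B \<in> P" for B using that part by (auto simp: partition_on_def)
  have neB: "B \<noteq> {}" if "B \<in> P" for B using that part by (auto simp: partition_on_def)
  have finB: "finite B" if "B \<in> P" for B using finite_subset[OF subB[OF that]] by simp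
  define w where "w x = (if x \<in> {1..N} then next_in (blk x) x else x)" for x
  have wB: "w x = next_in B x" if "B \<in> P" "x \<in> B" for x B
    using that blk_eq[OF that] subB[OF that(1)] by (auto simp: w_def)
  have wmem: "w x \<in> B" if "B \<in> P" "x \<in> B" for x B
    using wB[OF that] next_in_mem[OF finB[OF that(1)] that(2)] by simp
  have wim: "w ` B = B" if B: "B \<in> P" for B
  proof -
    obtain x where x: "x \<in> B" using B neB by (meson ex_in_conv)
    show "w ` B = B"
    proof (rule next_in_induct[OF finB[OF B], of "w x"])
      show "w x \<in> B" using wmem B x by simp
      show "w ` B \<subseteq> B" using wmem B by auto
      show "w x \<in> w ` B" using x by simp
      fix y assume "y \<in> w ` B"
      then have "y \<in> B" using wmem B by auto
      then show "next_in B y \<in> w ` B" using wB[OF B, of y] by (metis image_eqI)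
    qed
  qed
  have "w ` {1..N} = {1..N}"
  proof -
    have "{1..N} = \<Union> P" using part by (simp add: partition_on_def)
    then show ?thesis using wim by (simp add: image_Union)
  qed
  then have "bij_betw w {1..N} {1..N}" by (simp add: bij_betw_def eq_card_imp_inj_on)
  then have p: "w permutes {1..N}" by (rule bij_imp_permutes) (metis w_def)
  have orb: "orbit w x = B" if B: "B \<in> P" "x \<in> B" for x B
  proof (rule next_in_induct[OF finB[OF B(1)] B(2)])
    have st: "stable w B" using stableI_finite[OF permutes_inj[OF p] finB[OF B(1)]] wim[OF B(1)] by simp
    show sub: "orbit w x \<subseteq> B" using st B(2) unfolding stable_iff_orbit_subset[OF p] by (rule bspec)
    show "x \<in> orbit w x" by (rule self_in_orbit[OF p])
    fix y assume y: "y \<in> orbit w x"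
    then have "y \<in> B" using sub by auto
    then show "next_in B y \<in> orbit w x" using orbit.step[OF y] wB[OF B(1)] by simp
  qed
  have cp: "cycle_partition N w = P"
  proof
    show "cycle_partition N w \<subseteq> P" unfolding cycle_partition_def using orb blk by (metis image_subsetI)
    show "P \<subseteq> cycle_partition N w"
    proof
      fix B assume B: "B \<in> P"
      then obtain x where x: "x \<in> B" using neB by (meson ex_in_conv)
      have "x \<in> {1..N}" using subB[OF B] x by (rule subsetD)
      then show "B \<in> cycle_partition N w"
        unfolding cycle_partition_def by (rule rev_image_eqI) (rule sym[OF orb[OF B x]])
    qed
  qed
  have "stable w (gap N w x)" if x: "x \<in> {1..N}" for x
    unfolding stable_iff_orbit_subset[OF p]
  proof (intro ballI subsetI)
    fix y z assume y: "y \<in> gap N w x" and z: "z \<in> orbit w y"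
    have yN: "y \<in> {1..N}" using y unfolding gap_def by blast
    have oy: "orbit w y = blk y" by (rule orb[OF blk[OF yN]])
    have zy: "z \<in> blk y" using z unfolding oy .
    have zN: "z \<in> {1..N}" using subB[OF blk(1)[OF yN]] zy by (rule subsetD)
    note bx = blk[OF x]
    have wx: "w x = next_in (blk x) x" by (rule wB[OF bx])
    have wxB: "w x \<in> blk x" by (rule wmem[OF bx])
    have no: "u \<notin> gap N w x" if "u \<in> blk x" for u
      using next_in_gap[OF finB[OF bx(1)] bx(2) that] unfolding wx[symmetric] gap_def by simp
    have ne: "blk x \<noteq> blk y" using no[of y] y blk(2)[OF yN] by metis
    have "z \<notin> blk x" using blk_eq[OF bx(1), of z] blk_eq[OF blk(1)[OF yN] zy] ne by metis
    then have zx: "z \<noteq> x" "z \<noteq> w x" using bx(2) wxB by metis+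
    note C1 = noncrossingD[OF nc bx(1) blk(1)[OF yN] ne]
    note C2 = noncrossingD[OF nc blk(1)[OF yN] bx(1) ne[symmetric]]
    show "z \<in> gap N w x"
    proof (cases "x < w x")
      case True
      then have "x < y" "y < w x" using y by (simp_all add: gap_def)
      then show ?thesis
        using True zx zN C1[OF bx(2) wxB blk(2)[OF yN] zy] C2[OF zy blk(2)[OF yN] bx(2) wxB]
        by (simp add: gap_def)
    next
      case False
      then have "x < y \<or> y < w x" using y unfolding gap_def by auto
      then have "x < z \<or> z < w x"
        using zx C1[OF wxB bx(2) zy blk(2)[OF yN]] C2[OF blk(2)[OF yN] zy wxB bx(2)] by linarith
      then show ?thesis using False zN unfolding gap_def by simp
    qed
  qed
  then have "nc_perm N w" using p by (simp add: nc_perm_def)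
  then show ?thesis using cp by blast
qed

section \<open>The Kreweras complement\<close>

text \<open>No block of \<open>P\<close> is separated by cutting the circle after \<open>y\<close> and after \<open>z\<close>. These are the
  pairs that may share a block of a partition interleaved with \<open>P\<close> in a noncrossing way; the
  relation is an equivalence, so for noncrossing \<open>P\<close> its classes are the blocks of the coarsest such
  partition.\<close>

definition unseparated :: "nat set set \<Rightarrow> nat \<Rightarrow> nat \<Rightarrow> bool" where
  "unseparated P y z \<longleftrightarrow> (\<forall>B\<in>P. \<forall>x\<in>B. \<forall>x'\<in>B. ((x \<le> y) = (x' \<le> y)) = ((x \<le> z) = (x' \<le> z)))"

lemma unseparatedD:
  "unseparated P y z \<Longrightarrow> B \<in> P \<Longrightarrow> x \<in> B \<Longrightarrow> x' \<in> B \<Longrightarrow>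
    ((x \<le> y) = (x' \<le> y)) = ((x \<le> z) = (x' \<le> z))"
  unfolding unseparated_def by simp

abbreviation odd_pos :: "nat set \<Rightarrow> nat set" where "odd_pos B \<equiv> (\<lambda>j. 2 * j - 1) ` B"
abbreviation even_pos :: "nat set \<Rightarrow> nat set" where "even_pos B \<equiv> (\<lambda>j. 2 * j) ` B"

lemma odd_pos_neq_even_pos:
  assumes "A \<subseteq> {1..N}" "A \<noteq> {}" shows "odd_pos A \<noteq> even_pos B"
proof -
  obtain x where "x \<in> A" using assms by blast
  then have "2 * x - 1 \<in> odd_pos A" "1 \<le> x" using assms by auto
  moreover have "2 * x - 1 \<noteq> 2 * y" if "1 \<le> x" for y :: nat using that by presburger
  ultimately show ?thesis by force
qed

text \<open>If cutting after \<open>y\<close> and after \<open>z\<close> separates \<open>x\<close> from \<open>x'\<close> in a block of \<open>P\<close>, then the odd points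
  of \<open>x\<close>, \<open>x'\<close> and the even points of \<open>y\<close>, \<open>z\<close> alternate, which is a crossing.\<close>

lemma unseparated_of_candidate:
  assumes P: "partition_on {1..N} P" and R: "R \<in> kreweras_candidates N P"
    and C: "C \<in> R" "y \<in> C" "z \<in> C"
  shows "unseparated P y z"
proof (rule ccontr)
  assume "\<not> unseparated P y z"
  then obtain B x x' where B: "B \<in> P" "x \<in> B" "x' \<in> B"
    and sep: "((x \<le> y) = (x' \<le> y)) \<noteq> ((x \<le> z) = (x' \<le> z))"
    unfolding unseparated_def by auto
  let ?U = "odd_pos ` P \<union> even_pos ` R"
  have nc: "noncrossing ?U" using R by (auto simp: kreweras_candidates_def NC_def)
  have BN: "B \<subseteq> {1..N}" using P B by (auto simp: partition_on_def)
  have ne: "odd_pos B \<noteq> even_pos C" using odd_pos_neq_even_pos[OF BN] B by blast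
  have mem: "odd_pos B \<in> ?U" "even_pos C \<in> ?U" using B C by auto
  have x1: "1 \<le> x" "1 \<le> x'" using BN B by auto
  have in_odd: "u \<in> B \<Longrightarrow> 2 * u - 1 \<in> odd_pos B" and in_even: "v \<in> C \<Longrightarrow> 2 * v \<in> even_pos C" for u v
    by auto
  have 1: "\<not> (p \<le> r \<and> r < q \<and> q \<le> s)" if "p \<in> B" "q \<in> B" "r \<in> C" "s \<in> C" for p q r s
  proof -
    have "1 \<le> p" "1 \<le> q" using that BN by auto
    then show ?thesis
      using noncrossingD[OF nc mem ne in_odd[OF that(1)] in_odd[OF that(2)] in_even[OF that(3)] in_even[OF that(4)]]
      by linarith
  qed
  have 2: "\<not> (r < p \<and> p \<le> s \<and> s < q)" if "p \<in> B" "q \<in> B" "r \<in> C" "s \<in> C" for p q r s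
  proof -
    have "1 \<le> p" "1 \<le> q" using that BN by auto
    then show ?thesis
      using noncrossingD[OF nc mem(2,1) ne[symmetric] in_even[OF that(3)] in_even[OF that(4)] in_odd[OF that(1)] in_odd[OF that(2)]]
      by linarith
  qed
  show False
    using 1[OF B(2,3) C(2,3)] 1[OF B(3,2) C(2,3)] 1[OF B(2,3) C(3,2)] 1[OF B(3,2) C(3,2)]
      2[OF B(2,3) C(2,3)] 2[OF B(3,2) C(2,3)] 2[OF B(2,3) C(3,2)] 2[OF B(3,2) C(3,2)] sep
    by (cases "x \<le> y"; cases "x' \<le> y"; cases "x \<le> z"; cases "x' \<le> z") (simp_all add: not_le)
qed

lemma partition_on_image_inj:
  assumes "partition_on A P" "inj_on f A" shows "partition_on (f ` A) ((`) f ` P)"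
proof -
  have "{} \<notin> (`) f ` P" using assms(1) by (auto simp: partition_on_def)
  then show ?thesis using partition_on_inj_image[OF assms] by simp
qed

lemma partition_on_interleaved:
  assumes P: "partition_on {1..N} P" and Q: "partition_on {1..N} Q"
  shows "partition_on {1..2 * N} (odd_pos ` P \<union> even_pos ` Q)"
proof -
  have io: "inj_on (\<lambda>j::nat. 2 * j - 1) {1..N}" by (auto simp: inj_on_def)
  have ie: "inj_on (\<lambda>j::nat. 2 * j) {1..N}" by (auto simp: inj_on_def)
  have po: "partition_on (odd_pos {1..N}) (odd_pos ` P)"
    using partition_on_image_inj[OF P io] .
  have pe: "partition_on (even_pos {1..N}) (even_pos ` Q)"
    using partition_on_image_inj[OF Q ie] .
  have dj: "odd_pos {1..N} \<inter> even_pos {1..N} = {}"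
  proof -
    have "2 * x - 1 \<noteq> 2 * y" if "1 \<le> x" for x y :: nat using that by presburger
    then show ?thesis by auto
  qed
  have "x \<in> odd_pos {1..N} \<union> even_pos {1..N}" if "x \<in> {1..2 * N}" for x
  proof (cases "even x")
    case True
    then obtain y where "x = 2 * y" by blast
    then show ?thesis using that by auto
  next
    case False
    then obtain y where "x = 2 * y + 1" by (rule oddE)
    then show ?thesis using that by (intro UnI1 image_eqI[of _ _ "Suc y"]) auto
  qed
  then have un: "odd_pos {1..N} \<union> even_pos {1..N} = {1..2 * N}" by (intro equalityI subsetI) auto
  have "disjoint (odd_pos ` P \<union> even_pos ` Q)"
    using po pe dj by (intro disjoint_union) (auto simp: partition_on_def)
  then show ?thesis using po pe un by (auto simp: partition_on_def)
qed

lemma noncrossing_interleaved: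
  assumes P: "P \<in> NC N" and Q: "partition_on {1..N} Q"
    and iff: "\<And>y z. y \<in> {1..N} \<Longrightarrow> z \<in> {1..N} \<Longrightarrow> (\<exists>B\<in>Q. y \<in> B \<and> z \<in> B) \<longleftrightarrow> unseparated P y z"
  shows "noncrossing (odd_pos ` P \<union> even_pos ` Q)"
proof (rule noncrossingI)
  have part: "partition_on {1..N} P" and nc: "noncrossing P" using P by (auto simp: NC_def)
  have PN: "B \<subseteq> {1..N}" if "B \<in> P" for B using that part by (auto simp: partition_on_def)
  have QN: "B \<subseteq> {1..N}" if "B \<in> Q" for B using that Q by (auto simp: partition_on_def)
  have uns: "unseparated P y z" if "C \<in> Q" "y \<in> C" "z \<in> C" for C y z
  proof -
    have "y \<in> {1..N}" "z \<in> {1..N}" using QN that by blast+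
    then show ?thesis using iff that by blast
  qed
  fix A B a b c d
  assume A: "A \<in> odd_pos ` P \<union> even_pos ` Q" and B: "B \<in> odd_pos ` P \<union> even_pos ` Q"
    and ne: "A \<noteq> B" and mem: "a \<in> A" "c \<in> A" "b \<in> B" "d \<in> B" and lt: "a < b" "b < c" "c < d"
  consider (oo) "A \<in> odd_pos ` P" "B \<in> odd_pos ` P" | (oe) "A \<in> odd_pos ` P" "B \<in> even_pos ` Q"
    | (eo) "A \<in> even_pos ` Q" "B \<in> odd_pos ` P" | (ee) "A \<in> even_pos ` Q" "B \<in> even_pos ` Q"
    using A B by blast
  then show False
  proof cases
    case oo
    then obtain A' B' where AB: "A' \<in> P" "B' \<in> P" "A = odd_pos A'" "B = odd_pos B'" by blast
    then obtain a' b' c' d' where pts: "a' \<in> A'" "c' \<in> A'" "b' \<in> B'" "d' \<in> B'"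
      "a = 2 * a' - 1" "b = 2 * b' - 1" "c = 2 * c' - 1" "d = 2 * d' - 1" using mem by auto
    have "A' \<noteq> B'" using AB ne by auto
    then have "\<not> (a' < b' \<and> b' < c' \<and> c' < d')" using noncrossingD[OF nc AB(1,2)] pts(1-4) by blast
    then show False using pts lt by linarith
  next
    case oe
    then obtain A' B' where AB: "A' \<in> P" "B' \<in> Q" "A = odd_pos A'" "B = even_pos B'" by blast
    then obtain a' b' c' d' where pts: "a' \<in> A'" "c' \<in> A'" "b' \<in> B'" "d' \<in> B'"
      "a = 2 * a' - 1" "b = 2 * b'" "c = 2 * c' - 1" "d = 2 * d'" using mem by auto
    have "1 \<le> a'" "1 \<le> c'" using PN[OF AB(1)] pts by auto
    then show False
      using unseparatedD[OF uns[OF AB(2) pts(3,4)] AB(1) pts(1,2)] pts(5-8) lt by linarith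
  next
    case eo
    then obtain A' B' where AB: "A' \<in> Q" "B' \<in> P" "A = even_pos A'" "B = odd_pos B'" by blast
    then obtain a' b' c' d' where pts: "a' \<in> A'" "c' \<in> A'" "b' \<in> B'" "d' \<in> B'"
      "a = 2 * a'" "b = 2 * b' - 1" "c = 2 * c'" "d = 2 * d' - 1" using mem by auto
    have "1 \<le> b'" "1 \<le> d'" using PN[OF AB(2)] pts by auto
    then show False
      using unseparatedD[OF uns[OF AB(1) pts(1,2)] AB(2) pts(3,4)] pts(5-8) lt by linarith
  next
    case ee
    then obtain A' B' where AB: "A' \<in> Q" "B' \<in> Q" "A = even_pos A'" "B = even_pos B'" by blast
    then obtain a' b' c' d' where pts: "a' \<in> A'" "c' \<in> A'" "b' \<in> B'" "d' \<in> B'"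
      "a = 2 * a'" "b = 2 * b'" "c = 2 * c'" "d = 2 * d'" using mem by auto
    have lt': "a' < b'" "b' < c'" "c' < d'" using lt pts by auto
    \<comment> \<open>\<open>(a', b']\<close> is the difference of \<open>(a', c']\<close> and \<open>(b', d']\<close>, which separate no block; so \<open>a'\<close>
      and \<open>b'\<close> lie in one class\<close>
    have "unseparated P a' b'"
      unfolding unseparated_def
    proof (intro ballI)
      fix X x x' assume X: "X \<in> P" "x \<in> X" "x' \<in> X"
      show "((x \<le> a') = (x' \<le> a')) = ((x \<le> b') = (x' \<le> b'))"
        using unseparatedD[OF uns[OF AB(1) pts(1,2)] X] unseparatedD[OF uns[OF AB(2) pts(3,4)] X] lt'
by (smt (verit) le_trans less_imp_le)
    qed
    moreover have "a' \<in> {1..N}" "b' \<in> {1..N}" using QN AB pts by blast+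
    ultimately obtain C where C: "C \<in> Q" "a' \<in> C" "b' \<in> C" using iff by blast
    have "C = A'" "C = B'" using C AB pts Q unfolding partition_on_def disjoint_def by blast+
    then show False using ne AB by simp
  qed
qed

lemma refines_of_same_block:
  assumes R: "partition_on A R" and Q: "partition_on A Q"
    and same: "\<And>C y z. C \<in> R \<Longrightarrow> y \<in> C \<Longrightarrow> z \<in> C \<Longrightarrow> \<exists>B\<in>Q. y \<in> B \<and> z \<in> B"
  shows "refines A R Q"
  unfolding refines_def
proof (intro conjI ballI R Q)
  fix C assume C: "C \<in> R"
  then obtain y where y: "y \<in> C" using R unfolding partition_on_def by (metis ex_in_conv)
  then obtain B where B: "B \<in> Q" "y \<in> B" using same[OF C y y] by blast
  have "z \<in> B" if z: "z \<in> C" for z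
  proof -
    obtain B' where B': "B' \<in> Q" "y \<in> B'" "z \<in> B'" using same[OF C y z] by blast
    have "B' \<inter> B = {}" if "B' \<noteq> B" using that B' B Q by (auto simp: partition_on_def disjoint_def)
    then show ?thesis using B' B by blast
  qed
  then show "\<exists>B\<in>Q. C \<subseteq> B" using B by blast
qed

lemma kreweras_eqI:
  assumes P: "P \<in> NC N" and Q: "partition_on {1..N} Q"
    and iff: "\<And>y z. y \<in> {1..N} \<Longrightarrow> z \<in> {1..N} \<Longrightarrow> (\<exists>B\<in>Q. y \<in> B \<and> z \<in> B) \<longleftrightarrow> unseparated P y z"
  shows "kreweras N P = Q"
  unfolding kreweras_def
proof (rule the_equality)
  have part: "partition_on {1..N} P" using P by (auto simp: NC_def)
  have cand: "Q \<in> kreweras_candidates N P"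
    unfolding kreweras_candidates_def NC_def
    using Q partition_on_interleaved[OF part Q] noncrossing_interleaved[OF P Q iff] by blast
  have coarsest: "refines {1..N} R Q" if R: "R \<in> kreweras_candidates N P" for R
  proof (rule refines_of_same_block)
    show pR: "partition_on {1..N} R" using R by (simp add: kreweras_candidates_def)
    show "\<exists>B\<in>Q. y \<in> B \<and> z \<in> B" if "C \<in> R" "y \<in> C" "z \<in> C" for C y z
    proof -
      have "C \<subseteq> {1..N}" using pR that by (auto simp: partition_on_def)
      then have "y \<in> {1..N}" "z \<in> {1..N}" using that by auto
      then show ?thesis using unseparated_of_candidate[OF part R that] iff by simp
    qed
  qed (rule Q)
  show "Q \<in> kreweras_candidates N P \<and> (\<forall>R\<in>kreweras_candidates N P. refines {1..N} R Q)"
    using cand coarsest by simp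
  fix Q' assume Q': "Q' \<in> kreweras_candidates N P \<and> (\<forall>R\<in>kreweras_candidates N P. refines {1..N} R Q')"
  show "Q' = Q"
  proof (rule refines_asym)
    show "refines {1..N} Q' Q" using Q' coarsest by simp
    show "refines {1..N} Q Q'" using Q' cand by simp
  qed
qed

text \<open>Whether two points are separated depends only on their order, so the description of the
  complement carries over to an arbitrary finite set of integers.\<close>

lemma rank_in_less:
  assumes "finite X" "x \<in> X" "y \<in> X" "x < y" shows "rank_in X x < rank_in X y"
  unfolding rank_in_def
proof (rule psubset_card_mono)
  have "y \<in> {z \<in> X. z \<le> y}" "y \<notin> {z \<in> X. z \<le> x}" using assms by auto
  moreover have "{z \<in> X. z \<le> x} \<subseteq> {z \<in> X. z \<le> y}" using assms by auto
  ultimately show "{z \<in> X. z \<le> x} \<subset> {z \<in> X. z \<le> y}" by (metis psubsetI)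
qed (use assms in simp)

lemma rank_in_le_iff:
  assumes "finite X" "x \<in> X" "y \<in> X" shows "rank_in X x \<le> rank_in X y \<longleftrightarrow> x \<le> y"
  using rank_in_less[OF assms(1,2,3)] rank_in_less[OF assms(1,3,2)]
  by (cases x y rule: linorder_cases) simp_all

lemma bij_betw_rank_in:
  assumes "finite X" shows "bij_betw (rank_in X) X {1..card X}"
proof -
  have inj: "inj_on (rank_in X) X"
  proof (rule inj_onI)
    fix x y assume "x \<in> X" "y \<in> X" "rank_in X x = rank_in X y"
    then show "x = y" using rank_in_le_iff[OF assms, of x y] rank_in_le_iff[OF assms, of y x] by simp
  qed
  have "rank_in X x \<in> {1..card X}" if "x \<in> X" for x
  proof -
    have "card {x} \<le> rank_in X x" unfolding rank_in_def using assms that by (intro card_mono) auto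
    moreover have "rank_in X x \<le> card X" unfolding rank_in_def using assms by (intro card_mono) auto
    ultimately show ?thesis by simp
  qed
  then have "rank_in X ` X = {1..card X}"
    using inj by (intro card_subset_eq) (auto simp: card_image)
  then show ?thesis using inj by (simp add: bij_betw_def)
qed

lemma kreweras_on_eqI:
  assumes fin: "finite X" and P: "partition_on X P" "noncrossing P" and Q: "partition_on X Q"
    and iff: "\<And>y z. y \<in> X \<Longrightarrow> z \<in> X \<Longrightarrow> (\<exists>B\<in>Q. y \<in> B \<and> z \<in> B) \<longleftrightarrow> unseparated P y z"
  shows "kreweras_on X P = Q"
proof -
  let ?r = "rank_in X"
  note bij = bij_betw_rank_in[OF fin]
  have inj: "inj_on ?r X" and im: "?r ` X = {1..card X}" using bij by (auto simp: bij_betw_def)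
  have le: "?r x \<le> ?r y \<longleftrightarrow> x \<le> y" if "x \<in> X" "y \<in> X" for x y using rank_in_le_iff[OF fin that] .
  have lt: "?r x < ?r y \<longleftrightarrow> x < y" if "x \<in> X" "y \<in> X" for x y
    using le[of y x] that by (simp add: not_le[symmetric])
  have PX: "B \<subseteq> X" if "B \<in> P" for B using that P by (auto simp: partition_on_def)
  have QX: "B \<subseteq> X" if "B \<in> Q" for B using that Q by (auto simp: partition_on_def)
  have mem_iff: "?r y \<in> ?r ` B \<longleftrightarrow> y \<in> B" if "y \<in> X" "B \<subseteq> X" for y B
    using inj_on_image_mem_iff[OF inj that] .
  have P': "(`) ?r ` P \<in> NC (card X)"
    unfolding NC_def
  proof (intro CollectI conjI)
    show "partition_on {1..card X} ((`) ?r ` P)" using partition_on_image_inj[OF P(1) inj] unfolding im .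
    show "noncrossing ((`) ?r ` P)"
    proof (rule noncrossingI)
      fix A B a b c d
      assume AB: "A \<in> (`) ?r ` P" "B \<in> (`) ?r ` P" "A \<noteq> B" and mem: "a \<in> A" "c \<in> A" "b \<in> B" "d \<in> B"
        and l: "a < b" "b < c" "c < d"
      obtain A' B' where AB': "A' \<in> P" "B' \<in> P" "A = ?r ` A'" "B = ?r ` B'" using AB by blast
      then obtain a' b' c' d' where pts: "a' \<in> A'" "c' \<in> A'" "b' \<in> B'" "d' \<in> B'"
        "a = ?r a'" "b = ?r b'" "c = ?r c'" "d = ?r d'" using mem by auto
      have "A' \<noteq> B'" using AB' AB by auto
      then have "\<not> (a' < b' \<and> b' < c' \<and> c' < d')" using noncrossingD[OF P(2) AB'(1,2)] pts(1-4) by blast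
      moreover have "a' \<in> X" "b' \<in> X" "c' \<in> X" "d' \<in> X" using PX AB' pts by blast+
      ultimately show False using l lt pts by simp
    qed
  qed
  have "kreweras (card X) ((`) ?r ` P) = (`) ?r ` Q"
  proof (rule kreweras_eqI[OF P'])
    show "partition_on {1..card X} ((`) ?r ` Q)" using partition_on_image_inj[OF Q inj] unfolding im .
    fix y' z' assume "y' \<in> {1..card X}" "z' \<in> {1..card X}"
    then obtain y z where yz: "y \<in> X" "z \<in> X" "y' = ?r y" "z' = ?r z" using im by (metis imageE)
    have "(\<exists>B\<in>(`) ?r ` Q. y' \<in> B \<and> z' \<in> B) \<longleftrightarrow> (\<exists>B\<in>Q. ?r y \<in> ?r ` B \<and> ?r z \<in> ?r ` B)"
      unfolding yz(3,4) by blast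
    also have "\<dots> \<longleftrightarrow> (\<exists>B\<in>Q. y \<in> B \<and> z \<in> B)"
      using mem_iff[OF yz(1) QX] mem_iff[OF yz(2) QX] by blast
    also have "\<dots> \<longleftrightarrow> unseparated P y z" by (rule iff[OF yz(1,2)])
    also have "\<dots> \<longleftrightarrow> unseparated ((`) ?r ` P) y' z'"
    proof -
      have "(?r x \<le> ?r y) = (x \<le> y)" "(?r x \<le> ?r z) = (x \<le> z)" if "B \<in> P" "x \<in> B" for B x
        using le yz(1,2) PX[OF that(1)] that(2) by blast+
      then show ?thesis unfolding unseparated_def yz(3,4) by simp
    qed
    finally show "(\<exists>B\<in>(`) ?r ` Q. y' \<in> B \<and> z' \<in> B) \<longleftrightarrow> unseparated ((`) ?r ` P) y' z'" .
  qed
  moreover have "inv_into X ?r ` (?r ` B) = B" if "B \<in> Q" for B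
    using inv_into_image_cancel[OF inj QX[OF that]] .
  ultimately show ?thesis unfolding kreweras_on_def by (simp add: image_image)
qed

lemma unseparated_orbits:
  assumes w: "w permutes {1..N::nat}" and X: "stable w X"
  shows "unseparated (orbit w ` X) y z \<longleftrightarrow> stable w (between X y z)"
proof
  have orbX: "orbit w x \<subseteq> X" if "x \<in> X" for x
    using X that unfolding stable_iff_orbit_subset[OF w] by (rule bspec)
  show "stable w (between X y z)" if u: "unseparated (orbit w ` X) y z"
    unfolding stable_iff_orbit_subset[OF w]
  proof (intro ballI subsetI)
    fix x x' assume x: "x \<in> between X y z" and x': "x' \<in> orbit w x"
    have xX: "x \<in> X" using x by (simp add: between_def)
    then have "x' \<in> X" using orbX x' by blast
    moreover have "((x \<le> y) = (x' \<le> y)) = ((x \<le> z) = (x' \<le> z))"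
      by (rule unseparatedD[OF u _ self_in_orbit[OF w] x']) (use xX in simp)
    ultimately show "x' \<in> between X y z" using x by (auto simp: between_def)
  qed
  show "unseparated (orbit w ` X) y z" if st: "stable w (between X y z)"
    unfolding unseparated_def
  proof (intro ballI)
    fix B x x' assume B: "B \<in> orbit w ` X" and x: "x \<in> B" "x' \<in> B"
    obtain u where u: "u \<in> X" "B = orbit w u" using B by blast
    have "x \<in> X" "x' \<in> X" using orbX[OF u(1)] x u(2) by auto
    moreover have "x \<in> between X y z \<longleftrightarrow> x' \<in> between X y z"
      using stable_orbit_iff[OF st] x unfolding u(2) by metis
    ultimately show "((x \<le> y) = (x' \<le> y)) = ((x \<le> z) = (x' \<le> z))" by (auto simp: between_def)
  qed
qed

lemma same_orbit_iff:
  assumes w: "w permutes {1..N::nat}" and y: "y \<in> X"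
  shows "(\<exists>B\<in>orbit w ` X. y \<in> B \<and> z \<in> B) \<longleftrightarrow> z \<in> orbit w y"
proof
  assume "\<exists>B\<in>orbit w ` X. y \<in> B \<and> z \<in> B"
  then obtain u where "y \<in> orbit w u" "z \<in> orbit w u" by auto
  then show "z \<in> orbit w y" using orbit_eqI_mem[OF w] by metis
next
  assume "z \<in> orbit w y"
  then show "\<exists>B\<in>orbit w ` X. y \<in> B \<and> z \<in> B"
    using y self_in_orbit[OF w, of y] by (intro bexI[of _ "orbit w y"]) simp_all
qed

text \<open>Stability of the points between \<open>y\<close> and \<open>z\<close> under \<open>\<pi>\<close> says that no \<open>\<pi>\<close>-orbit is separated, so
  the orbits of \<open>\<pi>\<^sup>-\<^sup>1 \<mu>\<close> inside a \<open>\<mu>\<close>-orbit are the blocks of a Kreweras complement.\<close>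

lemma same_quotient_orbit_iff:
  assumes \<pi>: "nc_perm N \<pi>" and \<mu>: "nc_perm N \<mu>" and sub: "\<And>x. orbit \<pi> x \<subseteq> orbit \<mu> x"
    and x: "x \<in> {1..N}" and y: "y \<in> orbit \<mu> x" and z: "z \<in> orbit \<mu> x"
  shows "(\<exists>B\<in>orbit (inv \<pi> \<circ> \<mu>) ` orbit \<mu> x. y \<in> B \<and> z \<in> B) \<longleftrightarrow>
    unseparated (orbit \<pi> ` orbit \<mu> x) y z"
proof -
  note p\<pi> = nc_perm_permutes[OF \<pi>] and p\<mu> = nc_perm_permutes[OF \<mu>]
  have p\<tau>: "inv \<pi> \<circ> \<mu> permutes {1..N}" by (intro permutes_compose permutes_inv p\<pi> p\<mu>)
  have yN: "y \<in> {1..N}" using orbit_subset_range[OF p\<mu> x] y by blast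
  have e: "orbit \<mu> y = orbit \<mu> x" by (rule orbit_eqI_mem[OF p\<mu> y])
  show ?thesis
    unfolding same_orbit_iff[OF p\<tau> y] unseparated_orbits[OF p\<pi> stable_orbit_coarser[OF p\<pi> p\<mu> sub]]
    using quotient_orbit_iff[OF \<pi> \<mu> sub yN] z unfolding e .
qed

lemma restrict_orbits:
  assumes \<pi>: "\<pi> permutes {1..N}" and X: "stable \<pi> X" "X \<subseteq> {1..N}"
  shows "restrict_partition (cycle_partition N \<pi>) X = orbit \<pi> ` X"
proof -
  have "orbit \<pi> x \<inter> X = (if x \<in> X then orbit \<pi> x else {})" for x
    using stable_orbit_iff[OF X(1)] by auto
  moreover have "orbit \<pi> x \<noteq> {}" for x by (rule orbit_nonempty)
  ultimately show ?thesis
    unfolding restrict_partition_def cycle_partition_def image_image using X(2) by (auto simp: image_iff)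
qed

lemma rel_kreweras_cycles:
  assumes \<pi>: "nc_perm N \<pi>" and \<mu>: "nc_perm N \<mu>" and sub: "\<And>x. orbit \<pi> x \<subseteq> orbit \<mu> x"
  shows "rel_kreweras (cycle_partition N \<mu>) (cycle_partition N \<pi>) = cycle_partition N (inv \<pi> \<circ> \<mu>)"
proof -
  note p\<pi> = nc_perm_permutes[OF \<pi>] and p\<mu> = nc_perm_permutes[OF \<mu>]
  define \<tau> where "\<tau> = inv \<pi> \<circ> \<mu>"
  have p\<tau>: "\<tau> permutes {1..N}" unfolding \<tau>_def by (intro permutes_compose permutes_inv p\<pi> p\<mu>)
  have kr: "kreweras_on (orbit \<mu> x) (restrict_partition (cycle_partition N \<pi>) (orbit \<mu> x)) = orbit \<tau> ` orbit \<mu> x"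
    if x: "x \<in> {1..N}" for x
  proof -
    let ?X = "orbit \<mu> x"
    have XN: "?X \<subseteq> {1..N}" by (rule orbit_subset_range[OF p\<mu> x])
    have st: "stable \<pi> ?X" by (rule stable_orbit_coarser[OF p\<pi> p\<mu> sub])
    have "noncrossing (orbit \<pi> ` ?X)"
    proof (rule noncrossingI)
      fix A B a b c d
      assume AB: "A \<in> orbit \<pi> ` ?X" "B \<in> orbit \<pi> ` ?X" "A \<noteq> B"
        and mem: "a \<in> A" "c \<in> A" "b \<in> B" "d \<in> B" and lt: "a < b" "b < c" "c < d"
      have "A \<in> cycle_partition N \<pi>" "B \<in> cycle_partition N \<pi>"
        using AB(1,2) image_mono[OF XN, of "orbit \<pi>"] unfolding cycle_partition_def by auto
      then show False using noncrossingD[OF nc_perm_noncrossing[OF \<pi>] _ _ AB(3) mem] lt by simp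
    qed
    then have "kreweras_on ?X (orbit \<pi> ` ?X) = orbit \<tau> ` ?X"
    proof (rule kreweras_on_eqI[rotated 2])
      show "finite ?X" using XN by (rule finite_subset) simp
      show "partition_on ?X (orbit \<pi> ` ?X)" by (rule partition_on_orbits[OF p\<pi> st])
      show "partition_on ?X (orbit \<tau> ` ?X)"
        by (rule partition_on_orbits[OF p\<tau>]) (unfold \<tau>_def, rule quotient_stable_orbit[OF p\<pi> p\<mu> sub])
    qed (unfold \<tau>_def, rule same_quotient_orbit_iff[OF \<pi> \<mu> sub x])
    then show ?thesis unfolding restrict_orbits[OF p\<pi> st XN] .
  qed
  have "rel_kreweras (cycle_partition N \<mu>) (cycle_partition N \<pi>) = (\<Union>x\<in>{1..N}. orbit \<tau> ` orbit \<mu> x)"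
    unfolding rel_kreweras_def cycle_partition_def[of N \<mu>] image_image using kr by (intro SUP_cong) auto
  also have "\<dots> = orbit \<tau> ` (\<Union>x\<in>{1..N}. orbit \<mu> x)" by blast
  also have "(\<Union>x\<in>{1..N}. orbit \<mu> x) = {1..N}"
    using partition_on_cycles[OF p\<mu>] by (simp add: partition_on_def cycle_partition_def)
  finally show ?thesis unfolding \<tau>_def cycle_partition_def[of N "inv \<pi> \<circ> \<mu>"] .
qed

lemma kreweras_cycles:
  assumes \<pi>: "nc_perm N \<pi>"
  shows "kreweras N (cycle_partition N \<pi>) = cycle_partition N (inv \<pi> \<circ> long_cycle N)"
proof (rule kreweras_eqI[OF cycle_partition_in_NC[OF \<pi>]])
  note p\<pi> = nc_perm_permutes[OF \<pi>]
  show "partition_on {1..N} (cycle_partition N (inv \<pi> \<circ> long_cycle N))"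
    by (intro partition_on_cycles permutes_compose permutes_inv p\<pi> long_cycle_permutes)
  fix y z assume yz: "y \<in> {1..N}" "z \<in> {1..N}"
  show "(\<exists>B\<in>cycle_partition N (inv \<pi> \<circ> long_cycle N). y \<in> B \<and> z \<in> B) \<longleftrightarrow>
      unseparated (cycle_partition N \<pi>) y z"
    using same_quotient_orbit_iff[OF \<pi> nc_perm_long_cycle orbit_subset_long_cycle[OF p\<pi>] yz(1), of y z] yz
    unfolding orbit_long_cycle[OF yz(1)] cycle_partition_def by simp
qed

section \<open>Shuffling permutations\<close>

text \<open>The place that the shuffle of \<open>k\<close> partitions gives to the point \<open>j\<close> of the \<open>i\<close>-th of them,
  with \<open>i\<close> counted from \<open>0\<close>: the \<open>j\<close>-th element of a residue class modulo \<open>k\<close>.\<close>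

definition pos :: "nat \<Rightarrow> nat \<Rightarrow> nat \<Rightarrow> nat" where
  "pos k i j = k * j - (k - Suc i)"

lemma pos_alt: "i < k \<Longrightarrow> 1 \<le> j \<Longrightarrow> pos k i j = Suc (k * (j - 1) + i)"
  unfolding pos_def by (cases j) auto

lemma pos_div_mod:
  assumes "i < k" "1 \<le> j" shows "(pos k i j - 1) mod k = i" "Suc ((pos k i j - 1) div k) = j"
  using assms by (auto simp: pos_alt)

lemma pos_eq_iff:
  assumes "i < k" "1 \<le> j" "i' < k" "1 \<le> j'"
  shows "pos k i j = pos k i' j' \<longleftrightarrow> i = i' \<and> j = j'"
  using pos_div_mod[OF assms(1,2)] pos_div_mod[OF assms(3,4)] by metis

lemma pos_mem_iff:
  assumes "i < k" "1 \<le> j" shows "pos k i j \<in> {1..k * N} \<longleftrightarrow> j \<in> {1..N}"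
proof
  assume "pos k i j \<in> {1..k * N}"
  then have "Suc (k * (j - 1) + i) \<le> k * N" using pos_alt[OF assms] by simp
  then have "k * (j - 1) < k * N" by linarith
  then have "j - 1 < N" by simp
  then show "j \<in> {1..N}" using assms by auto
next
  assume "j \<in> {1..N}"
  then have "k * Suc (j - 1) \<le> k * N" using assms by (intro mult_le_mono) auto
  then have "k * (j - 1) + k \<le> k * N" unfolding mult_Suc_right by linarith
  then have "Suc (k * (j - 1) + i) \<le> k * N" using assms(1) by linarith
  then show "pos k i j \<in> {1..k * N}" unfolding pos_alt[OF assms] by simp
qed

lemma pos_cases:
  assumes "x \<in> {1..k * N}"
  obtains i j where "i < k" "j \<in> {1..N}" "x = pos k i j"
proof
  have k: "0 < k" using assms by (cases k) auto
  show i: "(x - 1) mod k < k" using k by simp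
  have x: "x = Suc (k * ((x - 1) div k) + (x - 1) mod k)" using assms by simp
  then show e: "x = pos k ((x - 1) mod k) (Suc ((x - 1) div k))" using i by (simp add: pos_alt)
  show "Suc ((x - 1) div k) \<in> {1..N}" using pos_mem_iff[OF i, of "Suc ((x - 1) div k)" N] assms e by simp
qed

lemma long_cycle_pos:
  assumes "i < k" "j \<in> {1..N}"
  shows "long_cycle (k * N) (pos k i j) = (if Suc i < k then pos k (Suc i) j else pos k 0 (long_cycle N j))"
proof (cases "Suc i < k")
  case True
  have j: "1 \<le> j" using assms by simp
  have s: "pos k (Suc i) j = Suc (pos k i j)" using True j by (simp add: pos_alt)
  moreover have "pos k (Suc i) j \<in> {1..k * N}" using pos_mem_iff[OF True j] assms(2) by simp
  ultimately have "pos k i j < k * N" by simp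
  moreover have "1 \<le> pos k i j" using assms j by (simp add: pos_alt)
  ultimately show ?thesis using long_cycle_apply(1) s True by simp
next
  case False
  then have k: "k = Suc i" using assms by simp
  have p: "pos k i j = k * j" using k by (simp add: pos_def)
  show ?thesis
  proof (cases "j = N")
    case True
    have "1 \<le> k * N" using k assms by simp
    then have "long_cycle (k * N) (pos k i j) = 1" using long_cycle_apply(2)[of "k * N"] p True by simp
    moreover have "pos k 0 (long_cycle N j) = 1"
      using long_cycle_apply(2)[of N] True assms k by (simp add: pos_def)
    ultimately show ?thesis using False by simp
  next
    case neq: False
    then have j: "1 \<le> j" "j < N" using assms by auto
    then have "k * j < k * N" "1 \<le> k * j" using k mult_less_mono2[of j N k] by simp_all
    then have "long_cycle (k * N) (pos k i j) = Suc (k * j)" using long_cycle_apply(1) p by simp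
    moreover have "pos k 0 (long_cycle N j) = Suc (k * j)"
      using long_cycle_apply(1)[OF j] k pos_alt[of 0 k "Suc j"] by simp
    ultimately show ?thesis using False by simp
  qed
qed

text \<open>The permutation of \<open>{1..k N}\<close> acting on the \<open>i\<close>-th residue class modulo \<open>k\<close> like the \<open>i\<close>-th
  entry of the list; its orbit partition is the shuffle of the orbit partitions of the entries.\<close>

definition shuffle_perm :: "nat \<Rightarrow> (nat \<Rightarrow> nat) list \<Rightarrow> nat \<Rightarrow> nat" where
  "shuffle_perm N rs x =
     (let k = length rs in
      if x \<in> {1..k * N} then pos k ((x - 1) mod k) ((rs ! ((x - 1) mod k)) (Suc ((x - 1) div k))) else x)"

lemma shuffle_perm_pos:
  assumes "i < length rs" "j \<in> {1..N}"
  shows "shuffle_perm N rs (pos (length rs) i j) = pos (length rs) i ((rs ! i) j)"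
proof -
  have j: "1 \<le> j" using assms by simp
  have "pos (length rs) i j \<in> {1..length rs * N}" using pos_mem_iff[OF assms(1) j] assms(2) by simp
  then show ?thesis unfolding shuffle_perm_def Let_def pos_div_mod[OF assms(1) j] by (simp only: if_True)
qed

lemma shuffle_perm_outside: "x \<notin> {1..length rs * N} \<Longrightarrow> shuffle_perm N rs x = x"
  unfolding shuffle_perm_def Let_def by (simp only: if_False)

lemma shuffle_perm_eqI:
  assumes "\<And>i j. i < length rs \<Longrightarrow> j \<in> {1..N} \<Longrightarrow> f (pos (length rs) i j) = pos (length rs) i ((rs ! i) j)"
    and "\<And>x. x \<notin> {1..length rs * N} \<Longrightarrow> f x = x"
  shows "f = shuffle_perm N rs"
proof
  fix x
  show "f x = shuffle_perm N rs x"
  proof (cases "x \<in> {1..length rs * N}")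
    case True
    then obtain i j where ij: "i < length rs" "j \<in> {1..N}" "x = pos (length rs) i j" by (rule pos_cases)
    show ?thesis unfolding ij(3) using assms(1)[OF ij(1,2)] shuffle_perm_pos[OF ij(1,2)] by simp
  next
    case False
    show ?thesis using assms(2)[OF False] shuffle_perm_outside[OF False] by simp
  qed
qed

lemma nth_permutes_mem:
  assumes "\<And>r. r \<in> set rs \<Longrightarrow> r permutes A" "i < length rs" "j \<in> A"
  shows "(rs ! i) j \<in> A"
  using permutes_in_image[OF assms(1)[OF nth_mem[OF assms(2)]]] assms(3) by simp

lemma shuffle_perm_comp:
  assumes rs: "\<And>r. r \<in> set rs \<Longrightarrow> r permutes {1..N}" and len: "length qs = length rs"
  shows "shuffle_perm N qs \<circ> shuffle_perm N rs = shuffle_perm N (map2 (\<circ>) qs rs)"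
proof (rule shuffle_perm_eqI)
  have L: "length (map2 (\<circ>) qs rs) = length rs" using len by simp
  show "(shuffle_perm N qs \<circ> shuffle_perm N rs) x = x" if x: "x \<notin> {1..length (map2 (\<circ>) qs rs) * N}" for x
  proof -
    have "x \<notin> {1..length rs * N}" "x \<notin> {1..length qs * N}" using x len unfolding L by simp_all
    then show ?thesis by (simp only: comp_apply shuffle_perm_outside not_False_eq_True)
  qed
  fix i j assume i: "i < length (map2 (\<circ>) qs rs)" and j: "j \<in> {1..N}"
  have ir: "i < length rs" and iq: "i < length qs" using i len by auto
  have "(rs ! i) j \<in> {1..N}" by (rule nth_permutes_mem[OF rs ir j])
  then have "shuffle_perm N qs (pos (length qs) i ((rs ! i) j)) = pos (length qs) i ((qs ! i) ((rs ! i) j))"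
    by (rule shuffle_perm_pos[OF iq])
  then show "(shuffle_perm N qs \<circ> shuffle_perm N rs) (pos (length (map2 (\<circ>) qs rs)) i j)
      = pos (length (map2 (\<circ>) qs rs)) i ((map2 (\<circ>) qs rs ! i) j)"
    unfolding L comp_apply shuffle_perm_pos[OF ir j] using ir iq len by simp
qed

lemma shuffle_perm_id: "shuffle_perm N (map (\<lambda>_. id) rs) = id"
  by (rule sym, rule shuffle_perm_eqI) simp_all

lemma shuffle_perm_inv_comp:
  assumes rs: "\<And>r. r \<in> set rs \<Longrightarrow> r permutes {1..N}"
  shows "shuffle_perm N (map inv rs) \<circ> shuffle_perm N rs = id"
    and "shuffle_perm N rs \<circ> shuffle_perm N (map inv rs) = id"
proof -
  have "map2 (\<circ>) (map inv rs) rs = map (\<lambda>_. id) rs" "map2 (\<circ>) rs (map inv rs) = map (\<lambda>_. id) rs"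
    using permutes_inv_o[OF rs] by (auto intro!: nth_equalityI)
  moreover have "r permutes {1..N}" if "r \<in> set (map inv rs)" for r
    using that rs permutes_inv by auto
  ultimately show "shuffle_perm N (map inv rs) \<circ> shuffle_perm N rs = id"
    and "shuffle_perm N rs \<circ> shuffle_perm N (map inv rs) = id"
    using shuffle_perm_comp[of rs N "map inv rs"] shuffle_perm_comp[of "map inv rs" N rs] rs
      shuffle_perm_id[of N rs] by simp_all
qed

lemma shuffle_perm_permutes:
  assumes rs: "\<And>r. r \<in> set rs \<Longrightarrow> r permutes {1..N}"
  shows "shuffle_perm N rs permutes {1..length rs * N}"
  unfolding permutes_def
proof (intro conjI allI impI)
  show "x \<notin> {1..length rs * N} \<Longrightarrow> shuffle_perm N rs x = x" for x by (rule shuffle_perm_outside)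
  have "bij (shuffle_perm N rs)" by (rule o_bij[OF shuffle_perm_inv_comp[OF rs]])
  then show "\<exists>!x. shuffle_perm N rs x = y" for y by (simp add: bij_iff)
qed

lemma inv_shuffle_perm:
  assumes rs: "\<And>r. r \<in> set rs \<Longrightarrow> r permutes {1..N}"
  shows "inv (shuffle_perm N rs) = shuffle_perm N (map inv rs)"
  by (rule inv_unique_comp[OF shuffle_perm_inv_comp(2,1)[OF rs]])

lemma orbit_shuffle_perm:
  assumes rs: "\<And>r. r \<in> set rs \<Longrightarrow> r permutes {1..N}" and i: "i < length rs" and j: "j \<in> {1..N}"
  shows "orbit (shuffle_perm N rs) (pos (length rs) i j) = pos (length rs) i ` orbit (rs ! i) j"
proof (rule orbit_inverse[symmetric])
  have p: "rs ! i permutes {1..N}" using rs i by simp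
  show "j \<in> orbit (rs ! i) j" by (rule self_in_orbit[OF p])
  fix x assume "x \<in> orbit (rs ! i) j"
  then have "x \<in> {1..N}" using orbit_subset_range[OF p j] by blast
  then show "shuffle_perm N rs (pos (length rs) i x) = pos (length rs) i ((rs ! i) x)"
    by (rule shuffle_perm_pos[OF i])
qed

lemma shuffle_partition_cycles:
  assumes rs: "\<And>r. r \<in> set rs \<Longrightarrow> r permutes {1..N}"
  shows "shuffle_partition (map (cycle_partition N) rs) = cycle_partition (length rs * N) (shuffle_perm N rs)"
proof -
  let ?k = "length rs"
  have "shuffle_partition (map (cycle_partition N) rs)
      = (\<Union>i<?k. (\<lambda>j. pos ?k i ` orbit (rs ! i) j) ` {1..N})"
    unfolding shuffle_partition_def by (simp add: cycle_partition_def image_image pos_def)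
  also have "\<dots> = (\<Union>i<?k. (\<lambda>j. orbit (shuffle_perm N rs) (pos ?k i j)) ` {1..N})"
    using orbit_shuffle_perm[OF rs] by (intro SUP_cong refl image_cong) auto
  also have "\<dots> = orbit (shuffle_perm N rs) ` (\<Union>i<?k. pos ?k i ` {1..N})"
    by (simp add: image_UN image_image)
  also have "(\<Union>i<?k. pos ?k i ` {1..N}) = {1..?k * N}"
  proof
    show "(\<Union>i<?k. pos ?k i ` {1..N}) \<subseteq> {1..?k * N}"
    proof
      fix x assume "x \<in> (\<Union>i<?k. pos ?k i ` {1..N})"
      then obtain i j where "i < ?k" "j \<in> {1..N}" "x = pos ?k i j" by auto
      then show "x \<in> {1..?k * N}" using pos_mem_iff[of i ?k j N] by simp
    qed
    show "{1..?k * N} \<subseteq> (\<Union>i<?k. pos ?k i ` {1..N})"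
    proof
      fix x assume "x \<in> {1..?k * N}"
      then obtain i j where "i < ?k" "j \<in> {1..N}" "x = pos ?k i j" by (rule pos_cases)
      then show "x \<in> (\<Union>i<?k. pos ?k i ` {1..N})" by blast
    qed
  qed
  finally show ?thesis unfolding cycle_partition_def .
qed

lemma inj_on_pos: "i < k \<Longrightarrow> inj_on (pos k i) {1..N}"
  by (rule inj_onI) (simp add: pos_eq_iff)

lemma cyc_shuffle_perm:
  assumes rs: "\<And>r. r \<in> set rs \<Longrightarrow> r permutes {1..N}"
  shows "cyc (length rs * N) (shuffle_perm N rs) = (\<Sum>i<length rs. cyc N (rs ! i))"
proof -
  let ?k = "length rs" and ?F = "\<lambda>i. (`) (pos (length rs) i) ` cycle_partition N (rs ! i)"
  have sub: "B \<subseteq> {1..N} \<and> B \<noteq> {}" if "i < ?k" "B \<in> cycle_partition N (rs ! i)" for i B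
    using partition_on_cycles[of "rs ! i" N] rs that by (auto simp: partition_on_def)
  have inj: "inj_on ((`) (pos ?k i)) (cycle_partition N (rs ! i))" if "i < ?k" for i
    by (rule inj_on_subset[OF inj_on_image_Pow[OF inj_on_pos[OF that, of N]]]) (use sub[OF that] in auto)
  have e: "cycle_partition (?k * N) (shuffle_perm N rs) = shuffle_partition (map (cycle_partition N) rs)"
    by (rule sym, rule shuffle_partition_cycles) (rule rs)
  have "cycle_partition (?k * N) (shuffle_perm N rs) = (\<Union>i<?k. ?F i)"
    unfolding e shuffle_partition_def length_map
    by (rule SUP_cong[OF refl]) (simp add: pos_def[abs_def])
  also have "card \<dots> = (\<Sum>i<?k. card (?F i))"
  proof (rule card_UN_disjoint)
    show "\<forall>i\<in>{..<?k}. \<forall>i'\<in>{..<?k}. i \<noteq> i' \<longrightarrow> ?F i \<inter> ?F i' = {}"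
    proof (intro ballI impI)
      fix i i' assume i: "i \<in> {..<?k}" "i' \<in> {..<?k}" "i \<noteq> i'"
      have "pos ?k i ` B \<noteq> pos ?k i' ` B'"
        if B: "B \<in> cycle_partition N (rs ! i)" "B' \<in> cycle_partition N (rs ! i')" for B B'
      proof
        assume e: "pos ?k i ` B = pos ?k i' ` B'"
        obtain x where x: "x \<in> B" "x \<in> {1..N}" using sub[of i B] B i by blast
        then obtain y where y: "y \<in> B'" "pos ?k i x = pos ?k i' y" using e by blast
        then have "y \<in> {1..N}" using sub[of i' B'] B i by blast
        then show False using pos_eq_iff[of i ?k x i' y] x y i by simp
      qed
      then show "?F i \<inter> ?F i' = {}" by blast
    qed
  qed auto
  also have "\<dots> = (\<Sum>i<?k. cyc N (rs ! i))"
    by (intro sum.cong refl card_image inj) auto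
  finally show ?thesis .
qed

lemma tlen_shuffle_perm:
  assumes rs: "\<And>r. r \<in> set rs \<Longrightarrow> r permutes {1..N}"
  shows "tlen (length rs * N) (shuffle_perm N rs) = (\<Sum>i<length rs. tlen N (rs ! i))"
proof -
  have "(\<Sum>i<length rs. tlen N (rs ! i)) + (\<Sum>i<length rs. cyc N (rs ! i)) = (\<Sum>i<length rs. N)"
    unfolding sum.distrib[symmetric] by (rule sum.cong) (use tlen_cyc rs in auto)
  also have "\<dots> = length rs * N" by simp
  finally have "(\<Sum>i<length rs. tlen N (rs ! i)) + (\<Sum>i<length rs. cyc N (rs ! i)) = length rs * N" .
  moreover have "cyc (length rs * N) (shuffle_perm N rs) = (\<Sum>i<length rs. cyc N (rs ! i))"
    by (rule cyc_shuffle_perm) (rule rs)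
  moreover have "shuffle_perm N rs permutes {1..length rs * N}"
    by (rule shuffle_perm_permutes) (rule rs)
  ultimately show ?thesis using tlen_cyc by (metis add_right_imp_eq)
qed

section \<open>Permutations shifting the residue classes\<close>

text \<open>Every residue class is mapped to the next one; the class of \<open>x\<close> is taken to be \<open>(x - 1) mod k\<close>, so
  that \<open>1\<close> lies in the class \<open>0\<close>.\<close>

definition shifts :: "nat \<Rightarrow> nat \<Rightarrow> (nat \<Rightarrow> nat) \<Rightarrow> bool" where
  "shifts k N w \<longleftrightarrow> (\<forall>x\<in>{1..k * N}. (w x - 1) mod k = x mod k)"

lemma shifts_funpow:
  assumes w: "w permutes {1..k * N}" and sh: "shifts k N w" and x: "x \<in> {1..k * N}"
  shows "((w ^^ m) x - 1) mod k = (x - 1 + m) mod k \<and> (w ^^ m) x \<in> {1..k * N}"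
proof (induction m)
  case 0
  then show ?case using x by simp
next
  case (Suc m)
  let ?y = "(w ^^ m) x"
  have y: "?y \<in> {1..k * N}" using Suc by simp
  then have "w ?y \<in> {1..k * N}" using w permutes_in_image by metis
  moreover have "(w ?y - 1) mod k = Suc (?y - 1) mod k" using sh y unfolding shifts_def by simp
  moreover have "Suc (?y - 1) mod k = Suc (x - 1 + m) mod k" using Suc by (metis mod_Suc_eq)
  ultimately show ?case by simp
qed

text \<open>Returning to the starting point takes a multiple of \<open>k\<close> steps.\<close>

lemma card_orbit_dvd:
  assumes w: "w permutes {1..k * N}" and sh: "shifts k N w" and x: "x \<in> {1..k * N}"
  shows "k dvd card (orbit w x)"
proof -
  let ?d = "funpow_dist1 w x x"
  have self: "x \<in> orbit w x" by (rule self_in_orbit[OF w])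
  have "card (orbit w x) = card {0..<?d}"
    unfolding orbit_conv_funpow_dist1[OF self] by (rule card_image[OF inj_on_funpow_dist1[OF self]])
  moreover have "(w ^^ ?d) x = x" by (rule funpow_dist1_prop[OF self])
  then have "(x - 1) mod k = (x - 1 + ?d) mod k" using shifts_funpow[OF w sh x, of ?d] by metis
  then have "k dvd ?d" by (metis add_diff_cancel_left' le_add1 mod_eq_dvd_iff_nat)
  ultimately show ?thesis by simp
qed

lemma card_stable_dvd:
  assumes w: "w permutes {1..M::nat}" and S: "stable w S" "S \<subseteq> {1..M}"
    and dvd: "\<And>B. B \<in> cycle_partition M w \<Longrightarrow> k dvd card B"
  shows "k dvd card S"
proof -
  have fin: "finite S" using S(2) by (rule finite_subset) simp
  have part: "partition_on S (orbit w ` S)" by (rule partition_on_orbits[OF w S(1)])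
  have mem: "B \<in> cycle_partition M w" if "B \<in> orbit w ` S" for B
    using that S(2) unfolding cycle_partition_def by auto
  have "card S = card (\<Union> (orbit w ` S))" using part by (simp add: partition_on_def)
  also have "\<dots> = sum card (orbit w ` S)"
  proof (rule card_Union_disjoint)
    show "pairwise disjnt (orbit w ` S)" using part by (simp add: partition_on_def)
    show "finite B" if B: "B \<in> orbit w ` S" for B
    proof -
      obtain x where "B = orbit w x" using B by (rule imageE)
      then show ?thesis by (simp add: finite_orbit[OF self_in_orbit[OF w]])
    qed
  qed
  finally have "card S = sum card (orbit w ` S)" .
  moreover have "k dvd sum card (orbit w ` S)" by (rule dvd_sum) (rule dvd[OF mem])
  ultimately show ?thesis by simp
qed

text \<open>The gap at \<open>x\<close> is a union of orbits, so its size is divisible by \<open>k\<close>; it consists of the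
  points strictly between \<open>x\<close> and \<open>w x\<close> on a circle with \<open>k N\<close> points.\<close>

lemma shifts_of_card_orbit_dvd:
  assumes w: "nc_perm (k * N) w" and dvd: "\<And>B. B \<in> cycle_partition (k * N) w \<Longrightarrow> k dvd card B"
  shows "shifts k N w"
  unfolding shifts_def
proof
  let ?M = "k * N"
  note p = nc_perm_permutes[OF w]
  fix x assume x: "x \<in> {1..?M}"
  have wx: "w x \<in> {1..?M}" using permutes_in_image[OF p] x by simp
  have "stable w (gap ?M w x)" using w x unfolding nc_perm_def by simp
  then have d: "k dvd card (gap ?M w x)"
    by (rule card_stable_dvd[OF p]) (use dvd in \<open>auto simp: gap_def\<close>)
  show "(w x - 1) mod k = x mod k"
  proof (cases "x < w x")
    case True
    then have "gap ?M w x = {x<..<w x}" using x wx by (auto simp: gap_def)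
    then have "card (gap ?M w x) = w x - 1 - x" by simp
    then have "k dvd (w x - 1 - x)" using d by simp
    moreover have "x \<le> w x - 1" using True by simp
    ultimately show ?thesis by (metis mod_eq_dvd_iff_nat)
  next
    case False
    then have "gap ?M w x = {x<..?M} \<union> {1..<w x}" using x wx by (auto simp: gap_def)
    moreover have "card ({x<..?M} \<union> {1..<w x}) = card {x<..?M} + card {1..<w x}"
      by (rule card_Un_disjoint) (use False in auto)
    ultimately have "card (gap ?M w x) = (?M - x) + (w x - 1)" by simp
    then have "k dvd (?M - x) + (w x - 1)" using d by simp
    then obtain q where "?M - x + (w x - 1) = k * q" by (rule dvdE)
    moreover have "x \<le> k * N" using x by simp
    ultimately have "(w x - 1) + k * N = x + k * q" by linarith
    then have "((w x - 1) + k * N) mod k = (x + k * q) mod k" by (rule arg_cong)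
    then show ?thesis by (simp only: mod_mult_self2)
  qed
qed

lemma shifts_long_cycle: "shifts k N (long_cycle (k * N))"
  unfolding shifts_def
proof
  fix x assume x: "x \<in> {1..k * N}"
  show "(long_cycle (k * N) x - 1) mod k = x mod k"
  proof (cases "x = k * N")
    case True
    then show ?thesis using long_cycle_apply(2)[of "k * N"] x by simp
  next
    case False
    then show ?thesis using long_cycle_apply(1)[of x "k * N"] x by simp
  qed
qed

text \<open>The quotient of two permutations shifting the residue classes preserves the classes, hence
  is a shuffle.\<close>

lemma shuffle_of_shifts:
  assumes w: "w permutes {1..k * N}" "shifts k N w" and v: "v permutes {1..k * N}" "shifts k N v"
  obtains rs where "length rs = k" "\<And>r. r \<in> set rs \<Longrightarrow> r permutes {1..N}" "inv w \<circ> v = shuffle_perm N rs"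
proof -
  define s where "s = inv w \<circ> v"
  have s: "s permutes {1..k * N}" unfolding s_def using w v by (intro permutes_compose permutes_inv)
  have cls: "(s x - 1) mod k = (x - 1) mod k" if x: "x \<in> {1..k * N}" for x
  proof -
    have sx: "s x \<in> {1..k * N}" using permutes_in_image[OF s] x by simp
    have "w (s x) = v x" by (simp add: s_def permutes_inverses(1)[OF w(1)])
    then have "s x mod k = x mod k" using w(2) v(2) sx x unfolding shifts_def by metis
    then have "Suc (s x - 1) mod k = Suc (x - 1) mod k" using sx x by simp
    then show ?thesis by (auto simp: mod_Suc split: if_splits)
  qed
  define r where "r i j = (if j \<in> {1..N} then Suc ((s (pos k i j) - 1) div k) else j)" for i j
  have r_eq: "s (pos k i j) = pos k i (r i j) \<and> r i j \<in> {1..N}" if i: "i < k" and j: "j \<in> {1..N}" for i j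
  proof -
    have j1: "1 \<le> j" using j by simp
    have m: "pos k i j \<in> {1..k * N}" using pos_mem_iff[OF i j1] j by simp
    then have "s (pos k i j) \<in> {1..k * N}" using permutes_in_image[OF s] by simp
    then obtain i' j' where ij: "i' < k" "j' \<in> {1..N}" "s (pos k i j) = pos k i' j'" by (rule pos_cases)
    have j'1: "1 \<le> j'" using ij by simp
    have "i' = i" using cls[OF m] pos_div_mod(1)[OF ij(1) j'1] pos_div_mod(1)[OF i j1] ij(3) by simp
    moreover have "r i j = j'" unfolding r_def using ij(3) pos_div_mod(2)[OF ij(1) j'1] j by simp
    ultimately show ?thesis using ij by simp
  qed
  have rp: "r i permutes {1..N}" if i: "i < k" for i
  proof (rule bij_imp_permutes)
    have "inj_on (r i) {1..N}"
    proof (rule inj_onI)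
      fix x y assume xy: "x \<in> {1..N}" "y \<in> {1..N}" "r i x = r i y"
      then have "s (pos k i x) = s (pos k i y)" using r_eq[OF i xy(1)] r_eq[OF i xy(2)] by simp
      then have "pos k i x = pos k i y" using permutes_inj[OF s] by (simp add: inj_eq)
      then show "x = y" using pos_eq_iff[OF i _ i, of x y] xy by simp
    qed
    moreover have "r i ` {1..N} \<subseteq> {1..N}" by (rule image_subsetI) (use r_eq[OF i] in blast)
    ultimately show "bij_betw (r i) {1..N} {1..N}"
      by (simp add: bij_betw_def endo_inj_surj)
    show "r i x = x" if "x \<notin> {1..N}" for x unfolding r_def if_not_P[OF that] ..
  qed
  show ?thesis
  proof
    show "length (map r [0..<k]) = k" by simp
    show "q permutes {1..N}" if "q \<in> set (map r [0..<k])" for q using that rp by auto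
    show "inv w \<circ> v = shuffle_perm N (map r [0..<k])"
      unfolding s_def[symmetric]
    proof (rule shuffle_perm_eqI)
      show "s x = x" if "x \<notin> {1..length (map r [0..<k]) * N}" for x
        by (rule permutes_not_in[OF s]) (use that in simp)
      show "s (pos (length (map r [0..<k])) i j) = pos (length (map r [0..<k])) i ((map r [0..<k] ! i) j)"
        if "i < length (map r [0..<k])" "j \<in> {1..N}" for i j
        using r_eq[of i j] that by simp
    qed
  qed
qed

lemma card_image_cong_ker:
  assumes "\<And>x y. x \<in> A \<Longrightarrow> y \<in> A \<Longrightarrow> f x = f y \<longleftrightarrow> g x = g y"
  shows "card (f ` A) = card (g ` A)"
proof (rule bij_betw_same_card)
  let ?h = "\<lambda>z. g (inv_into A f z)"
  have h: "?h (f x) = g x" if "x \<in> A" for x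
    using assms[of "inv_into A f (f x)" x] that by (simp add: f_inv_into_f inv_into_into)
  have "inj_on ?h (f ` A)" by (rule inj_onI) (use h assms in auto)
  moreover have "?h ` f ` A = g ` A" using h by (auto simp: image_image intro!: image_cong)
  ultimately show "bij_betw ?h (f ` A) (g ` A)" by (simp add: bij_betw_def)
qed

text \<open>If \<open>w\<close> shifts the residue classes, every orbit meets the first class, and \<open>w\<^sup>k\<close> is the first
  return map to it. So \<open>w\<close> has as many orbits as this return map.\<close>

lemma cyc_first_return:
  assumes k: "0 < k" and w: "w permutes {1..k * N}" "shifts k N w" and q: "q permutes {1..N}"
    and return: "\<And>j. j \<in> {1..N} \<Longrightarrow> (w ^^ k) (pos k 0 j) = pos k 0 (q j)"
  shows "cyc (k * N) w = cyc N q"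
proof -
  have M: "pos k 0 j \<in> {1..k * N}" if "j \<in> {1..N}" for j using pos_mem_iff[OF k, of j N] that by simp
  have pow: "(w ^^ (k * m)) (pos k 0 j) = pos k 0 ((q ^^ m) j) \<and> (q ^^ m) j \<in> {1..N}" if "j \<in> {1..N}" for j m
  proof (induction m)
    case (Suc m)
    have "(w ^^ (k * Suc m)) (pos k 0 j) = (w ^^ k) ((w ^^ (k * m)) (pos k 0 j))"
      by (simp add: funpow_add)
    then show ?case using Suc return[of "(q ^^ m) j"] permutes_in_image[OF q] by simp
  qed (use that in simp)
  have iff: "pos k 0 j' \<in> orbit w (pos k 0 j) \<longleftrightarrow> j' \<in> orbit q j" if j: "j \<in> {1..N}" "j' \<in> {1..N}" for j j'
  proof
    assume "pos k 0 j' \<in> orbit w (pos k 0 j)"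
    then obtain m where m: "pos k 0 j' = (w ^^ m) (pos k 0 j)"
      unfolding orbit_altdef_permutation[OF permutation_of_permutes[OF w(1)]] by blast
    have "(pos k 0 j' - 1) mod k = (pos k 0 j - 1 + m) mod k"
      unfolding m using shifts_funpow[OF w M[OF j(1)]] by blast
    moreover have "(pos k 0 j' - 1) mod k = 0" "(pos k 0 j - 1) mod k = 0"
      using pos_div_mod(1)[OF k, of j] pos_div_mod(1)[OF k, of j'] j by simp_all
    ultimately have "m mod k = 0" by (metis add_0 mod_add_left_eq)
    then obtain m' where "m = k * m'" by auto
    then have "pos k 0 j' = pos k 0 ((q ^^ m') j)" "(q ^^ m') j \<in> {1..N}" using pow[OF j(1), of m'] m by simp_all
    then have "j' = (q ^^ m') j" using pos_eq_iff[OF k _ k, of j' "(q ^^ m') j"] j by simp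
    then show "j' \<in> orbit q j"
      unfolding orbit_altdef_permutation[OF permutation_of_permutes[OF q]] by blast
  next
    assume "j' \<in> orbit q j"
    then obtain m where "j' = (q ^^ m) j"
      unfolding orbit_altdef_permutation[OF permutation_of_permutes[OF q]] by blast
    then have "pos k 0 j' = (w ^^ (k * m)) (pos k 0 j)" using pow[OF j(1), of m] by simp
    then show "pos k 0 j' \<in> orbit w (pos k 0 j)"
      unfolding orbit_altdef_permutation[OF permutation_of_permutes[OF w(1)]] by blast
  qed
  have "cycle_partition (k * N) w = (\<lambda>j. orbit w (pos k 0 j)) ` {1..N}"
  proof
    show "(\<lambda>j. orbit w (pos k 0 j)) ` {1..N} \<subseteq> cycle_partition (k * N) w"
      using M unfolding cycle_partition_def by auto
    show "cycle_partition (k * N) w \<subseteq> (\<lambda>j. orbit w (pos k 0 j)) ` {1..N}"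
      unfolding cycle_partition_def
    proof (rule image_subsetI)
      fix x assume x: "x \<in> {1..k * N}"
      \<comment> \<open>enough steps to reach the first class\<close>
      define m where "m = k - (x - 1) mod k"
      define y where "y = (w ^^ m) x"
      have "(x - 1 + m) mod k = 0"
      proof -
        have "(x - 1) mod k < k" using k by simp
        then have "(x - 1) mod k + m = k" unfolding m_def by simp
        then show ?thesis by (metis mod_add_left_eq mod_self)
      qed
      then have y: "(y - 1) mod k = 0" "y \<in> {1..k * N}"
        unfolding y_def using shifts_funpow[OF w x, of m] by simp_all
      obtain i j where ij: "i < k" "j \<in> {1..N}" "y = pos k i j" using y(2) by (rule pos_cases)
      have "i = 0" using pos_div_mod(1)[OF ij(1), of j] ij y(1) by simp
      moreover have "y \<in> orbit w x"
        unfolding orbit_altdef_permutation[OF permutation_of_permutes[OF w(1)]] y_def by blast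
      ultimately have "orbit w x = orbit w (pos k 0 j)" using orbit_eqI_mem[OF w(1)] ij(3) by metis
      then show "orbit w x \<in> (\<lambda>j. orbit w (pos k 0 j)) ` {1..N}" using ij(2) by simp
    qed
  qed
  moreover have "card ((\<lambda>j. orbit w (pos k 0 j)) ` {1..N}) = card (orbit q ` {1..N})"
    by (rule card_image_cong_ker) (unfold orbit_eq_iff[OF w(1)] orbit_eq_iff[OF q], use iff in simp)
  ultimately show ?thesis by (simp add: cycle_partition_def)
qed

section \<open>Multichains and their consecutive quotients\<close>

lemma inv_comp_inv:
  assumes "p permutes A" "q permutes A"
  shows "inv (q \<circ> inv p) = p \<circ> inv q" and "inv (inv p \<circ> q) = inv q \<circ> p"
  using o_inv_distrib[OF permutes_bij[OF assms(2)] permutes_bij[OF permutes_inv[OF assms(1)]]]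
    o_inv_distrib[OF permutes_bij[OF permutes_inv[OF assms(1)]] permutes_bij[OF assms(2)]]
  by (simp_all only: permutes_inv_inv[OF assms(1)])

lemma inv_comp_cancel:
  assumes "p permutes A" "q permutes A"
  shows "inv (q \<circ> inv p) \<circ> q = p" and "q \<circ> inv (inv p \<circ> q) = p"
  unfolding inv_comp_inv[OF assms] comp_assoc permutes_inv_o[OF assms(2)]
  by (simp_all add: permutes_inv_o[OF assms(2)] flip: comp_assoc)

fun quotients :: "(nat \<Rightarrow> nat) list \<Rightarrow> (nat \<Rightarrow> nat) list" where
  "quotients (p # q # xs) = (inv p \<circ> q) # quotients (q # xs)"
| "quotients _ = []"

text \<open>The inverse of \<open>quotients\<close>, rebuilding the sequence from its last entry \<open>c\<close> downwards.\<close>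

fun multichain_of :: "(nat \<Rightarrow> nat) \<Rightarrow> (nat \<Rightarrow> nat) list \<Rightarrow> (nat \<Rightarrow> nat) list" where
  "multichain_of c [] = [c]"
| "multichain_of c (r # rs) = (hd (multichain_of c rs) \<circ> inv r) # multichain_of c rs"

lemma length_quotients: "length (quotients xs) = length xs - 1"
  by (induction xs rule: quotients.induct) auto

lemma nth_quotients: "Suc i < length xs \<Longrightarrow> quotients xs ! i = inv (xs ! i) \<circ> xs ! Suc i"
proof (induction xs arbitrary: i rule: quotients.induct)
  case (1 p q xs)
  then show ?case by (cases i) auto
qed auto

lemma quotients_permutes:
  "(\<And>p. p \<in> set xs \<Longrightarrow> p permutes A) \<Longrightarrow> r \<in> set (quotients xs) \<Longrightarrow> r permutes A"
proof (induction xs rule: quotients.induct)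
  case (1 p q xs)
  have "p permutes A" "q permutes A" using 1(2) by auto
  then have "inv p \<circ> q permutes A" by (intro permutes_compose permutes_inv)
  then show ?case using 1 by auto
qed auto

lemma multichain_of_ne: "multichain_of c rs \<noteq> []"
  and length_multichain_of: "length (multichain_of c rs) = Suc (length rs)"
  and last_multichain_of: "last (multichain_of c rs) = c"
  by (induction rs) auto

lemma multichain_of_permutes:
  "c permutes A \<Longrightarrow> (\<And>r. r \<in> set rs \<Longrightarrow> r permutes A) \<Longrightarrow> p \<in> set (multichain_of c rs) \<Longrightarrow> p permutes A"
proof (induction rs arbitrary: p)
  case (Cons r rs)
  have "hd (multichain_of c rs) permutes A" using Cons multichain_of_ne[of c rs] by simp
  then have "hd (multichain_of c rs) \<circ> inv r permutes A"
    using Cons by (intro permutes_compose permutes_inv) auto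
  then show ?case using Cons by auto
qed simp

lemma quotients_multichain_of:
  "c permutes A \<Longrightarrow> (\<And>r. r \<in> set rs \<Longrightarrow> r permutes A) \<Longrightarrow> quotients (multichain_of c rs) = rs"
proof (induction rs)
  case (Cons r rs)
  obtain q xs where qxs: "multichain_of c rs = q # xs" using multichain_of_ne[of c rs] by (cases "multichain_of c rs") auto
  have q: "q permutes A" using multichain_of_permutes[of c A rs q] Cons qxs by simp
  have r: "r permutes A" using Cons by simp
  have "inv (q \<circ> inv r) \<circ> q = r" by (rule inv_comp_cancel(1)[OF r q])
  then show ?case using Cons qxs by simp
qed simp

lemma multichain_of_quotients:
  "xs \<noteq> [] \<Longrightarrow> (\<And>p. p \<in> set xs \<Longrightarrow> p permutes A) \<Longrightarrow> multichain_of (last xs) (quotients xs) = xs"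
proof (induction xs rule: quotients.induct)
  case (1 p q xs)
  have p: "p permutes A" and q: "q permutes A" using 1(3) by auto
  have "q \<circ> inv (inv p \<circ> q) = p" by (rule inv_comp_cancel(2)[OF p q])
  then show ?case using 1 by simp
qed auto

primrec compose_all :: "('a \<Rightarrow> 'a) list \<Rightarrow> 'a \<Rightarrow> 'a" where
  "compose_all [] = id"
| "compose_all (f # fs) = f \<circ> compose_all fs"

lemma compose_all_append: "compose_all (fs @ gs) = compose_all fs \<circ> compose_all gs"
  by (induction fs) (auto simp: comp_assoc)

lemma compose_all_permutes: "(\<And>r. r \<in> set rs \<Longrightarrow> r permutes A) \<Longrightarrow> compose_all rs permutes A"
proof (induction rs)
  case (Cons r rs)
  have "compose_all rs permutes A" "r permutes A" using Cons by auto
  then show ?case by (simp only: compose_all.simps permutes_compose)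
qed (simp only: compose_all.simps permutes_id)

lemma hd_quotients_last:
  "xs \<noteq> [] \<Longrightarrow> (\<And>p. p \<in> set xs \<Longrightarrow> p permutes A) \<Longrightarrow> hd xs \<circ> compose_all (quotients xs) = last xs"
proof (induction xs rule: quotients.induct)
  case (1 p q xs)
  have p: "p permutes A" using 1(3) by simp
  have IH: "hd (q # xs) \<circ> compose_all (quotients (q # xs)) = last (q # xs)"
    by (rule 1(1)) (use 1(3) in auto)
  have "hd (p # q # xs) \<circ> compose_all (quotients (p # q # xs))
      = (p \<circ> inv p) \<circ> (hd (q # xs) \<circ> compose_all (quotients (q # xs)))"
    by (simp add: comp_assoc)
  also have "\<dots> = last (p # q # xs)" unfolding IH permutes_inv_o(1)[OF p] by simp
  finally show ?case .
qed auto

text \<open>Each step satisfies the triangle inequality \<open>tlen N q \<le> tlen N p + tlen N (inv p \<circ> q)\<close>, with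
  equality iff \<open>p \<le> q\<close>; the sum is sharp iff all steps are.\<close>

lemma tlen_multichain:
  "xs \<noteq> [] \<Longrightarrow> (\<And>p. p \<in> set xs \<Longrightarrow> p permutes {1..N}) \<Longrightarrow>
    tlen N (last xs) \<le> tlen N (hd xs) + sum_list (map (tlen N) (quotients xs)) \<and>
    (successively (abs_le N) xs \<longleftrightarrow>
      tlen N (last xs) = tlen N (hd xs) + sum_list (map (tlen N) (quotients xs)))"
proof (induction xs rule: quotients.induct)
  case (1 p q xs)
  have p: "p permutes {1..N}" and q: "q permutes {1..N}" using 1(3) by auto
  have "p \<circ> (inv p \<circ> q) = q" by (simp add: permutes_inv_o[OF p] flip: comp_assoc)
  then have le: "tlen N q \<le> tlen N p + tlen N (inv p \<circ> q)"
    using tlen_mult_le[OF p permutes_compose[OF q permutes_inv[OF p]]] by simp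
  have IH: "tlen N (last (q # xs)) \<le> tlen N (hd (q # xs)) + sum_list (map (tlen N) (quotients (q # xs))) \<and>
    (successively (abs_le N) (q # xs) \<longleftrightarrow>
      tlen N (last (q # xs)) = tlen N (hd (q # xs)) + sum_list (map (tlen N) (quotients (q # xs))))"
    by (rule 1(1)) (use 1(3) in auto)
  have unfold_first: "last (p # q # xs) = last (q # xs)" "hd (p # q # xs) = p"
    "sum_list (map (tlen N) (quotients (p # q # xs)))
      = tlen N (inv p \<circ> q) + sum_list (map (tlen N) (quotients (q # xs)))"
    "successively (abs_le N) (p # q # xs) \<longleftrightarrow> abs_le N p q \<and> successively (abs_le N) (q # xs)" by simp_all
  have arith: "c \<le> a + (x + S) \<and> (U \<and> V \<longleftrightarrow> c = a + (x + S))"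
    if "b \<le> a + x" "U \<longleftrightarrow> b = a + x" "c \<le> b + S \<and> (V \<longleftrightarrow> c = b + S)" for a b c x S :: nat and U V
    using that by auto
  show ?case
    unfolding unfold_first by (rule arith[OF le abs_le_def IH[unfolded list.sel(1)]])
qed auto

lemma multichain_le_last:
  "successively (abs_le N) xs \<Longrightarrow> (\<And>p. p \<in> set xs \<Longrightarrow> p permutes {1..N}) \<Longrightarrow> p \<in> set xs \<Longrightarrow>
    abs_le N p (last xs)"
proof (induction xs arbitrary: p rule: quotients.induct)
  case (1 a b xs)
  have le: "abs_le N q (last (b # xs))" if "q \<in> set (b # xs)" for q using 1 that by simp
  have "last (b # xs) \<in> set (a # b # xs)" using last_in_set[of "b # xs"] by simp
  then have "last (b # xs) permutes {1..N}" by (rule 1(3))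
  then have "abs_le N a (last (b # xs))"
    using abs_le_trans[of a N b "last (b # xs)"] le[of b] 1 by simp
  then show ?case using 1(4) le by auto
qed (auto intro: abs_le_refl)

section \<open>The complement of a shuffle\<close>

lemma nc_perm_iff: "nc_perm N w \<longleftrightarrow> w permutes {1..N} \<and> abs_le N w (long_cycle N)"
  using NC_A_iff NC_A_eq_nc_perm by auto

lemma nc_perm_left_complement:
  assumes "nc_perm N p" shows "nc_perm N (long_cycle N \<circ> inv p)"
proof -
  let ?c = "long_cycle N"
  note p = nc_perm_permutes[OF assms] and c = long_cycle_permutes[of N]
  have q: "?c \<circ> inv p permutes {1..N}" by (intro permutes_compose permutes_inv p c)
  have "tlen N ?c = tlen N p + tlen N (inv p \<circ> ?c)"
    using assms unfolding nc_perm_iff abs_le_def by simp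
  moreover have "tlen N (inv p \<circ> ?c) = tlen N (?c \<circ> inv p)" by (rule tlen_comm[OF permutes_inv[OF p] c])
  ultimately show ?thesis
    unfolding nc_perm_iff abs_le_def inv_comp_cancel(1)[OF p c] using q by simp
qed

lemma nc_perm_right_complement:
  assumes "nc_perm N p" shows "nc_perm N (inv p \<circ> long_cycle N)"
proof -
  let ?c = "long_cycle N"
  note p = nc_perm_permutes[OF assms] and c = long_cycle_permutes[of N]
  have q: "inv p \<circ> ?c permutes {1..N}" by (intro permutes_compose permutes_inv p c)
  have "inv (inv p \<circ> ?c) \<circ> ?c = inv ?c \<circ> p \<circ> inv (inv ?c)"
    unfolding inv_comp_inv(2)[OF p c] permutes_inv_inv[OF c] ..
  then have "tlen N (inv (inv p \<circ> ?c) \<circ> ?c) = tlen N p" using tlen_conj[OF p permutes_inv[OF c]] by simp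
  moreover have "tlen N ?c = tlen N p + tlen N (inv p \<circ> ?c)"
    using assms unfolding nc_perm_iff abs_le_def by simp
  ultimately show ?thesis unfolding nc_perm_iff abs_le_def using q by simp
qed

lemma abs_le_left_complement:
  assumes "nc_perm N p" "nc_perm N q"
  shows "abs_le N (long_cycle N \<circ> inv p) (long_cycle N \<circ> inv q) \<longleftrightarrow> abs_le N q p"
proof -
  let ?c = "long_cycle N"
  note p = nc_perm_permutes[OF assms(1)] and q = nc_perm_permutes[OF assms(2)] and c = long_cycle_permutes[of N]
  have len: "tlen N ?c = tlen N r + tlen N (?c \<circ> inv r)" if "nc_perm N r" for r
    using that tlen_comm[OF permutes_inv[OF nc_perm_permutes[OF that]] c]
    unfolding nc_perm_iff abs_le_def by simp
  have "inv (?c \<circ> inv p) \<circ> (?c \<circ> inv q) = p \<circ> (inv ?c \<circ> ?c) \<circ> inv q"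
    unfolding inv_comp_inv(1)[OF p c] by (simp only: comp_assoc)
  then have "inv (?c \<circ> inv p) \<circ> (?c \<circ> inv q) = p \<circ> inv q" by (simp add: permutes_inv_o[OF c])
  moreover have "tlen N (p \<circ> inv q) = tlen N (inv q \<circ> p)" by (rule tlen_comm[OF p permutes_inv[OF q]])
  ultimately show ?thesis unfolding abs_le_def using len[OF assms(1)] len[OF assms(2)] by auto
qed

lemma kreweras_left_complement:
  assumes "nc_perm N p"
  shows "kreweras N (cycle_partition N (long_cycle N \<circ> inv p)) = cycle_partition N p"
  using kreweras_cycles[OF nc_perm_left_complement[OF assms]]
  by (simp only: inv_comp_cancel(1)[OF nc_perm_permutes[OF assms] long_cycle_permutes])

lemma inj_on_kreweras: "inj_on (kreweras N) (NC N)"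
proof (rule inj_onI)
  fix P Q assume P: "P \<in> NC N" and Q: "Q \<in> NC N" and e: "kreweras N P = kreweras N Q"
  obtain p where p: "nc_perm N p" "cycle_partition N p = P" using nc_perm_of_partition[OF P] by blast
  obtain q where q: "nc_perm N q" "cycle_partition N q = Q" using nc_perm_of_partition[OF Q] by blast
  note c = long_cycle_permutes[of N]
  have "cycle_partition N (inv p \<circ> long_cycle N) = cycle_partition N (inv q \<circ> long_cycle N)"
    using kreweras_cycles[OF p(1)] kreweras_cycles[OF q(1)] e p(2) q(2) by simp
  then have e': "inv p \<circ> long_cycle N = inv q \<circ> long_cycle N"
    by (rule nc_perm_eqI[OF nc_perm_right_complement[OF p(1)] nc_perm_right_complement[OF q(1)]])
  have "p = long_cycle N \<circ> inv (inv p \<circ> long_cycle N)"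
    by (rule sym[OF inv_comp_cancel(2)[OF nc_perm_permutes[OF p(1)] c]])
  also have "\<dots> = q" unfolding e' by (rule inv_comp_cancel(2)[OF nc_perm_permutes[OF q(1)] c])
  finally show "P = Q" using p(2) q(2) by simp
qed

lemma kreweras_inv_cycles:
  assumes "nc_perm N p"
  shows "kreweras_inv N (cycle_partition N p) = cycle_partition N (long_cycle N \<circ> inv p)"
  unfolding kreweras_inv_def
  by (rule inv_into_f_eq[OF inj_on_kreweras cycle_partition_in_NC[OF nc_perm_left_complement[OF assms]]
        kreweras_left_complement[OF assms]])

text \<open>If the shuffle is noncrossing, this is the noncrossing permutation whose orbit partition has the
  orbit partition of the shuffle as its Kreweras complement.\<close>

definition shuffle_complement :: "nat \<Rightarrow> (nat \<Rightarrow> nat) list \<Rightarrow> nat \<Rightarrow> nat" where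
  "shuffle_complement N rs = long_cycle (length rs * N) \<circ> inv (shuffle_perm N rs)"

context
  fixes N :: nat and rs :: "(nat \<Rightarrow> nat) list"
  assumes rs: "\<And>r. r \<in> set rs \<Longrightarrow> r permutes {1..N}"
begin

lemma shuffle_complement_permutes: "shuffle_complement N rs permutes {1..length rs * N}"
  unfolding shuffle_complement_def
  by (intro permutes_compose permutes_inv long_cycle_permutes shuffle_perm_permutes rs)

lemma shuffle_complement_pos:
  assumes i: "i < length rs" and j: "j \<in> {1..N}"
  shows "shuffle_complement N rs (pos (length rs) i ((rs ! i) j)) =
    (if Suc i < length rs then pos (length rs) (Suc i) j else pos (length rs) 0 (long_cycle N j))"
proof -
  have "inv (shuffle_perm N rs) (pos (length rs) i ((rs ! i) j)) = pos (length rs) i j"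
    unfolding shuffle_perm_pos[OF i j, symmetric]
    by (rule permutes_inverses(2)[OF shuffle_perm_permutes[OF rs]])
  then show ?thesis
    unfolding shuffle_complement_def comp_apply using long_cycle_pos[OF i j] by simp
qed

lemma shifts_shuffle_complement: "shifts (length rs) N (shuffle_complement N rs)"
  unfolding shifts_def
proof
  fix x assume "x \<in> {1..length rs * N}"
  then obtain i j' where ij: "i < length rs" "j' \<in> {1..N}" "x = pos (length rs) i j'" by (rule pos_cases)
  have r: "rs ! i permutes {1..N}" using rs ij(1) by simp
  define j where "j = inv (rs ! i) j'"
  have j: "j \<in> {1..N}" unfolding j_def using permutes_in_image[OF permutes_inv[OF r]] ij(2) by simp
  have x: "x = pos (length rs) i ((rs ! i) j)" unfolding j_def permutes_inverses(1)[OF r] by (rule ij(3))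
  have j'1: "1 \<le> j'" and j1: "1 \<le> j" using ij(2) j by simp_all
  have k: "0 < length rs" using ij(1) by linarith
  have "1 \<le> x" unfolding ij(3) pos_alt[OF ij(1) j'1] by simp
  then have "x mod length rs = Suc (x - 1) mod length rs" by simp
  also have "\<dots> = Suc ((x - 1) mod length rs) mod length rs" by (rule sym[OF mod_Suc_eq])
  also have "(x - 1) mod length rs = i" unfolding ij(3) by (rule pos_div_mod(1)[OF ij(1) j'1])
  finally have xm: "x mod length rs = Suc i mod length rs" .
  have cj: "1 \<le> long_cycle N j" using permutes_in_image[OF long_cycle_permutes, of N j] j by simp
  show "(shuffle_complement N rs x - 1) mod length rs = x mod length rs"
  proof (cases "Suc i < length rs")
    case True
    have "shuffle_complement N rs x = pos (length rs) (Suc i) j"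
      unfolding x using shuffle_complement_pos[OF ij(1) j] True by simp
    then show ?thesis unfolding xm using pos_div_mod(1)[OF True j1] True by simp
  next
    case False
    have "shuffle_complement N rs x = pos (length rs) 0 (long_cycle N j)"
      unfolding x using shuffle_complement_pos[OF ij(1) j] False by simp
    moreover have "Suc i = length rs" using False ij(1) by linarith
    ultimately show ?thesis unfolding xm using pos_div_mod(1)[OF k cj] by simp
  qed
qed

lemma shuffle_complement_steps:
  "m < length rs \<Longrightarrow> y \<in> {1..N} \<Longrightarrow>
    (shuffle_complement N rs ^^ m) (pos (length rs) 0 (compose_all (take m rs) y)) = pos (length rs) m y"
proof (induction m arbitrary: y)
  case 0
  then show ?case by simp
next
  case (Suc m)
  have m: "m < length rs" using Suc by simp
  have "(rs ! m) y \<in> {1..N}" by (rule nth_permutes_mem[OF rs m Suc.prems(2)])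
  note IH = Suc.IH[OF m this]
  have t: "compose_all (take (Suc m) rs) y = compose_all (take m rs) ((rs ! m) y)"
    unfolding take_Suc_conv_app_nth[OF m] compose_all_append by simp
  show ?case
    unfolding t funpow.simps comp_apply IH shuffle_complement_pos[OF m Suc.prems(2)] using Suc.prems(1) by simp
qed

text \<open>Once around the classes, \<open>shuffle_complement\<close> applies the inverses of all entries and then \<open>c\<close>.\<close>

lemma shuffle_complement_return:
  assumes k: "0 < length rs" and q: "q \<circ> compose_all rs = long_cycle N" and j: "j \<in> {1..N}"
  shows "(shuffle_complement N rs ^^ length rs) (pos (length rs) 0 j) = pos (length rs) 0 (q j)"
proof -
  let ?F = "compose_all rs"
  obtain m where m: "length rs = Suc m" using k by (cases "length rs") auto
  have F: "?F permutes {1..N}" by (rule compose_all_permutes) (rule rs)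
  define y where "y = inv ?F j"
  have Fy: "?F y = j" unfolding y_def by (rule permutes_inverses(1)[OF F])
  have y: "y \<in> {1..N}" unfolding y_def using permutes_in_image[OF permutes_inv[OF F]] j by simp
  have ml: "m < length rs" using m by simp
  have my: "(rs ! m) y \<in> {1..N}" by (rule nth_permutes_mem[OF rs ml y])
  have "rs = take m rs @ [rs ! m]" using take_Suc_conv_app_nth[OF ml] m by simp
  then have "?F = compose_all (take m rs) \<circ> compose_all [rs ! m]" by (metis compose_all_append)
  then have "?F y = compose_all (take m rs) ((rs ! m) y)" by simp
  then have "(shuffle_complement N rs ^^ m) (pos (length rs) 0 j) = pos (length rs) m ((rs ! m) y)"
    using shuffle_complement_steps[OF ml my] Fy by simp
  then have "(shuffle_complement N rs ^^ Suc m) (pos (length rs) 0 j) = pos (length rs) 0 (long_cycle N y)"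
    unfolding funpow.simps comp_apply using shuffle_complement_pos[OF ml y] m by simp
  moreover have "long_cycle N y = q j" unfolding q[symmetric] comp_apply Fy ..
  ultimately show ?thesis unfolding m by simp
qed

lemma tlen_shuffle_complement:
  assumes k: "0 < length rs" and q: "q permutes {1..N}" "q \<circ> compose_all rs = long_cycle N"
  shows "tlen (length rs * N) (shuffle_complement N rs) + N = tlen N q + length rs * N"
proof -
  have "cyc (length rs * N) (shuffle_complement N rs) = cyc N q"
    by (rule cyc_first_return[OF k shuffle_complement_permutes shifts_shuffle_complement q(1)
          shuffle_complement_return[OF k q(2)]])
  then show ?thesis using tlen_cyc[OF shuffle_complement_permutes] tlen_cyc[OF q(1)] by linarith
qed

text \<open>The shuffle is as long as its entries together, and its complement has as many orbits as \<open>q\<close>.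
  So the lengths of the two exceed that of the long cycle of \<open>{1..k N}\<close> by as much as the lengths in
  the factorization of \<open>c\<close> into \<open>q\<close> and the entries exceed that of \<open>c\<close>.\<close>

lemma nc_perm_shuffle_perm_iff:
  assumes k: "0 < length rs" and N: "1 \<le> N" and q: "q permutes {1..N}" "q \<circ> compose_all rs = long_cycle N"
  shows "nc_perm (length rs * N) (shuffle_perm N rs) \<longleftrightarrow>
    tlen N (long_cycle N) = tlen N q + sum_list (map (tlen N) rs)"
proof -
  let ?M = "length rs * N" and ?s = "shuffle_perm N rs"
  have s: "?s permutes {1..?M}" by (rule shuffle_perm_permutes) (rule rs)
  have M: "1 \<le> ?M" using k N by (simp add: Suc_le_eq)
  have len: "tlen ?M ?s = sum_list (map (tlen N) rs)"
  proof -
    have "tlen ?M ?s = (\<Sum>i<length rs. tlen N (rs ! i))" by (rule tlen_shuffle_perm) (rule rs)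
    then show ?thesis by (simp add: sum_list_sum_nth atLeast0LessThan)
  qed
  have "tlen ?M (inv ?s \<circ> long_cycle ?M) = tlen ?M (shuffle_complement N rs)"
    unfolding shuffle_complement_def by (rule tlen_comm[OF permutes_inv[OF s] long_cycle_permutes])
  then have "nc_perm ?M ?s \<longleftrightarrow>
      tlen ?M (long_cycle ?M) = sum_list (map (tlen N) rs) + tlen ?M (shuffle_complement N rs)"
    unfolding nc_perm_iff abs_le_def using s len by presburger
  moreover have "A = S + B \<longleftrightarrow> a = b + S"
    if "B + N = b + M" "Suc A = M" "Suc a = N" for A B a b M S
    using that by auto
  ultimately show ?thesis
    using tlen_shuffle_complement[OF k q] tlen_long_cycle[OF M] tlen_long_cycle[OF N] by blast
qed

end

lemma shuffle_perm_inject: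
  assumes "length rs = length ss" "\<And>r. r \<in> set rs \<Longrightarrow> r permutes {1..N}" "\<And>r. r \<in> set ss \<Longrightarrow> r permutes {1..N}"
    and e: "shuffle_perm N rs = shuffle_perm N ss"
  shows "rs = ss"
proof (rule nth_equalityI[OF assms(1)])
  fix i assume i: "i < length rs"
  have i': "i < length ss" using i assms(1) by simp
  have pr: "rs ! i permutes {1..N}" and ps: "ss ! i permutes {1..N}" using assms(2,3) i i' by auto
  show "rs ! i = ss ! i"
  proof
    fix j
    show "(rs ! i) j = (ss ! i) j"
    proof (cases "j \<in> {1..N}")
      case True
      have r: "(rs ! i) j \<in> {1..N}" "(ss ! i) j \<in> {1..N}"
        using permutes_in_image[OF pr] permutes_in_image[OF ps] True by auto
      have "pos (length rs) i ((rs ! i) j) = pos (length rs) i ((ss ! i) j)"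
        using shuffle_perm_pos[OF i True] shuffle_perm_pos[OF i' True] e assms(1) by simp
      then show ?thesis using pos_eq_iff[OF i _ i] r by simp
    next
      case False
      then show ?thesis using permutes_not_in[OF pr] permutes_not_in[OF ps] by simp
    qed
  qed
qed

text \<open>Lengths of shuffles are sums of lengths, and a sum of triangle inequalities is sharp iff each of
  them is.\<close>

lemma abs_le_shuffle_perm_iff:
  assumes len: "length rs = length ss"
    and rs: "\<And>r. r \<in> set rs \<Longrightarrow> r permutes {1..N}" and ss: "\<And>r. r \<in> set ss \<Longrightarrow> r permutes {1..N}"
  shows "abs_le (length rs * N) (shuffle_perm N rs) (shuffle_perm N ss) \<longleftrightarrow>
    (\<forall>i<length rs. abs_le N (rs ! i) (ss ! i))"
proof -
  let ?k = "length rs"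
  define qs where "qs = map2 (\<circ>) (map inv rs) ss"
  have qs: "qs ! i = inv (rs ! i) \<circ> ss ! i" if "i < ?k" for i using that len unfolding qs_def by simp
  have lq: "length qs = ?k" using len unfolding qs_def by simp
  have pr: "rs ! i permutes {1..N}" and ps: "ss ! i permutes {1..N}" if "i < ?k" for i
    using rs ss that len by auto
  have pq: "q permutes {1..N}" if qm: "q \<in> set qs" for q
  proof -
    obtain i where i: "i < ?k" "q = qs ! i" using qm lq in_set_conv_nth[of q qs] by auto
    show ?thesis unfolding i(2) qs[OF i(1)] using pr[OF i(1)] ps[OF i(1)] by (intro permutes_compose permutes_inv)
  qed
  have "inv (shuffle_perm N rs) \<circ> shuffle_perm N ss = shuffle_perm N qs"
  proof -
    have "inv (shuffle_perm N rs) = shuffle_perm N (map inv rs)" by (rule inv_shuffle_perm) (rule rs)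
    moreover have "shuffle_perm N (map inv rs) \<circ> shuffle_perm N ss = shuffle_perm N qs"
      unfolding qs_def by (rule shuffle_perm_comp) (use ss len in simp_all)
    ultimately show ?thesis by simp
  qed
  moreover have "tlen (?k * N) (shuffle_perm N ss) = (\<Sum>i<?k. tlen N (ss ! i))"
    unfolding len by (rule tlen_shuffle_perm) (rule ss)
  moreover have "tlen (?k * N) (shuffle_perm N rs) = (\<Sum>i<?k. tlen N (rs ! i))"
    by (rule tlen_shuffle_perm) (rule rs)
  moreover have "tlen (?k * N) (shuffle_perm N qs) = (\<Sum>i<?k. tlen N (inv (rs ! i) \<circ> ss ! i))"
  proof -
    have "tlen (length qs * N) (shuffle_perm N qs) = (\<Sum>i<length qs. tlen N (qs ! i))"
      by (rule tlen_shuffle_perm) (rule pq)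
    also have "\<dots> = (\<Sum>i<?k. tlen N (inv (rs ! i) \<circ> ss ! i))"
      unfolding lq by (rule sum.cong) (use qs in simp_all)
    finally show ?thesis unfolding lq .
  qed
  ultimately have "abs_le (?k * N) (shuffle_perm N rs) (shuffle_perm N ss) \<longleftrightarrow>
      (\<Sum>i<?k. tlen N (ss ! i)) = (\<Sum>i<?k. tlen N (rs ! i) + tlen N (inv (rs ! i) \<circ> ss ! i))"
    unfolding abs_le_def by (simp add: sum.distrib)
  also have "\<dots> \<longleftrightarrow> (\<forall>i<?k. tlen N (ss ! i) = tlen N (rs ! i) + tlen N (inv (rs ! i) \<circ> ss ! i))"
  proof
    assume e: "(\<Sum>i<?k. tlen N (ss ! i)) = (\<Sum>i<?k. tlen N (rs ! i) + tlen N (inv (rs ! i) \<circ> ss ! i))"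
    have le: "tlen N (ss ! i) \<le> tlen N (rs ! i) + tlen N (inv (rs ! i) \<circ> ss ! i)" if i: "i \<in> {..<?k}" for i
    proof -
      have r: "rs ! i permutes {1..N}" and s: "ss ! i permutes {1..N}" using pr ps i by auto
      have "rs ! i \<circ> (inv (rs ! i) \<circ> ss ! i) = ss ! i" by (simp add: permutes_inv_o[OF r] flip: comp_assoc)
      then show ?thesis using tlen_mult_le[OF r permutes_compose[OF s permutes_inv[OF r]]] by simp
    qed
    show "\<forall>i<?k. tlen N (ss ! i) = tlen N (rs ! i) + tlen N (inv (rs ! i) \<circ> ss ! i)"
    proof (intro allI impI)
      fix i assume "i < ?k"
      then have i: "i \<in> {..<?k}" by simp
      show "tlen N (ss ! i) = tlen N (rs ! i) + tlen N (inv (rs ! i) \<circ> ss ! i)"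
        by (rule sum_mono_inv[OF e le i]) simp_all
    qed
  qed simp
  finally show ?thesis unfolding abs_le_def .
qed

section \<open>The map on multichains\<close>

definition chain_quotients :: "nat \<Rightarrow> (nat \<Rightarrow> nat) list \<Rightarrow> (nat \<Rightarrow> nat) list" where
  "chain_quotients N ps = quotients (ps @ [long_cycle N])"

lemma NCk_A_iff:
  "ps \<in> NCk_A N k \<longleftrightarrow>
    length ps = k \<and> (\<forall>p\<in>set ps. p permutes {1..N}) \<and> successively (abs_le N) (ps @ [long_cycle N])"
proof
  assume "ps \<in> NCk_A N k"
  then have ps: "length ps = k" "set ps \<subseteq> NC_A N" "successively (abs_le N) ps" by (auto simp: NCk_A_def)
  have "abs_le N (last ps) (long_cycle N)" if "ps \<noteq> []"
    using ps(2) last_in_set[OF that] by (auto simp: NC_A_iff)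
  then show "length ps = k \<and> (\<forall>p\<in>set ps. p permutes {1..N}) \<and> successively (abs_le N) (ps @ [long_cycle N])"
    using ps by (auto simp: successively_append_iff NC_A_iff)
next
  assume R: "length ps = k \<and> (\<forall>p\<in>set ps. p permutes {1..N}) \<and> successively (abs_le N) (ps @ [long_cycle N])"
  have "abs_le N p (long_cycle N)" if "p \<in> set ps" for p
    using multichain_le_last[of N "ps @ [long_cycle N]" p] R that long_cycle_permutes by auto
  then show "ps \<in> NCk_A N k" using R by (auto simp: NCk_A_def NC_A_iff successively_append_iff)
qed

context
  fixes N k :: nat and ps :: "(nat \<Rightarrow> nat) list"
  assumes N: "1 \<le> N" and k: "1 \<le> k" and ps: "ps \<in> NCk_A N k"
begin

lemma chain_permutes: "p \<in> set (ps @ [long_cycle N]) \<Longrightarrow> p permutes {1..N}"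
  using ps long_cycle_permutes unfolding NCk_A_iff by auto

lemma length_chain: "length ps = k" using ps by (simp add: NCk_A_iff)

lemma length_chain_quotients: "length (chain_quotients N ps) = k"
  by (simp add: chain_quotients_def length_quotients length_chain)

lemma chain_quotients_permutes: "r \<in> set (chain_quotients N ps) \<Longrightarrow> r permutes {1..N}"
  unfolding chain_quotients_def by (rule quotients_permutes[OF chain_permutes])

lemma nth_chain_quotients:
  assumes "i < k" shows "chain_quotients N ps ! i = inv (ps ! i) \<circ> (ps @ [long_cycle N]) ! Suc i"
  unfolding chain_quotients_def using nth_quotients[of i "ps @ [long_cycle N]"] assms length_chain
  by (simp add: nth_append)

lemma multichain_of_chain_quotients: "multichain_of (long_cycle N) (chain_quotients N ps) = ps @ [long_cycle N]"
  unfolding chain_quotients_def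
  using multichain_of_quotients[of "ps @ [long_cycle N]" "{1..N}"] chain_permutes by simp

lemma nc_perm_chain: "p \<in> set (ps @ [long_cycle N]) \<Longrightarrow> nc_perm N p"
  using ps nc_perm_long_cycle NC_A_imp_nc_perm by (auto simp: NCk_A_def)

lemma nc_perm_shuffle_chain: "nc_perm (k * N) (shuffle_perm N (chain_quotients N ps))"
proof -
  let ?xs = "ps @ [long_cycle N]" and ?rs = "chain_quotients N ps"
  have "hd ?xs \<in> set ?xs" by (rule hd_in_set) simp
  then have q: "hd ?xs permutes {1..N}" by (rule chain_permutes)
  have "hd ?xs \<circ> compose_all (quotients ?xs) = last ?xs"
    by (rule hd_quotients_last) (simp, rule chain_permutes)
  then have qf: "hd ?xs \<circ> compose_all ?rs = long_cycle N" unfolding chain_quotients_def by simp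
  have "successively (abs_le N) ?xs" using ps by (simp add: NCk_A_iff)
  moreover have "successively (abs_le N) ?xs \<longleftrightarrow>
      tlen N (last ?xs) = tlen N (hd ?xs) + sum_list (map (tlen N) (quotients ?xs))"
    by (rule conjunct2[OF tlen_multichain]) (simp, rule chain_permutes)
  ultimately have len: "tlen N (long_cycle N) = tlen N (hd ?xs) + sum_list (map (tlen N) ?rs)"
    unfolding chain_quotients_def by simp
  have "0 < length ?rs" using length_chain_quotients k by simp
  then show ?thesis
    using nc_perm_shuffle_perm_iff[OF chain_quotients_permutes _ N q qf] len length_chain_quotients by simp
qed

lemma kreweras_sequence_eq: "kreweras_sequence N ps = map (cycle_partition N) (chain_quotients N ps)"
proof (rule nth_equalityI)
  show l: "length (kreweras_sequence N ps) = length (map (cycle_partition N) (chain_quotients N ps))"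
    using k by (simp add: kreweras_sequence_def length_chain_quotients length_chain)
  fix i assume "i < length (kreweras_sequence N ps)"
  then have i: "i < k" unfolding l by (simp add: length_chain_quotients)
  have lps: "i < length ps" using i length_chain by simp
  have nc: "nc_perm N (ps ! i)" using nc_perm_chain lps by simp
  have "kreweras_sequence N ps ! i = cycle_partition N (inv (ps ! i) \<circ> (ps @ [long_cycle N]) ! Suc i)"
  proof (cases "Suc i < k")
    case True
    have nc': "nc_perm N (ps ! Suc i)" using nc_perm_chain True length_chain by simp
    have "successively (abs_le N) ps" using ps by (simp add: NCk_A_def)
    then have "abs_le N (ps ! i) (ps ! Suc i)" using True length_chain by (simp add: successively_conv_nth)
    then have "orbit (ps ! i) x \<subseteq> orbit (ps ! Suc i) x" for x
      by (rule abs_le_orbit_subset[OF nc_perm_permutes[OF nc] nc_perm_permutes[OF nc']])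
    then have "rel_kreweras (cycle_partition N (ps ! Suc i)) (cycle_partition N (ps ! i))
        = cycle_partition N (inv (ps ! i) \<circ> ps ! Suc i)"
      by (rule rel_kreweras_cycles[OF nc nc'])
    then show ?thesis
      using True length_chain less_diff_conv[of i k 1] by (simp add: kreweras_sequence_def nth_append)
  next
    case False
    then have ik: "i = k - 1" using i by simp
    have "ps \<noteq> []" using k length_chain by auto
    then have "last ps = ps ! i" using ik length_chain by (simp add: last_conv_nth)
    then show ?thesis
      using False ik k length_chain kreweras_cycles[OF nc] by (simp add: kreweras_sequence_def nth_append)
  qed
  then show "kreweras_sequence N ps ! i = map (cycle_partition N) (chain_quotients N ps) ! i"
    using nth_chain_quotients[OF i] i length_chain_quotients by simp
qed

lemma shuffle_kreweras_sequence:
  "shuffle_partition (kreweras_sequence N ps) = cycle_partition (k * N) (shuffle_perm N (chain_quotients N ps))"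
proof -
  have "shuffle_partition (map (cycle_partition N) (chain_quotients N ps))
      = cycle_partition (length (chain_quotients N ps) * N) (shuffle_perm N (chain_quotients N ps))"
    by (rule shuffle_partition_cycles) (rule chain_quotients_permutes)
  then show ?thesis unfolding kreweras_sequence_eq length_chain_quotients .
qed

lemma nabla_eq: "nabla N ps = cycle_partition (k * N) (shuffle_complement N (chain_quotients N ps))"
  unfolding nabla_def length_chain shuffle_kreweras_sequence
  using kreweras_inv_cycles[OF nc_perm_shuffle_chain]
  by (simp only: shuffle_complement_def length_chain_quotients)

lemma nc_perm_shuffle_complement: "nc_perm (k * N) (shuffle_complement N (chain_quotients N ps))"
  using nc_perm_left_complement[OF nc_perm_shuffle_chain]
  by (simp only: shuffle_complement_def length_chain_quotients)

lemma nabla_in_NC: "nabla N ps \<in> NC (k * N)"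
  unfolding nabla_eq by (rule cycle_partition_in_NC[OF nc_perm_shuffle_complement])

lemma shuffle_in_kreweras_image: "shuffle_partition (kreweras_sequence N ps) \<in> kreweras (k * N) ` NC (k * N)"
proof (rule image_eqI)
  show "shuffle_partition (kreweras_sequence N ps) = kreweras (k * N) (nabla N ps)"
    unfolding nabla_eq shuffle_kreweras_sequence shuffle_complement_def length_chain_quotients
    by (rule sym[OF kreweras_left_complement[OF nc_perm_shuffle_chain]])
qed (rule nabla_in_NC)

lemma nabla_card_dvd:
  assumes "B \<in> nabla N ps" shows "k dvd card B"
proof -
  obtain x where x: "x \<in> {1..k * N}" "B = orbit (shuffle_complement N (chain_quotients N ps)) x"
    using assms unfolding nabla_eq cycle_partition_def by (rule imageE) blast
  have "shifts (length (chain_quotients N ps)) N (shuffle_complement N (chain_quotients N ps))"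
    by (rule shifts_shuffle_complement) (rule chain_quotients_permutes)
  then have "shifts k N (shuffle_complement N (chain_quotients N ps))" unfolding length_chain_quotients .
  then show ?thesis
    unfolding x(2) using card_orbit_dvd[OF nc_perm_permutes[OF nc_perm_shuffle_complement] _ x(1)] by simp
qed

end

lemma NCk_le_iff_refines:
  assumes N: "1 \<le> N" and k: "1 \<le> k" and ps: "ps \<in> NCk_A N k" and qs: "qs \<in> NCk_A N k"
  shows "NCk_le N ps qs \<longleftrightarrow> refines {1..k * N} (nabla N ps) (nabla N qs)"
proof -
  let ?P = "chain_quotients N ps" and ?Q = "chain_quotients N qs"
  note lP = length_chain_quotients[OF N k ps] and lQ = length_chain_quotients[OF N k qs]
  have "NCk_le N ps qs \<longleftrightarrow> (\<forall>i<k. abs_le N (?Q ! i) (?P ! i))"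
    unfolding NCk_le_def length_chain[OF N k ps]
    using nth_chain_quotients[OF N k ps] nth_chain_quotients[OF N k qs] by simp
  also have "\<dots> \<longleftrightarrow> abs_le (k * N) (shuffle_perm N ?Q) (shuffle_perm N ?P)"
    using abs_le_shuffle_perm_iff[of ?Q ?P N] chain_quotients_permutes[OF N k ps] chain_quotients_permutes[OF N k qs]
      lP lQ by simp
  also have "\<dots> \<longleftrightarrow> abs_le (k * N) (shuffle_complement N ?P) (shuffle_complement N ?Q)"
    unfolding shuffle_complement_def lP lQ
    by (rule sym[OF abs_le_left_complement[OF nc_perm_shuffle_chain[OF N k ps] nc_perm_shuffle_chain[OF N k qs]]])
  also have "\<dots> \<longleftrightarrow> refines {1..k * N} (nabla N ps) (nabla N qs)"
    unfolding nabla_eq[OF N k ps] nabla_eq[OF N k qs]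
    by (rule abs_le_iff_refines[OF nc_perm_shuffle_complement[OF N k ps] nc_perm_shuffle_complement[OF N k qs]])
  finally show ?thesis .
qed

lemma inj_on_nabla:
  assumes N: "1 \<le> N" and k: "1 \<le> k" shows "inj_on (nabla N) (NCk_A N k)"
proof (rule inj_onI)
  fix ps qs assume ps: "ps \<in> NCk_A N k" and qs: "qs \<in> NCk_A N k" and e: "nabla N ps = nabla N qs"
  let ?P = "chain_quotients N ps" and ?Q = "chain_quotients N qs"
  note lP = length_chain_quotients[OF N k ps] and lQ = length_chain_quotients[OF N k qs]
  note pP = nc_perm_permutes[OF nc_perm_shuffle_chain[OF N k ps]]
    and pQ = nc_perm_permutes[OF nc_perm_shuffle_chain[OF N k qs]]
  have "shuffle_complement N ?P = shuffle_complement N ?Q"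
    using nc_perm_eqI[OF nc_perm_shuffle_complement[OF N k ps] nc_perm_shuffle_complement[OF N k qs]]
      e nabla_eq[OF N k ps] nabla_eq[OF N k qs] by simp
  then have "inv (shuffle_complement N ?P) \<circ> long_cycle (k * N) = inv (shuffle_complement N ?Q) \<circ> long_cycle (k * N)"
    by simp
  then have "shuffle_perm N ?P = shuffle_perm N ?Q"
    unfolding shuffle_complement_def lP lQ
      inv_comp_cancel(1)[OF pP long_cycle_permutes] inv_comp_cancel(1)[OF pQ long_cycle_permutes] .
  then have "?P = ?Q"
    using shuffle_perm_inject[of ?P ?Q N] lP lQ chain_quotients_permutes[OF N k ps] chain_quotients_permutes[OF N k qs]
    by simp
  then have "ps @ [long_cycle N] = qs @ [long_cycle N]"
    using multichain_of_chain_quotients[OF N k ps] multichain_of_chain_quotients[OF N k qs] by metis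
  then show "ps = qs" by simp
qed

text \<open>By divisibility \<open>w\<close> shifts the residue classes, so \<open>w\<^sup>-\<^sup>1 c\<close>, with \<open>c\<close> the long cycle of \<open>{1..k N}\<close>, is a
  shuffle. Its entries are the quotients of a sequence ending in the long cycle of \<open>{1..N}\<close>, and this is
  a multichain because minimality passes from the shuffle to the factorization.\<close>

lemma nabla_surj:
  assumes N: "1 \<le> N" and k: "1 \<le> k" and w: "nc_perm (k * N) w"
    and dvd: "\<And>B. B \<in> cycle_partition (k * N) w \<Longrightarrow> k dvd card B"
  obtains ps where "ps \<in> NCk_A N k" "shuffle_perm N (chain_quotients N ps) = inv w \<circ> long_cycle (k * N)"
    "nabla N ps = cycle_partition (k * N) w"
proof -
  let ?C = "long_cycle (k * N)" and ?c = "long_cycle N"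
  note p = nc_perm_permutes[OF w]
  obtain rs where rs: "length rs = k" "\<And>r. r \<in> set rs \<Longrightarrow> r permutes {1..N}" "inv w \<circ> ?C = shuffle_perm N rs"
    using shuffle_of_shifts[OF p shifts_of_card_orbit_dvd[OF w dvd] long_cycle_permutes shifts_long_cycle] by metis
  define xs where "xs = multichain_of ?c rs"
  define ps where "ps = butlast xs"
  have xs: "ps @ [?c] = xs"
    unfolding ps_def xs_def using multichain_of_ne last_multichain_of by (metis append_butlast_last_id)
  have pxs: "q permutes {1..N}" if "q \<in> set xs" for q
    using multichain_of_permutes[OF long_cycle_permutes rs(2)] that unfolding xs_def by simp
  have qxs: "quotients xs = rs" unfolding xs_def by (rule quotients_multichain_of[OF long_cycle_permutes rs(2)])
  have ne: "xs \<noteq> []" and last: "last xs = ?c" unfolding xs_def by (rule multichain_of_ne, rule last_multichain_of)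
  have q: "hd xs permutes {1..N}" using pxs ne by simp
  have qf: "hd xs \<circ> compose_all rs = ?c" using hd_quotients_last[OF ne pxs] unfolding qxs last .
  have "nc_perm (length rs * N) (shuffle_perm N rs)"
    using nc_perm_right_complement[OF w] unfolding rs(1) rs(3)[symmetric] .
  moreover have "0 < length rs" using rs(1) k by simp
  ultimately have "tlen N ?c = tlen N (hd xs) + sum_list (map (tlen N) rs)"
    using nc_perm_shuffle_perm_iff[OF rs(2) _ N q qf] by simp
  then have "successively (abs_le N) xs"
    using conjunct2[OF tlen_multichain[OF ne pxs]] unfolding qxs last by simp
  moreover have "length ps = k" unfolding ps_def xs_def by (simp add: length_multichain_of rs(1))
  moreover have "\<forall>q\<in>set ps. q permutes {1..N}" using pxs xs by (metis in_set_butlastD ps_def)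
  ultimately have ps: "ps \<in> NCk_A N k" unfolding NCk_A_iff xs by simp
  have cq: "chain_quotients N ps = rs" unfolding chain_quotients_def xs by (rule qxs)
  have "shuffle_complement N rs = w"
    unfolding shuffle_complement_def rs(1) rs(3)[symmetric]
    by (rule inv_comp_cancel(2)[OF p long_cycle_permutes])
  then have "nabla N ps = cycle_partition (k * N) w" using nabla_eq[OF N k ps] cq by simp
  then show ?thesis using that ps cq rs(3) by simp
qed

section \<open>The antipodal symmetry\<close>

text \<open>Commuting with the antipodal rotation is passed along the construction: from the multichain to
  its quotients and back, to their shuffle, to its complement, and to the orbit partition.\<close>

lemma commute_comp:
  assumes "p \<circ> h = h \<circ> p" "q \<circ> h = h \<circ> q" shows "(p \<circ> q) \<circ> h = h \<circ> (p \<circ> q)"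
  using assms by (metis comp_assoc)

lemma commute_inv:
  assumes "bij p" "p \<circ> h = h \<circ> p" shows "inv p \<circ> h = h \<circ> inv p"
proof -
  have i: "inv p \<circ> p = id" "p \<circ> inv p = id" using assms(1) by (simp_all add: bij_def surj_iff)
  have "inv p \<circ> h = inv p \<circ> h \<circ> (p \<circ> inv p)" unfolding i by simp
  also have "\<dots> = inv p \<circ> (h \<circ> p) \<circ> inv p" by (simp only: comp_assoc)
  also have "\<dots> = (inv p \<circ> p) \<circ> h \<circ> inv p" unfolding assms(2)[symmetric] by (simp only: comp_assoc)
  finally show ?thesis unfolding i by simp
qed

lemma quotients_commute:
  "(\<And>p. p \<in> set xs \<Longrightarrow> bij p \<and> p \<circ> h = h \<circ> p) \<Longrightarrow> r \<in> set (quotients xs) \<Longrightarrow> r \<circ> h = h \<circ> r"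
proof (induction xs rule: quotients.induct)
  case (1 p q xs)
  have p: "bij p \<and> p \<circ> h = h \<circ> p" and q: "bij q \<and> q \<circ> h = h \<circ> q" by (rule 1(2), simp)+
  have "inv p \<circ> h = h \<circ> inv p" by (rule commute_inv) (use p in blast)+
  moreover have "q \<circ> h = h \<circ> q" using q ..
  ultimately have "(inv p \<circ> q) \<circ> h = h \<circ> (inv p \<circ> q)" by (rule commute_comp)
  moreover have "r = inv p \<circ> q \<or> r \<in> set (quotients (q # xs))" using 1(3) by auto
  moreover have "r \<circ> h = h \<circ> r" if "r \<in> set (quotients (q # xs))"
    by (rule 1(1)[OF _ that]) (rule 1(2), simp)
  ultimately show ?case by metis
qed auto

lemma multichain_of_commute:
  "c \<circ> h = h \<circ> c \<Longrightarrow> (\<And>r. r \<in> set rs \<Longrightarrow> bij r \<and> r \<circ> h = h \<circ> r) \<Longrightarrow> p \<in> set (multichain_of c rs) \<Longrightarrow>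
    p \<circ> h = h \<circ> p"
proof (induction rs arbitrary: p)
  case (Cons r rs)
  have IH: "q \<circ> h = h \<circ> q" if "q \<in> set (multichain_of c rs)" for q
    by (rule Cons.IH[OF Cons.prems(1) _ that]) (rule Cons.prems(2), simp)
  have "hd (multichain_of c rs) \<circ> h = h \<circ> hd (multichain_of c rs)"
    by (rule IH[OF hd_in_set[OF multichain_of_ne]])
  moreover have "bij r \<and> r \<circ> h = h \<circ> r" by (rule Cons.prems(2)) simp
  then have "inv r \<circ> h = h \<circ> inv r" using commute_inv by blast
  ultimately have "(hd (multichain_of c rs) \<circ> inv r) \<circ> h = h \<circ> (hd (multichain_of c rs) \<circ> inv r)"
    by (rule commute_comp)
  moreover have "p = hd (multichain_of c rs) \<circ> inv r \<or> p \<in> set (multichain_of c rs)" using Cons.prems(3) by simp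
  ultimately show ?case using IH by metis
qed simp

lemma funpow_commute_self: "(f ^^ m) \<circ> f = f \<circ> (f ^^ m)"
  by (induction m) (auto simp: fun_eq_iff funpow_swap1)

lemma funpow_permutes: "f permutes A \<Longrightarrow> (f ^^ m) permutes A"
  by (induction m) (simp_all only: funpow.simps permutes_id permutes_compose)

text \<open>A full round through the \<open>k\<close> classes applies the long cycle of \<open>{1..N}\<close> once, in every class.\<close>

lemma long_cycle_funpow_pos:
  assumes i: "i < k" and j: "j \<in> {1..N}"
  shows "(long_cycle (k * N) ^^ (k * m)) (pos k i j) = pos k i ((long_cycle N ^^ m) j)"
proof -
  let ?C = "long_cycle (k * N)"
  have up: "(?C ^^ m) (pos k i j) = pos k (i + m) j" if "i + m < k" "j \<in> {1..N}" for i j m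
    using that
  proof (induction m)
    case (Suc m)
    then show ?case using long_cycle_pos[of "i + m" k j N] by simp
  qed simp
  have k: "0 < k" using i by linarith
  have round: "(?C ^^ k) (pos k i j) = pos k i (long_cycle N j)" if j: "j \<in> {1..N}" for j
  proof -
    define t where "t = k - Suc i"
    have t: "i + t < k" "\<not> Suc (i + t) < k" "k = i + Suc t" using i by (auto simp: t_def)
    have cj: "long_cycle N j \<in> {1..N}" using permutes_in_image[OF long_cycle_permutes, of N j] j by simp
    have "(?C ^^ Suc t) (pos k i j) = pos k 0 (long_cycle N j)"
      using up[OF t(1) j] long_cycle_pos[OF t(1) j] t(2) by simp
    then have "(?C ^^ i) ((?C ^^ Suc t) (pos k i j)) = pos k i (long_cycle N j)"
      using up[of 0 i "long_cycle N j"] i cj by simp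
    moreover have "?C ^^ k = (?C ^^ i) \<circ> (?C ^^ Suc t)" unfolding t(3) by (rule funpow_add)
    ultimately show ?thesis by simp
  qed
  have "(?C ^^ (k * m)) (pos k i j) = pos k i ((long_cycle N ^^ m) j) \<and> (long_cycle N ^^ m) j \<in> {1..N}"
  proof (induction m)
    case (Suc m)
    have "(?C ^^ (k * Suc m)) (pos k i j) = (?C ^^ k) ((?C ^^ (k * m)) (pos k i j))" by (simp add: funpow_add)
    then show ?case
      using Suc round[of "(long_cycle N ^^ m) j"] permutes_in_image[OF long_cycle_permutes, of N "(long_cycle N ^^ m) j"]
      by simp
  qed (use j in simp)
  then show ?thesis ..
qed

lemma long_cycle_funpow:
  assumes "x \<in> {1..M}" "t \<le> M"
  shows "(long_cycle M ^^ t) x = (if x + t \<le> M then x + t else x + t - M)"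
  using assms(2)
proof (induction t)
  case 0
  then show ?case using assms(1) by simp
next
  case (Suc t)
  then have IH: "(long_cycle M ^^ t) x = (if x + t \<le> M then x + t else x + t - M)" by simp
  consider "x + t < M" | "x + t = M" | "M < x + t" by linarith
  then show ?case
  proof cases
    case 1
    then show ?thesis using IH assms(1) long_cycle_apply(1)[of "x + t" M] by simp
  next
    case 2
    then show ?thesis using IH assms(1) long_cycle_apply(2)[of M] by simp
  next
    case 3
    then have "1 \<le> x + t - M" "x + t - M < M" using Suc.prems assms(1) by auto
    then show ?thesis using 3 IH long_cycle_apply(1)[of "x + t - M" M] by simp
  qed
qed

lemma antipodal_image:
  assumes "B \<subseteq> {1..2 * m}" shows "antipodal m ` B = (long_cycle (2 * m) ^^ m) ` B"
proof (rule image_cong[OF refl])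
  fix x assume "x \<in> B"
  then have x: "x \<in> {1..2 * m}" using assms by auto
  show "antipodal m x = (long_cycle (2 * m) ^^ m) x"
    using long_cycle_funpow[OF x, of m] by (auto simp: antipodal_def)
qed

lemma shuffle_perm_commute_iff:
  assumes rs: "\<And>r. r \<in> set rs \<Longrightarrow> r permutes {1..N}"
    and h: "h permutes {1..N}" and H: "H permutes {1..length rs * N}"
    and Hpos: "\<And>i j. i < length rs \<Longrightarrow> j \<in> {1..N} \<Longrightarrow> H (pos (length rs) i j) = pos (length rs) i (h j)"
  shows "shuffle_perm N rs \<circ> H = H \<circ> shuffle_perm N rs \<longleftrightarrow> (\<forall>r\<in>set rs. r \<circ> h = h \<circ> r)"
proof -
  let ?k = "length rs" and ?s = "shuffle_perm N rs"
  have hN: "h j \<in> {1..N}" if "j \<in> {1..N}" for j using permutes_in_image[OF h] that by simp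
  have rN: "(rs ! i) j \<in> {1..N}" if "i < ?k" "j \<in> {1..N}" for i j by (rule nth_permutes_mem[OF rs that])
  have sH: "?s (H (pos ?k i j)) = pos ?k i ((rs ! i) (h j))" if "i < ?k" "j \<in> {1..N}" for i j
    unfolding Hpos[OF that] by (rule shuffle_perm_pos[OF that(1) hN[OF that(2)]])
  have Hs: "H (?s (pos ?k i j)) = pos ?k i (h ((rs ! i) j))" if "i < ?k" "j \<in> {1..N}" for i j
    unfolding shuffle_perm_pos[OF that] by (rule Hpos[OF that(1) rN[OF that]])
  show ?thesis
  proof
    assume c: "?s \<circ> H = H \<circ> ?s"
    show "\<forall>r\<in>set rs. r \<circ> h = h \<circ> r"
    proof
      fix r assume r: "r \<in> set rs"
      then obtain i where i: "i < ?k" "rs ! i = r" using in_set_conv_nth[of r rs] by auto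
      show "r \<circ> h = h \<circ> r"
      proof
        fix j
        show "(r \<circ> h) j = (h \<circ> r) j"
        proof (cases "j \<in> {1..N}")
          case True
          have "pos ?k i (r (h j)) = pos ?k i (h (r j))"
            using sH[OF i(1) True] Hs[OF i(1) True] fun_cong[OF c, of "pos ?k i j"] i(2) by simp
          moreover have "1 \<le> r (h j)" "1 \<le> h (r j)"
            using rN[OF i(1) hN[OF True]] hN[OF rN[OF i(1) True]] i(2) by auto
          ultimately show ?thesis using pos_eq_iff[OF i(1) _ i(1)] by simp
        next
          case False
          then show ?thesis using permutes_not_in[OF h False] permutes_not_in[OF rs[OF r] False] by simp
        qed
      qed
    qed
  next
    assume c: "\<forall>r\<in>set rs. r \<circ> h = h \<circ> r"
    show "?s \<circ> H = H \<circ> ?s"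
    proof
      fix x
      show "(?s \<circ> H) x = (H \<circ> ?s) x"
      proof (cases "x \<in> {1..?k * N}")
        case True
        then obtain i j where ij: "i < ?k" "j \<in> {1..N}" "x = pos ?k i j" by (rule pos_cases)
        have "rs ! i \<circ> h = h \<circ> rs ! i" using c ij(1) by simp
        then have "(rs ! i) (h j) = h ((rs ! i) j)" by (metis comp_apply)
        then show ?thesis unfolding ij(3) using sH[OF ij(1,2)] Hs[OF ij(1,2)] by simp
      next
        case False
        then show ?thesis using permutes_not_in[OF H False] shuffle_perm_outside[OF False] by simp
      qed
    qed
  qed
qed

text \<open>The conjugate of a noncrossing permutation by a power of the long cycle is again noncrossing,
  hence determined by its orbit partition, which is the image of the original one.\<close>

lemma nc_perm_commute_iff:
  assumes w: "nc_perm M w"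
  shows "w \<circ> (long_cycle M ^^ m) = (long_cycle M ^^ m) \<circ> w \<longleftrightarrow>
    (`) (long_cycle M ^^ m) ` cycle_partition M w = cycle_partition M w"
proof -
  let ?C = "long_cycle M" and ?H = "long_cycle M ^^ m"
  note p = nc_perm_permutes[OF w] and C = long_cycle_permutes[of M]
  have H: "?H permutes {1..M}" by (rule funpow_permutes[OF C])
  define v where "v = ?H \<circ> w \<circ> inv ?H"
  have v: "v permutes {1..M}" unfolding v_def by (intro permutes_compose permutes_inv H p)
  have Hi: "?H \<circ> inv ?H = id" "inv ?H \<circ> ?H = id" using permutes_inv_o[OF H] by auto
  have vw: "v = w \<longleftrightarrow> w \<circ> ?H = ?H \<circ> w"
  proof
    assume "v = w"
    then have "w \<circ> ?H = ?H \<circ> w \<circ> (inv ?H \<circ> ?H)" unfolding v_def by (metis comp_assoc)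
    then show "w \<circ> ?H = ?H \<circ> w" unfolding Hi by simp
  next
    assume c: "w \<circ> ?H = ?H \<circ> w"
    have "v = w \<circ> (?H \<circ> inv ?H)" unfolding v_def c[symmetric] by (simp only: comp_assoc)
    then show "v = w" unfolding Hi by simp
  qed
  have "inv v = ?H \<circ> inv w \<circ> inv ?H"
    unfolding v_def inv_comp_inv(1)[OF H permutes_compose[OF p H]]
      o_inv_distrib[OF permutes_bij[OF H] permutes_bij[OF p]] by (simp only: comp_assoc)
  moreover have "inv ?H \<circ> ?C = ?C \<circ> inv ?H"
    by (rule commute_inv[OF permutes_bij[OF H] funpow_commute_self])
  ultimately have "inv v \<circ> ?C = ?H \<circ> (inv w \<circ> ?C) \<circ> inv ?H" by (simp only: comp_assoc)
  moreover have "inv w \<circ> ?C permutes {1..M}" by (intro permutes_compose permutes_inv p C)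
  ultimately have "tlen M (inv v \<circ> ?C) = tlen M (inv w \<circ> ?C)" using tlen_conj[OF _ H] by metis
  moreover have "tlen M v = tlen M w" unfolding v_def by (rule tlen_conj[OF p H])
  ultimately have nv: "nc_perm M v" using w v unfolding nc_perm_iff abs_le_def by simp
  have "cycle_partition M v = (`) ?H ` cycle_partition M w" unfolding v_def by (rule cycle_partition_conj[OF p H])
  then show ?thesis using nc_perm_eqI[OF nv w] vw by metis
qed

lemma chain_commute_iff:
  assumes n: "1 \<le> n" and k: "1 \<le> k" and ps: "ps \<in> NCk_A (2 * n) k"
  shows "(\<forall>\<pi>\<in>set ps. \<pi> \<circ> (long_cycle (2 * n) ^^ n) = (long_cycle (2 * n) ^^ n) \<circ> \<pi>) \<longleftrightarrow>
    (\<lambda>B. antipodal (k * n) ` B) ` nabla (2 * n) ps = nabla (2 * n) ps"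
proof -
  let ?N = "2 * n" and ?M = "k * (2 * n)"
  have N: "1 \<le> ?N" using n by simp
  let ?h = "long_cycle ?N ^^ n" and ?H = "long_cycle ?M ^^ (k * n)" and ?c = "long_cycle ?N"
    and ?rs = "chain_quotients ?N ps" and ?C = "long_cycle ?M"
  note lr = length_chain_quotients[OF N k ps] and pr = chain_quotients_permutes[OF N k ps]
  have ch: "?c \<circ> ?h = ?h \<circ> ?c" by (rule sym[OF funpow_commute_self])
  have h: "?h permutes {1..?N}" and H: "?H permutes {1..?M}"
    by (intro funpow_permutes long_cycle_permutes)+
  have "(\<forall>\<pi>\<in>set ps. \<pi> \<circ> ?h = ?h \<circ> \<pi>) \<longleftrightarrow> (\<forall>r\<in>set ?rs. r \<circ> ?h = ?h \<circ> r)"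
  proof
    assume a: "\<forall>\<pi>\<in>set ps. \<pi> \<circ> ?h = ?h \<circ> \<pi>"
    have "bij p \<and> p \<circ> ?h = ?h \<circ> p" if "p \<in> set (ps @ [?c])" for p
      using a ch that permutes_bij[OF chain_permutes[OF N k ps that]] by auto
    then show "\<forall>r\<in>set ?rs. r \<circ> ?h = ?h \<circ> r"
      unfolding chain_quotients_def using quotients_commute[of "ps @ [?c]" ?h] by blast
  next
    assume a: "\<forall>r\<in>set ?rs. r \<circ> ?h = ?h \<circ> r"
    have "bij r \<and> r \<circ> ?h = ?h \<circ> r" if "r \<in> set ?rs" for r
      using a that permutes_bij[OF pr[OF that]] by simp
    then have "p \<circ> ?h = ?h \<circ> p" if "p \<in> set (ps @ [?c])" for p
      using multichain_of_commute[OF ch, of ?rs p] that unfolding multichain_of_chain_quotients[OF N k ps] by blast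
    then show "\<forall>\<pi>\<in>set ps. \<pi> \<circ> ?h = ?h \<circ> \<pi>" by simp
  qed
  also have "\<dots> \<longleftrightarrow> shuffle_perm ?N ?rs \<circ> ?H = ?H \<circ> shuffle_perm ?N ?rs"
  proof (rule sym, rule shuffle_perm_commute_iff[OF _ h])
    show "?H permutes {1..length ?rs * ?N}" unfolding lr by (rule H)
    show "?H (pos (length ?rs) i j) = pos (length ?rs) i (?h j)" if "i < length ?rs" "j \<in> {1..?N}" for i j
      using that unfolding lr by (rule long_cycle_funpow_pos)
  qed (rule pr)
  also have "\<dots> \<longleftrightarrow> shuffle_complement ?N ?rs \<circ> ?H = ?H \<circ> shuffle_complement ?N ?rs"
  proof -
    note s = nc_perm_permutes[OF nc_perm_shuffle_chain[OF N k ps]]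
      and w = nc_perm_permutes[OF nc_perm_shuffle_complement[OF N k ps]]
    have CH: "?C \<circ> ?H = ?H \<circ> ?C" by (rule sym[OF funpow_commute_self])
    have sc: "shuffle_complement ?N ?rs = ?C \<circ> inv (shuffle_perm ?N ?rs)"
      unfolding shuffle_complement_def lr ..
    have cs: "shuffle_perm ?N ?rs = inv (shuffle_complement ?N ?rs) \<circ> ?C"
      unfolding sc by (rule sym[OF inv_comp_cancel(1)[OF s long_cycle_permutes]])
    show ?thesis
    proof
      assume "shuffle_perm ?N ?rs \<circ> ?H = ?H \<circ> shuffle_perm ?N ?rs"
      then show "shuffle_complement ?N ?rs \<circ> ?H = ?H \<circ> shuffle_complement ?N ?rs"
        unfolding sc by (intro commute_comp[OF CH] commute_inv[OF permutes_bij[OF s]])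
    next
      assume "shuffle_complement ?N ?rs \<circ> ?H = ?H \<circ> shuffle_complement ?N ?rs"
      then have "inv (shuffle_complement ?N ?rs) \<circ> ?H = ?H \<circ> inv (shuffle_complement ?N ?rs)"
        by (rule commute_inv[OF permutes_bij[OF w]])
      then have "(inv (shuffle_complement ?N ?rs) \<circ> ?C) \<circ> ?H = ?H \<circ> (inv (shuffle_complement ?N ?rs) \<circ> ?C)"
        by (rule commute_comp[OF _ CH])
      then show "shuffle_perm ?N ?rs \<circ> ?H = ?H \<circ> shuffle_perm ?N ?rs" unfolding cs[symmetric] .
    qed
  qed
  also have "\<dots> \<longleftrightarrow> (`) ?H ` nabla ?N ps = nabla ?N ps"
    unfolding nabla_eq[OF N k ps] by (rule nc_perm_commute_iff[OF nc_perm_shuffle_complement[OF N k ps]])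
  also have "(`) ?H ` nabla ?N ps = (\<lambda>B. antipodal (k * n) ` B) ` nabla ?N ps"
  proof (rule image_cong[OF refl])
    fix B assume "B \<in> nabla ?N ps"
    then have "B \<subseteq> {1..2 * (k * n)}"
      using nabla_in_NC[OF N k ps] by (auto simp: NC_def partition_on_def mult.left_commute)
    then show "?H ` B = antipodal (k * n) ` B" using antipodal_image[of B "k * n"] by (simp add: mult.left_commute)
  qed
  finally show ?thesis .
qed

section \<open>The isomorphism\<close>

lemma partial_order_on_pullback:
  assumes B: "partial_order_on B {(x, y). x \<in> B \<and> y \<in> B \<and> le_B x y}" and f: "bij_betw f A B"
    and le: "\<And>x y. x \<in> A \<Longrightarrow> y \<in> A \<Longrightarrow> le_A x y \<longleftrightarrow> le_B (f x) (f y)"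
  shows "partial_order_on A {(x, y). x \<in> A \<and> y \<in> A \<and> le_A x y}"
proof -
  have fA: "f x \<in> B" if "x \<in> A" for x using f that by (auto simp: bij_betw_def)
  have inj: "x = y" if "x \<in> A" "y \<in> A" "f x = f y" for x y
    using f that by (auto simp: bij_betw_def inj_on_def)
  have refl_B: "le_B x x" if "x \<in> B" for x
    using B that by (auto simp: order_on_defs refl_on_def)
  have trans_B: "le_B x z" if "le_B x y" "le_B y z" "x \<in> B" "y \<in> B" "z \<in> B" for x y z
  proof -
    have "trans {(x, y). x \<in> B \<and> y \<in> B \<and> le_B x y}" using B by (simp add: order_on_defs)
    then show ?thesis using that by (blast dest: transD)
  qed
  have antisym_B: "x = y" if "le_B x y" "le_B y x" "x \<in> B" "y \<in> B" for x y
  proof -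
    have "antisym {(x, y). x \<in> B \<and> y \<in> B \<and> le_B x y}" using B by (simp add: order_on_defs)
    then show ?thesis using that by (blast dest: antisymD)
  qed
  let ?R = "{(x, y). x \<in> A \<and> y \<in> A \<and> le_A x y}"
  have "?R \<subseteq> A \<times> A" by auto
  moreover have "refl_on A ?R" using le refl_B fA by (auto simp: refl_on_def)
  moreover have "trans ?R"
  proof (rule transI)
    fix x y z assume "(x, y) \<in> ?R" "(y, z) \<in> ?R"
    then show "(x, z) \<in> ?R" using le trans_B[of "f x" "f y" "f z"] fA by auto
  qed
  moreover have "antisym ?R"
  proof (rule antisymI)
    fix x y assume "(x, y) \<in> ?R" "(y, x) \<in> ?R"
    then show "x = y" using le antisym_B[of "f x" "f y"] fA inj by auto
  qed
  ultimately show ?thesis by (simp add: order_on_defs)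
qed

lemma partial_order_on_refines:
  assumes "\<And>P. P \<in> S \<Longrightarrow> partition_on A P"
  shows "partial_order_on S {(P, Q). P \<in> S \<and> Q \<in> S \<and> refines A P Q}"
proof -
  let ?R = "{(P, Q). P \<in> S \<and> Q \<in> S \<and> refines A P Q}"
  have "?R \<subseteq> S \<times> S" by auto
  moreover have "refl_on S ?R" using refines_refl assms by (auto simp: refl_on_def)
  moreover have "trans ?R"
  proof (rule transI)
    fix P Q U assume "(P, Q) \<in> ?R" "(Q, U) \<in> ?R"
    then show "(P, U) \<in> ?R" using refines_trans[of A P Q U] by simp
  qed
  moreover have "antisym ?R"
  proof (rule antisymI)
    fix P Q assume "(P, Q) \<in> ?R" "(Q, P) \<in> ?R"
    then show "P = Q" using refines_asym[of A P Q] by simp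
  qed
  ultimately show ?thesis by (simp add: order_on_defs)
qed

lemma nabla_image_NCk_B:
  assumes n: "1 \<le> n" and k: "1 \<le> k" shows "nabla (2 * n) ` NCk_B n k = NC_tilde k n"
proof
  have N: "1 \<le> 2 * n" using n by simp
  have M: "2 * k * n = k * (2 * n)" by simp
  show "nabla (2 * n) ` NCk_B n k \<subseteq> NC_tilde k n"
  proof (rule image_subsetI)
    fix ps assume "ps \<in> NCk_B n k"
    then have ps: "ps \<in> NCk_A (2 * n) k"
      and com: "\<forall>\<pi>\<in>set ps. \<pi> \<circ> (long_cycle (2 * n) ^^ n) = (long_cycle (2 * n) ^^ n) \<circ> \<pi>"
      unfolding NCk_B_def by blast+
    have inv: "(\<lambda>B. antipodal (k * n) ` B) ` nabla (2 * n) ps = nabla (2 * n) ps"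
      using com unfolding chain_commute_iff[OF n k ps] .
    show "nabla (2 * n) ps \<in> NC_tilde k n"
      unfolding NC_tilde_def M
      by (intro CollectI conjI ballI inv nabla_in_NC[OF N k ps]) (rule nabla_card_dvd[OF N k ps])
  qed
  show "NC_tilde k n \<subseteq> nabla (2 * n) ` NCk_B n k"
  proof
    fix P assume "P \<in> NC_tilde k n"
    then have P: "P \<in> NC (k * (2 * n))" and dvd: "\<And>B. B \<in> P \<Longrightarrow> k dvd card B"
      and inv: "(\<lambda>B. antipodal (k * n) ` B) ` P = P"
      unfolding NC_tilde_def M by blast+
    obtain w where w: "nc_perm (k * (2 * n)) w" "cycle_partition (k * (2 * n)) w = P"
      using nc_perm_of_partition[OF P] by blast
    obtain ps where ps: "ps \<in> NCk_A (2 * n) k" "nabla (2 * n) ps = P"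
      using nabla_surj[OF N k w(1)] dvd unfolding w(2) by metis
    have "\<forall>\<pi>\<in>set ps. \<pi> \<circ> (long_cycle (2 * n) ^^ n) = (long_cycle (2 * n) ^^ n) \<circ> \<pi>"
      using inv unfolding chain_commute_iff[OF n k ps(1)] ps(2) .
    then have "ps \<in> NCk_B n k" using ps(1) unfolding NCk_B_def by blast
    then show "P \<in> nabla (2 * n) ` NCk_B n k" using ps(2) by (intro image_eqI[of P _ ps]) simp_all
  qed
qed

theorem theorem4p5p6:
  fixes n k :: nat
  assumes "n \<ge> 1" and "k \<ge> 1"
  shows "(\<forall>ps \<in> NCk_A (2 * n) k.
            shuffle_partition (kreweras_sequence (2 * n) ps) \<in> kreweras (2 * k * n) ` NC (2 * k * n)) \<and>
         poset_iso (NCk_B n k) (NCk_le (2 * n)) (NC_tilde k n) (refines {1..2 * k * n}) (nabla (2 * n))"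
proof (intro conjI ballI)
  have N: "1 \<le> 2 * n" using assms(1) by simp
  have M: "2 * k * n = k * (2 * n)" by simp
  show "shuffle_partition (kreweras_sequence (2 * n) ps) \<in> kreweras (2 * k * n) ` NC (2 * k * n)"
    if "ps \<in> NCk_A (2 * n) k" for ps
    unfolding M by (rule shuffle_in_kreweras_image[OF N assms(2) that])
  have sub: "NCk_B n k \<subseteq> NCk_A (2 * n) k" by (auto simp: NCk_B_def)
  have bij: "bij_betw (nabla (2 * n)) (NCk_B n k) (NC_tilde k n)"
    unfolding bij_betw_def
    using inj_on_subset[OF inj_on_nabla[OF N assms(2)] sub] nabla_image_NCk_B[OF assms] by blast
  have le: "NCk_le (2 * n) ps qs \<longleftrightarrow> refines {1..2 * k * n} (nabla (2 * n) ps) (nabla (2 * n) qs)"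
    if "ps \<in> NCk_B n k" "qs \<in> NCk_B n k" for ps qs
    unfolding M by (rule NCk_le_iff_refines[OF N assms(2)]) (use that sub in blast)+
  have po: "partial_order_on (NC_tilde k n) {(P, Q). P \<in> NC_tilde k n \<and> Q \<in> NC_tilde k n \<and> refines {1..2 * k * n} P Q}"
    by (rule partial_order_on_refines) (simp add: NC_tilde_def NC_def)
  show "poset_iso (NCk_B n k) (NCk_le (2 * n)) (NC_tilde k n) (refines {1..2 * k * n}) (nabla (2 * n))"
    unfolding poset_iso_def using partial_order_on_pullback[OF po bij le] po bij le by blast
qed

end
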